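(* Let $\xi$ be a random variable with values in $\mathbb{N}_0$, with $p_k=\mathbb{P}(\xi=k)$, mean $\mu=\mathbb{E}\,\xi$, probability generating function $g(x)=\sum_{k\ge0}p_kx^k$, and let $q$ be the extinction probability of the Galton-Watson process with offspring distribution $\xi$. Consider the $(1,1)$ Maker-Breaker game on the corresponding Galton-Watson tree $T$ in the regime $I(v)=|T_v|$, and let $p$ be the winning probability of Breaker (with Breaker starting the game). Then $p$ is a solution to $$x^2\,(1-q)=g\big(x\,(1-q)+q\big)-q.$$ To be more precise: $p=1$ in case $\mu\le 2$ and $p_2\ne 1$; $p=0$ if $\xi\ge 2$ almost surely; and for $\mu>2$ and $p_0+p_1>0$, $p$ equals the (unique) solution of this equation in $(0,1)$.
   Context: The Galton-Watson tree $T$ is the random rooted family tree with root $\mathbf{0}$ in which all individuals have independent numbers of children distributed as $\xi$; $T_v$ is the subtree of $T$ rooted in $v$ (formed by $v$ and its descendants), and $|T_v|\in\mathbb{N}\cup\{\infty\}$ is its number of vertices. The extinction probability is $q=\lim_n\mathbb{P}(Z_n=0)$, where $Z_n$ is the number of individuals in generation $n$. In the $(1,1)$ Maker-Breaker game the two players move alternately; in each turn a player picks one available edge: Maker fixates it (securing it permanently from deletion), Breaker removes it. Breaker wins once the root is contained in a finite component separated from the rest of the graph by removed edges; otherwise Maker wins. Both players play optimally. The number $p$ is the probability that Breaker succeeds in isolating the root in a finite component, given that Breaker makes the first move. Internal nodes are those connected to the root by fixated edges (including the root); external nodes are children of internal nodes that are neither internal nor cut off from the root. Regime $I(v)=|T_v|$: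 the tree is explored during the game; besides the current internal and external nodes, both players are told, once a node $v$ is internal or external, the size $|T_v|$ of its subtree (in particular whether $v$ has infinite progeny), but not the structure of $T_v$.
   Formalization: When q<1, p is taken as the probability that Breaker wins given that T is infinite (for p_0>0 and μ>2 the claim fails for the unconditional probability, which is at least q); the unconditional winning probability is shown to be q+(1-q)p. *)

theory Defs
  imports "HOL-Probability.Probability" "HOL-Library.Sublist" "HOL-Library.Extended_Nat"
begin

section \<open>Galton-Watson trees\<close>

text \<open>Vertices carry Ulam-Harris labels: the root is the empty list, the children of \<open>v\<close> are
  \<open>v @ [0], v @ [1], \<dots>\<close>. Offspring numbers are attached to all labels; only those of labels
  belonging to the tree matter. The edge joining \<open>v \<noteq> []\<close> to its parent is represented by \<open>v\<close>.\<close>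

type_synonym node = "nat list"

definition GW :: "nat pmf \<Rightarrow> (node \<Rightarrow> nat) measure" where
  "GW xi = (\<Pi>\<^sub>M v\<in>UNIV. measure_pmf xi)"

inductive_set gw_tree :: "(node \<Rightarrow> nat) \<Rightarrow> node set" for c :: "node \<Rightarrow> nat" where
  root: "[] \<in> gw_tree c"
| child: "v \<in> gw_tree c \<Longrightarrow> k < c v \<Longrightarrow> v @ [k] \<in> gw_tree c"

definition subtree :: "(node \<Rightarrow> nat) \<Rightarrow> node \<Rightarrow> node set" where
  "subtree c v = {w \<in> gw_tree c. prefix v w}"

definition subtree_size :: "(node \<Rightarrow> nat) \<Rightarrow> node \<Rightarrow> enat" where
  "subtree_size c v = (if finite (subtree c v) then enat (card (subtree c v)) else \<infinity>)"

definition generation_size :: "(node \<Rightarrow> nat) \<Rightarrow> nat \<Rightarrow> nat" where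
  "generation_size c n = card {v \<in> gw_tree c. length v = n}"

definition extinction_prob :: "nat pmf \<Rightarrow> real" where
  "extinction_prob xi = lim (\<lambda>n. \<P>(c in GW xi. generation_size c n = 0))"

definition offspring_mean :: "nat pmf \<Rightarrow> ennreal" where
  "offspring_mean xi = (\<integral>\<^sup>+ k. of_nat k \<partial>measure_pmf xi)"

definition offspring_pgf :: "nat pmf \<Rightarrow> real \<Rightarrow> real" where
  "offspring_pgf xi x = (\<Sum>k. pmf xi k * x ^ k)"


section \<open>The game\<close>

text \<open>A position consists of the set of fixated edges and the set of removed edges.\<close>

type_synonym position = "node set \<times> node set"

definition path_edges :: "node \<Rightarrow> node set" where
  "path_edges v = {u. prefix u v \<and> u \<noteq> []}"

definition internal :: "(node \<Rightarrow> nat) \<Rightarrow> position \<Rightarrow> node set" where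
  "internal c s = {v \<in> gw_tree c. path_edges v \<subseteq> fst s}"

definition root_component :: "(node \<Rightarrow> nat) \<Rightarrow> position \<Rightarrow> node set" where
  "root_component c s = {v \<in> gw_tree c. path_edges v \<inter> snd s = {}}"

definition external :: "(node \<Rightarrow> nat) \<Rightarrow> position \<Rightarrow> node set" where
  "external c s = {v \<in> root_component c s. v \<notin> internal c s \<and> butlast v \<in> internal c s}"

text \<open>What both players are shown in a position: the internal nodes, the external nodes, and the
  sizes of the subtrees rooted in these nodes.\<close>

type_synonym observation = "node set \<times> node set \<times> (node \<rightharpoonup> enat)"

definition observe :: "(node \<Rightarrow> nat) \<Rightarrow> position \<Rightarrow> observation" where
  "observe c s = (internal c s, external c s,
     (\<lambda>v. Some (subtree_size c v)) |` (internal c s \<union> external c s))"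

text \<open>A strategy selects, on the basis of everything observed so far, an external node, i.e. one of
  the known unclaimed edges in the component of the root.\<close>

type_synonym strategy = "observation list \<Rightarrow> node"

definition strategies :: "strategy set" where
  "strategies = {\<sigma>. \<forall>h I E S. E \<noteq> {} \<longrightarrow> \<sigma> (h @ [(I, E, S)]) \<in> E}"

text \<open>The list of the first \<open>n + 1\<close> positions when Breaker uses \<open>\<sigma>\<close>, Maker uses \<open>\<tau>\<close>, and Breaker
  makes the first move. When no external node is left, the position no longer changes; the
  component of the root then consists of the finitely many internal nodes.\<close>

primrec play :: "strategy \<Rightarrow> strategy \<Rightarrow> (node \<Rightarrow> nat) \<Rightarrow> nat \<Rightarrow> position list" where
  "play \<sigma> \<tau> c 0 = [({}, {})]"
| "play \<sigma> \<tau> c (Suc n) =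
    (let ss = play \<sigma> \<tau> c n; h = map (observe c) ss; s = last ss
     in ss @ [if external c s = {} then s
              else if even n then (fst s, insert (\<sigma> h) (snd s))
              else (insert (\<tau> h) (fst s), snd s)])"

definition breaker_wins :: "strategy \<Rightarrow> strategy \<Rightarrow> (node \<Rightarrow> nat) \<Rightarrow> bool" where
  "breaker_wins \<sigma> \<tau> c \<longleftrightarrow> (\<exists>n. finite (root_component c (last (play \<sigma> \<tau> c n))))"

text \<open>Optimal play: the minimax value, with Breaker maximising and Maker minimising.\<close>

definition game_value :: "(strategy \<Rightarrow> strategy \<Rightarrow> real) \<Rightarrow> real \<Rightarrow> bool" where
  "game_value w p \<longleftrightarrow>
     (SUP \<sigma>\<in>strategies. INF \<tau>\<in>strategies. w \<sigma> \<tau>) = p \<and>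
     (INF \<tau>\<in>strategies. SUP \<sigma>\<in>strategies. w \<sigma> \<tau>) = p"

definition win_prob :: "nat pmf \<Rightarrow> strategy \<Rightarrow> strategy \<Rightarrow> real" where
  "win_prob xi \<sigma> \<tau> = \<P>(c in GW xi. breaker_wins \<sigma> \<tau> c)"

text \<open>The probability that Breaker wins, given that the tree is infinite. On a finite tree Breaker
  has won before the first move, hence wins with probability at least \<open>q\<close>, whereas the solution of
  \<open>x\<^sup>2 (1 - q) = g (x (1 - q) + q) - q\<close> in \<open>(0, 1)\<close> may be smaller than \<open>q\<close> (take
  \<open>p\<^sub>0 = 31/63\<close>, \<open>p\<^sub>6 = 32/63\<close>, so \<open>q = 1/2\<close>; the solution is about \<open>0.13\<close>): the equation
  describes the conditional probability. If the tree is almost surely finite, there is nothing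
  to condition on and the unconditional probability is used.\<close>

definition win_prob_given_survival :: "nat pmf \<Rightarrow> strategy \<Rightarrow> strategy \<Rightarrow> real" where
  "win_prob_given_survival xi \<sigma> \<tau> =
     (if extinction_prob xi < 1
      then \<P>(c in GW xi. breaker_wins \<sigma> \<tau> c \<bar> infinite (gw_tree c))
      else win_prob xi \<sigma> \<tau>)"

end

theory Submission
  imports Defs
begin

text \<open>Only the number \<open>L\<close> of external nodes with an infinite subtree matters: Breaker wins as soon as
  \<open>L = 0\<close>, and both players should always play at such a node. Conditionally on survival a node has
  \<open>K \<ge> 1\<close> children with infinite subtrees, where \<open>t E[t\<^sup>K\<^sup>-\<^sup>1] (1 - q) = g (t (1 - q) + q) - q\<close>. A round in
  which both players do so changes \<open>L\<close> by \<open>K - 2\<close>, so that the value is the probability that this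
  walk, started at an independent copy of \<open>K\<close>, reaches 1: the least fixed point of the generating
  function \<open>\<phi>\<close> of \<open>K - 1\<close>. Against arbitrary strategies the bounds are obtained from the potential
  \<open>y ^ (L - 1)\<close>. Since the subtree below an external node has only been observed to be infinite, it may be
  replaced by any other infinite tree without changing the past of the game; together with the
  invariance of the distribution under resampling a subtree this yields the required independence.\<close>

section \<open>Probability generating functions\<close>

text \<open>Strategies are arbitrary functions of the history, with no measurability imposed.
  Probability is rescued by the fact that every stage of a play, observations included, takes only
  countably many values, so that any function of it is measurable. The exponent in
  \<open>y ^ (L - 1)\<close> is a truncated difference on purpose: at Breaker's turn both
  \<open>L = 0\<close> and \<open>L = 1\<close> are won for him, and both get weight 1. The stated
  equation is the fixed-point equation \<phi>(x) = x multiplied by x (1 - q). Given survival, K has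
  the same mean \<mu> as the offspring law, so K - 1 has mean \<mu> - 1; this is the origin of the
  threshold 2, and \<open>pmf xi 2 = 1\<close> is the critical case in which \<phi> is the identity.
  The two bounds are not symmetric. At the fixed point the potential directly bounds what a greedy
  Maker concedes, but it does not tell Breaker's wins from endless games (for x = 1 it is constant),
  hence the detour over y < x. Expectations are taken over the restriction of the Galton-Watson law
  to infinite trees, not under a conditional measure.\<close>

lemma integrable_power_pmf:
  fixes X :: "nat pmf" and t :: real
  assumes "0 \<le> t" "t \<le> 1"
  shows "integrable (measure_pmf X) (\<lambda>k. t ^ k)"
  using assms
  by (intro measure_pmf.integrable_const_bound[where B = 1]) (auto simp: power_le_one)

lemma pgf_sums:
  assumes "0 \<le> t" "t \<le> 1"
  shows "(\<lambda>k. pmf X k * t ^ k) sums offspring_pgf X t"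
    and "offspring_pgf X t = measure_pmf.expectation X (\<lambda>k. t ^ k)"
proof -
  have "integrable (density (count_space UNIV) (pmf X)) (\<lambda>k. t ^ k)"
    using integrable_power_pmf[OF assms, of X] by (simp add: measure_pmf_eq_density)
  then have *: "integrable (count_space UNIV) (\<lambda>k. pmf X k * t ^ k)"
    by (subst (asm) integrable_density) auto
  have "measure_pmf.expectation X (\<lambda>k. t ^ k)
      = integral\<^sup>L (density (count_space UNIV) (pmf X)) (\<lambda>k. t ^ k)"
    by (simp add: measure_pmf_eq_density)
  also have "\<dots> = integral\<^sup>L (count_space UNIV) (\<lambda>k. pmf X k * t ^ k)"
    by (subst integral_density) auto
  finally have E: "measure_pmf.expectation X (\<lambda>k. t ^ k)
      = integral\<^sup>L (count_space UNIV) (\<lambda>k. pmf X k * t ^ k)" .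
  from sums_integral_count_space_nat[OF *] show "(\<lambda>k. pmf X k * t ^ k) sums offspring_pgf X t"
    by (simp add: offspring_pgf_def sums_iff)
  from sums_integral_count_space_nat[OF *] E
  show "offspring_pgf X t = measure_pmf.expectation X (\<lambda>k. t ^ k)"
    by (simp add: offspring_pgf_def sums_iff)
qed

lemma pgf_mono:
  assumes "0 \<le> s" "s \<le> t" "t \<le> 1"
  shows "offspring_pgf X s \<le> offspring_pgf X t"
proof -
  have "measure_pmf.expectation X (\<lambda>k. s ^ k) \<le> measure_pmf.expectation X (\<lambda>k. t ^ k)"
    using assms by (intro integral_mono integrable_power_pmf power_mono) auto
  then show ?thesis
    using pgf_sums(2)[of s X] pgf_sums(2)[of t X] assms by simp
qed

lemma pgf_one [simp]: "offspring_pgf X 1 = 1"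
  using pgf_sums(2)[of 1 X] by simp

lemma pgf_zero [simp]: "offspring_pgf X 0 = pmf X 0"
  unfolding offspring_pgf_def by (rule powser_zero)

lemma pgf_nonneg: "0 \<le> t \<Longrightarrow> t \<le> 1 \<Longrightarrow> 0 \<le> offspring_pgf X t"
  using pgf_mono[of 0 t X] pmf_nonneg[of X 0] unfolding pgf_zero by linarith

lemma pgf_le_one: "0 \<le> t \<Longrightarrow> t \<le> 1 \<Longrightarrow> offspring_pgf X t \<le> 1"
  using pgf_mono[of t 1 X] by simp

section \<open>Fixed points in the subcritical and the supercritical case\<close>

lemma pgf_support_le_one:
  assumes "set_pmf X \<subseteq> {0, 1}" "0 \<le> t" "t \<le> 1"
  shows "offspring_pgf X t = 1 - pmf X 1 + pmf X 1 * t"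
    and "offspring_mean X = ennreal (pmf X 1)"
proof -
  have "measure_pmf.prob X {0, 1} = 1"
    using assms(1) by (simp add: measure_pmf.prob_eq_1 AE_measure_pmf_iff subset_eq)
  then have "pmf X 0 + pmf X 1 = 1"
    by (simp add: measure_measure_pmf_finite)
  moreover have "offspring_pgf X t = pmf X 0 + pmf X 1 * t"
    using assms by (simp add: pgf_sums(2) integral_measure_pmf[of "{0, 1}"] subset_eq)
  ultimately show "offspring_pgf X t = 1 - pmf X 1 + pmf X 1 * t" by simp
  show "offspring_mean X = ennreal (pmf X 1)"
    unfolding offspring_mean_def using assms(1)
    by (subst nn_integral_measure_pmf_support[of "{0, 1}"]) auto
qed

text \<open>Bernoulli's inequality; its strictness from k = 2 on is what later excludes every
  support point outside {0, 1}.\<close>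

lemma one_minus_power_less:
  fixes t :: real
  assumes "0 \<le> t" "t < 1" "2 \<le> k"
  shows "1 - t ^ k < real k * (1 - t)"
  using assms(3)
proof (induction k rule: dec_induct)
  case base
  have "real 2 * (1 - t) - (1 - t\<^sup>2) = (1 - t)\<^sup>2"
    by (simp add: power2_eq_square algebra_simps)
  moreover have "(1 - t)\<^sup>2 > 0" using assms by simp
  ultimately show ?case by linarith
next
  case (step k)
  have "1 - t ^ Suc k = (1 - t ^ k) + t ^ k * (1 - t)"
    by (simp add: algebra_simps)
  moreover have "t ^ k * (1 - t) \<le> 1 * (1 - t)"
    using assms by (intro mult_right_mono power_le_one) auto
  ultimately show ?case
    using step.IH by (simp add: algebra_simps)
qed

text \<open>The slack \<open>f\<close> of Bernoulli's inequality is nonnegative, and at a fixed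
  point its expectation is (1 - t)(mean - 1) \<le> 0. So it vanishes almost surely and the support
  lies in {0, 1}, where the generating function is affine and fixes t < 1 only if it is the
  identity.\<close>

lemma pgf_no_fixpoint_subcritical:
  assumes mean: "offspring_mean X \<le> 1" and "pmf X 1 \<noteq> 1" and t: "0 \<le> t" "t < 1"
  shows "offspring_pgf X t \<noteq> t"
proof
  assume fixp: "offspring_pgf X t = t"
  have fin: "(\<integral>\<^sup>+ k. ennreal (real k) \<partial>measure_pmf X) \<le> 1"
    using mean by (simp add: offspring_mean_def ennreal_of_nat_eq_real_of_nat)
  have int: "integrable (measure_pmf X) real"
    using fin by (intro integrableI_nonneg) (auto simp: less_le_trans order.strict_trans1)
  have "ennreal (measure_pmf.expectation X real) \<le> 1"
    using fin nn_integral_eq_integral[OF int] by simp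
  then have E: "measure_pmf.expectation X real \<le> 1"
    by simp
  define f where "f k = (1 - t) * real k - (1 - t ^ k)" for k
  have f0: "f k \<ge> 0" for k
  proof (cases "k \<ge> 2")
    case True
    then show ?thesis
      using one_minus_power_less[of t k] t by (simp add: f_def mult.commute)
  next
    case False
    then have "k = 0 \<or> k = 1" by linarith
    then show ?thesis by (auto simp: f_def)
  qed
  have intf: "integrable (measure_pmf X) f"
    unfolding f_def using t by (intro Bochner_Integration.integrable_diff integrable_mult_right
        integrable_power_pmf int measure_pmf.integrable_const) auto
  have "measure_pmf.expectation X f
      = (1 - t) * measure_pmf.expectation X real - (1 - measure_pmf.expectation X (\<lambda>k. t ^ k))"
    unfolding f_def using t int integrable_power_pmf[of t X] by simp
  also have "\<dots> = (1 - t) * (measure_pmf.expectation X real - 1)"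
    using fixp pgf_sums(2)[of t X] t by (simp add: algebra_simps)
  also have "\<dots> \<le> 0"
    using E t by (simp add: mult_le_0_iff)
  finally have "measure_pmf.expectation X f = 0"
    using f0 by (intro antisym) auto
  then have "AE k in measure_pmf X. f k = 0"
    using integral_nonneg_eq_0_iff_AE[OF intf] f0 by simp
  then have "\<forall>k\<in>set_pmf X. f k = 0"
    by (simp add: AE_measure_pmf_iff)
  moreover have "f k \<noteq> 0" if "k \<ge> 2" for k
    using one_minus_power_less[OF t that] by (simp add: f_def mult.commute)
  ultimately have "set_pmf X \<subseteq> {0, 1}"
    by (auto simp: subset_eq) (metis One_nat_def less_2_cases not_le)
  from pgf_support_le_one(1)[OF this, of t] fixp t have "(1 - pmf X 1) * (1 - t) = 0"
    by (simp add: algebra_simps)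
  with assms show False by simp
qed

text \<open>The quotient (1 - g(t)) / (1 - t) is the sum of p_k (1 + t + ... + t^(k-1)), which at t
  = 1 becomes the mean. A finite partial sum that already exceeds 1 there is a polynomial in t, so
  continuity suffices and infinite means are covered.\<close>

lemma pgf_le_id_supercritical:
  assumes "offspring_mean X > 1"
  obtains t where "0 \<le> t" "t < 1" "offspring_pgf X t \<le> t"
proof -
  have "(1::ennreal) < (\<Sum>k. ennreal (pmf X k) * of_nat k)"
    using assms by (simp add: offspring_mean_def nn_integral_measure_pmf nn_integral_count_space_nat)
  also have "\<dots> = (SUP n. \<Sum>k<n. ennreal (pmf X k) * of_nat k)"
    by (simp add: suminf_eq_SUP)
  finally obtain n where n: "1 < (\<Sum>k<n. ennreal (pmf X k) * of_nat k)"
    by (auto simp: less_SUP_iff)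
  have "(\<Sum>k<n. ennreal (pmf X k) * of_nat k) = ennreal (\<Sum>k<n. pmf X k * real k)"
    by (subst sum_ennreal[symmetric])
       (auto simp: ennreal_of_nat_eq_real_of_nat ennreal_mult intro!: sum.cong)
  with n have n': "1 < (\<Sum>k<n. pmf X k * real k)"
    by (metis ennreal_1 ennreal_less_iff zero_le_one)
  define h where "h t = (\<Sum>k<n. pmf X k * (\<Sum>j<k. t ^ j))" for t :: real
  have "isCont h 1"
    unfolding h_def by (intro continuous_intros)
  moreover have "h 1 > 1"
    using n' by (simp add: h_def)
  ultimately have "\<forall>\<^sub>F t in at 1. h t > 1"
    by (simp add: isCont_def order_tendstoD(1))
  then have "\<forall>\<^sub>F t in at_left 1. h t > 1"
    using eventually_at_split by blast
  moreover have "\<forall>\<^sub>F t in at_left 1. t \<in> {0<..<1::real}"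
    by (rule eventually_at_left_real) simp
  ultimately have "\<forall>\<^sub>F t in at_left 1. h t > 1 \<and> t \<in> {0<..<1::real}"
    by (rule eventually_conj)
  then obtain t where t: "h t > 1" "0 < t" "t < 1"
    using eventually_happens[of _ "at_left (1::real)"] trivial_limit_at_left_real by auto
  have s: "(\<lambda>k. pmf X k * 1 ^ k - pmf X k * t ^ k) sums (1 - offspring_pgf X t)"
    using pgf_sums(1)[of 1 X] pgf_sums(1)[of t X] t by (intro sums_diff) auto
  have "(1 - t) * h t = (\<Sum>k<n. pmf X k * 1 ^ k - pmf X k * t ^ k)"
    unfolding h_def
  proof (subst sum_distrib_left, intro sum.cong refl)
    fix k
    have "(1 - t) * (\<Sum>j<k. t ^ j) = 1 - t ^ k"
      by (simp add: one_diff_power_eq)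
    then have "pmf X k * ((1 - t) * (\<Sum>j<k. t ^ j)) = pmf X k * 1 ^ k - pmf X k * t ^ k"
      by (simp add: right_diff_distrib)
    then show "(1 - t) * (pmf X k * (\<Sum>j<k. t ^ j)) = pmf X k * 1 ^ k - pmf X k * t ^ k"
      by (simp only: mult.left_commute)
  qed
  also have "\<dots> \<le> 1 - offspring_pgf X t"
    unfolding sums_unique[OF s] using s t
    by (intro sum_le_suminf) (auto simp: sums_iff mult_left_le power_le_one)
  finally have "(1 - t) * h t \<le> 1 - offspring_pgf X t" .
  moreover have "(1 - t) * 1 \<le> (1 - t) * h t"
    using t by (intro mult_left_mono) auto
  ultimately have "1 - t \<le> 1 - offspring_pgf X t" by (metis mult_1_right order_trans)
  then show ?thesis using that[of t] t by simp
qed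

text \<open>Strict convexity of the power along the chord from r to 1. In the induction a
  multiplication by \<open>s\<close> leaves the gap l (1 - l)(1 - r)(1 - r^j), which is positive as
  soon as j > 0.\<close>

lemma power_strictly_convex_at_one:
  fixes r :: real
  assumes "0 \<le> r" "r < 1" "0 < l" "l < 1" "2 \<le> k"
  shows "(l * r + (1 - l)) ^ k < l * r ^ k + (1 - l)"
proof -
  define s where "s = l * r + (1 - l)"
  have s: "0 \<le> s" using assms by (simp add: s_def)
  have *: "s * (l * r ^ j + (1 - l)) = l * r ^ Suc j + (1 - l) - l * (1 - l) * (1 - r) * (1 - r ^ j)" for j
    by (simp add: s_def algebra_simps)
  have weak: "s ^ j \<le> l * r ^ j + (1 - l)" for j
  proof (induction j)
    case (Suc j)
    have "s ^ Suc j \<le> s * (l * r ^ j + (1 - l))"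
      using Suc s by (simp add: mult_left_mono)
    moreover have "0 \<le> l * (1 - l) * (1 - r) * (1 - r ^ j)"
      using assms by (intro mult_nonneg_nonneg) (auto simp: power_le_one)
    ultimately show ?case using * by simp
  qed simp
  obtain j where j: "k = Suc j" "j \<noteq> 0" using assms(5) by (cases k) auto
  have "s ^ Suc j \<le> s * (l * r ^ j + (1 - l))"
    using weak[of j] s by (simp add: mult_left_mono)
  moreover have "0 < l * (1 - l) * (1 - r) * (1 - r ^ j)"
    using assms j by (intro mult_pos_pos) (auto simp: power_less_one_iff)
  ultimately show ?thesis using * j by (simp add: s_def)
qed

text \<open>Together with 1 the two fixed points would lie on one chord of a convex function, so the
  convexity gap \<open>f\<close> would have expectation 0. It is positive for k \<ge> 2; hence the
  support would lie in {0, 1} and the mean would be at most 1.\<close>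

lemma pgf_fixpoint_unique_supercritical:
  assumes mean: "offspring_mean X > 1" and rs: "0 \<le> r" "r < s" "s < 1"
    and "offspring_pgf X r = r" "offspring_pgf X s = s"
  shows False
proof -
  define l where "l = (1 - s) / (1 - r)"
  have "l * (1 - r) = 1 - s" using rs by (simp add: l_def)
  then have "s = l * r + (1 - l)"
    by (simp add: algebra_simps)
  then have l: "0 < l" "l < 1" "s = l * r + (1 - l)"
    using rs by (auto simp: l_def)
  define f where "f k = l * r ^ k + (1 - l) - s ^ k" for k
  have pos: "f k > 0" if "k \<ge> 2" for k
    using power_strictly_convex_at_one[of r l k] that l rs by (simp add: f_def)
  have f0: "f k \<ge> 0" for k
  proof (cases "k \<ge> 2")
    case False
    then have "k = 0 \<or> k = 1" by linarith
    then show ?thesis using l(3) by (auto simp: f_def)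
  qed (use pos in force)
  have int: "integrable (measure_pmf X) f"
    unfolding f_def using rs by (intro Bochner_Integration.integrable_diff integrable_mult_right
        Bochner_Integration.integrable_add integrable_power_pmf measure_pmf.integrable_const) auto
  have "measure_pmf.expectation X f = l * measure_pmf.expectation X (\<lambda>k. r ^ k) + (1 - l)
      - measure_pmf.expectation X (\<lambda>k. s ^ k)"
    unfolding f_def using rs integrable_power_pmf[of r X] integrable_power_pmf[of s X] by simp
  also have "\<dots> = l * r + (1 - l) - s"
    using assms pgf_sums(2)[of r X] pgf_sums(2)[of s X] by simp
  finally have "measure_pmf.expectation X f = 0" using l by simp
  then have "AE k in measure_pmf X. f k = 0"
    using integral_nonneg_eq_0_iff_AE[OF int] f0 by simp
  then have "\<forall>k\<in>set_pmf X. f k = 0"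
    by (simp add: AE_measure_pmf_iff)
  then have "set_pmf X \<subseteq> {0, 1}"
    using pos by (auto simp: subset_eq) (metis One_nat_def less_2_cases not_le order_less_irrefl)
  from pgf_support_le_one(2)[OF this, of r] rs mean pmf_le_1[of X 1] show False
    by (metis ennreal_1 ennreal_leI not_less less_imp_le order_trans)
qed

text \<open>Tangent bound for the convex power. For k = 0 the factor \<open>real k\<close> makes the
  truncated exponent harmless.\<close>

lemma power_diff_ge:
  fixes a b :: real
  assumes "0 \<le> a" "a \<le> b"
  shows "real k * a ^ (k - 1) * (b - a) \<le> b ^ k - a ^ k"
proof (induction k)
  case (Suc k)
  have "b ^ Suc k - a ^ Suc k = b * (b ^ k - a ^ k) + a ^ k * (b - a)"
    by (simp add: algebra_simps)
  moreover have "b * (b ^ k - a ^ k) \<ge> a * (b ^ k - a ^ k)"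
    using assms by (intro mult_right_mono) (auto intro: power_mono)
  moreover have "a * (b ^ k - a ^ k) \<ge> a * (real k * a ^ (k - 1) * (b - a))"
    using assms Suc by (intro mult_left_mono) auto
  moreover have "a * (real k * a ^ (k - 1) * (b - a)) = real k * a ^ k * (b - a)"
    by (cases k) auto
  ultimately show ?case by (simp add: algebra_simps)
qed simp

text \<open>Comparing first order terms at \<open>q\<close>: a pgf that is quadratically flat at its fixed point \<open>q\<close>
  has vanishing derivative there.\<close>

lemma pgf_quadratically_flat:
  assumes q: "0 \<le> q" "q < 1" and fixp: "offspring_pgf X q = q"
    and flat: "\<And>t. 0 < t \<Longrightarrow> t \<le> 1 \<Longrightarrow> offspring_pgf X (q + (1 - q) * t) - q \<le> (1 - q) * t\<^sup>2"
  shows "q = 0" "pmf X 0 = 0" "pmf X 1 = 0"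
proof -
  have bound: "pmf X k * (real k * q ^ (k - 1)) \<le> t" if t: "0 < t" "t \<le> 1" for k t
  proof -
    define s where "s = q + (1 - q) * t"
    have s: "q \<le> s" "s - q = (1 - q) * t" using q t by (auto simp: s_def)
    have "(1 - q) * t \<le> 1 - q" using q t by (simp add: mult_left_le)
    then have s1: "s \<le> 1" unfolding s_def by linarith
    note s = s s1
    have sm: "(\<lambda>k. pmf X k * s ^ k - pmf X k * q ^ k) sums (offspring_pgf X s - offspring_pgf X q)"
      using q s by (intro sums_diff pgf_sums(1)) auto
    have "(1 - q) * (t * (pmf X k * (real k * q ^ (k - 1)))) = pmf X k * (real k * q ^ (k - 1) * (s - q))"
      using s by simp
    also have "\<dots> \<le> pmf X k * (s ^ k - q ^ k)"
      using power_diff_ge[of q s k] q s by (intro mult_left_mono) auto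
    also have "\<dots> = (\<Sum>j\<in>{k}. pmf X j * s ^ j - pmf X j * q ^ j)"
      by (simp add: algebra_simps)
    \<comment> \<open>All terms are nonnegative because q \<le> s, so a single one is bounded by the
      whole series.\<close>
    also have "\<dots> \<le> (\<Sum>j. pmf X j * s ^ j - pmf X j * q ^ j)"
      using sm q s
      by (intro sum_le_suminf) (auto simp: sums_iff intro!: mult_left_mono power_mono)
    also have "\<dots> = offspring_pgf X s - q"
      using sm fixp by (simp add: sums_iff)
    also have "\<dots> \<le> (1 - q) * t\<^sup>2"
      using flat[OF t] by (simp add: s_def)
    finally have "t * (pmf X k * (real k * q ^ (k - 1))) \<le> t * t"
      using q by (simp add: power2_eq_square)
    then show ?thesis using t by simp
  qed
  have zero: "pmf X k * (real k * q ^ (k - 1)) = 0" for k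
  proof (rule antisym)
    show "pmf X k * (real k * q ^ (k - 1)) \<le> 0"
    proof (rule field_le_epsilon)
      fix e :: real assume "e > 0"
      with bound[of "min e 1" k] show "pmf X k * (real k * q ^ (k - 1)) \<le> 0 + e" by simp
    qed
  qed (use q in simp)
  show q0: "q = 0"
  proof (rule ccontr)
    assume "q \<noteq> 0"
    with zero have "pmf X k = 0" if "k \<noteq> 0" for k using that by (metis mult_eq_0_iff of_nat_eq_0_iff power_not_zero)
    then have *: "set_pmf X \<subseteq> {0, 1}" "pmf X 1 = 0" by (auto simp: set_pmf_eq)
    from pgf_support_le_one(1)[OF *(1), of q] *(2) q fixp show False by simp
  qed
  show "pmf X 1 = 0" using zero[of 1] by simp
  show "pmf X 0 = 0" using fixp q0 by simp
qed

text \<open>The support starts at 2, where (1/2)^k \<le> (1/2)^2 with equality only for k = 2. So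
  agreement with the square at the single point 1/2 is enough.\<close>

lemma pgf_eq_square_imp:
  assumes "offspring_pgf X (1/2) = (1/2)\<^sup>2" "pmf X 0 = 0" "pmf X 1 = 0"
  shows "pmf X 2 = 1"
proof -
  define f where "f k = (1/2)\<^sup>2 - (1/2 :: real) ^ k" for k
  have supp: "k \<ge> 2" if "k \<in> set_pmf X" for k
  proof -
    have "k \<noteq> 0" "k \<noteq> 1" using that assms by (metis set_pmf_iff)+
    then show ?thesis by linarith
  qed
  have int: "integrable (measure_pmf X) f"
    unfolding f_def by (intro Bochner_Integration.integrable_diff integrable_power_pmf) auto
  have "measure_pmf.expectation X f = (1/2)\<^sup>2 - measure_pmf.expectation X (\<lambda>k. (1/2) ^ k)"
    unfolding f_def using integrable_power_pmf[of "1/2" X] by simp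
  also have "\<dots> = 0"
    using assms(1) by (simp add: pgf_sums(2))
  finally have E: "measure_pmf.expectation X f = 0" .
  have "AE k in measure_pmf X. 0 \<le> f k"
    unfolding AE_measure_pmf_iff f_def using supp by (auto intro!: power_decreasing)
  with E have "AE k in measure_pmf X. f k = 0"
    using integral_nonneg_eq_0_iff_AE[OF int] by simp
  then have "\<forall>k\<in>set_pmf X. (1/2 :: real) ^ k = (1/2)\<^sup>2"
    by (simp add: AE_measure_pmf_iff f_def)
  then have "set_pmf X \<subseteq> {2}"
    by (auto simp: power_inject_exp' simp del: power_one_over)
  then have "measure_pmf.prob X {2} = 1"
    by (simp add: measure_pmf.prob_eq_1 AE_measure_pmf_iff subset_eq)
  then show ?thesis
    by (simp add: measure_pmf_single)
qed

section \<open>Subtrees and grafting\<close>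

definition reroot :: "node \<Rightarrow> (node \<Rightarrow> nat) \<Rightarrow> node \<Rightarrow> nat" where
  "reroot v c = (\<lambda>u. c (v @ u))"

text \<open>All labels below \<open>v\<close> are overwritten, whether or not they belong to the
  tree. The labels kept from \<open>c\<close> and those replaced by \<open>d\<close> are thus
  complementary families of coordinates of the product space.\<close>

definition graft :: "node \<Rightarrow> (node \<Rightarrow> nat) \<Rightarrow> (node \<Rightarrow> nat) \<Rightarrow> node \<Rightarrow> nat" where
  "graft v c d = (\<lambda>u. if prefix v u then d (drop (length v) u) else c u)"

lemma reroot_apply: "reroot v c u = c (v @ u)"
  by (simp add: reroot_def)

lemma reroot_reroot: "reroot u (reroot v c) = reroot (v @ u) c"
  by (simp add: reroot_def)

lemma reroot_graft [simp]: "reroot v (graft v c d) = d"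
  by (simp add: reroot_def graft_def)

lemma reroot_graft_disjoint: "\<not> prefix v u \<Longrightarrow> \<not> prefix u v \<Longrightarrow> reroot u (graft v c d) = reroot u c"
  by (auto simp: reroot_def graft_def prefix_append fun_eq_iff)

lemma gw_tree_Nil [simp]: "[] \<in> gw_tree c"
  by (rule gw_tree.root)

lemma gw_tree_snoc [simp]: "v @ [k] \<in> gw_tree c \<longleftrightarrow> v \<in> gw_tree c \<and> k < c v"
  by (auto elim: gw_tree.cases intro: gw_tree.child)

lemma gw_tree_append: "v @ u \<in> gw_tree c \<longleftrightarrow> v \<in> gw_tree c \<and> u \<in> gw_tree (reroot v c)"
proof (induction u rule: rev_induct)
  case (snoc k u)
  then show ?case
    unfolding append_assoc[symmetric] gw_tree_snoc by (simp add: reroot_def conj_ac)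
qed simp

lemma gw_tree_Cons: "i # u \<in> gw_tree c \<longleftrightarrow> i < c [] \<and> u \<in> gw_tree (reroot [i] c)"
  using gw_tree_append[of "[i]" u c] gw_tree_snoc[of "[]" i c] by simp

lemma gw_tree_prefix: "w \<in> gw_tree c \<Longrightarrow> prefix v w \<Longrightarrow> v \<in> gw_tree c"
  by (auto simp: prefix_def gw_tree_append)

lemma subtree_reroot: "v \<in> gw_tree c \<Longrightarrow> subtree c v = (@) v ` gw_tree (reroot v c)"
  by (auto simp: subtree_def prefix_def gw_tree_append)

lemma finite_subtree_iff:
  "v \<in> gw_tree c \<Longrightarrow> finite (subtree c v) \<longleftrightarrow> finite (gw_tree (reroot v c))"
  by (simp add: subtree_reroot finite_image_iff inj_on_def)

lemma gw_tree_decomp: "gw_tree c = insert [] (\<Union>i<c []. (#) i ` gw_tree (reroot [i] c))"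
proof (rule set_eqI)
  fix w show "w \<in> gw_tree c \<longleftrightarrow> w \<in> insert [] (\<Union>i<c []. (#) i ` gw_tree (reroot [i] c))"
    by (cases w) (auto simp: gw_tree_Cons)
qed

section \<open>Survival through the children of the root, extinction through empty
  generations\<close>

definition immortal_children :: "(node \<Rightarrow> nat) \<Rightarrow> nat set" where
  "immortal_children c = {i. i < c [] \<and> infinite (gw_tree (reroot [i] c))}"

lemma finite_immortal_children [simp]: "finite (immortal_children c)"
  by (simp add: immortal_children_def)

lemma infinite_gw_tree_iff: "infinite (gw_tree c) \<longleftrightarrow> immortal_children c \<noteq> {}"
proof -
  have "finite (gw_tree c) \<longleftrightarrow> (\<forall>i<c []. finite (gw_tree (reroot [i] c)))"
    by (subst gw_tree_decomp) (auto simp: finite_image_iff)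
  then show ?thesis by (auto simp: immortal_children_def)
qed

lemma card_immortal_children_pos: "infinite (gw_tree c) \<Longrightarrow> 0 < card (immortal_children c)"
  by (simp add: infinite_gw_tree_iff card_gt_0_iff)

lemma finite_generation: "finite {v \<in> gw_tree c. length v = n}"
proof (induction n)
  case (Suc n)
  have "{v \<in> gw_tree c. length v = Suc n}
      \<subseteq> (\<Union>v\<in>{v \<in> gw_tree c. length v = n}. (\<lambda>k. v @ [k]) ` {..<c v})"
  proof
    fix w assume w: "w \<in> {v \<in> gw_tree c. length v = Suc n}"
    then obtain v k where "w = v @ [k]" by (auto simp: length_Suc_conv_rev)
    with w show "w \<in> (\<Union>v\<in>{v \<in> gw_tree c. length v = n}. (\<lambda>k. v @ [k]) ` {..<c v})" by auto
  qed
  with Suc show ?case by (auto elim: finite_subset)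
qed (auto intro: finite_subset[of _ "{[]}"])

lemma generation_size_eq_0_iff: "generation_size c n = 0 \<longleftrightarrow> (\<forall>v\<in>gw_tree c. length v \<noteq> n)"
  using finite_generation[of c n] by (auto simp: generation_size_def)

lemma generation_size_eq_0_mono:
  assumes "generation_size c n = 0" "n \<le> m"
  shows "generation_size c m = 0"
  unfolding generation_size_eq_0_iff
proof safe
  fix v assume "v \<in> gw_tree c" "m = length v"
  with assms gw_tree_prefix[of v c "take n v"] show False
    by (auto simp: generation_size_eq_0_iff take_is_prefix)
qed

lemma generation_size_0 [simp]: "generation_size c 0 \<noteq> 0"
  unfolding generation_size_eq_0_iff by force

lemma generation_size_Suc_eq_0_iff:
  "generation_size c (Suc n) = 0 \<longleftrightarrow> (\<forall>i<c []. generation_size (reroot [i] c) n = 0)"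
  unfolding generation_size_eq_0_iff by (subst gw_tree_decomp) auto

text \<open>Offspring numbers are finite, so every generation is finite, and an empty generation has
  only empty successors. This expresses extinction by countably many events.\<close>

lemma finite_gw_tree_iff: "finite (gw_tree c) \<longleftrightarrow> (\<exists>n. generation_size c n = 0)"
proof
  assume fin: "finite (gw_tree c)"
  then have "length v \<noteq> Suc (Max (length ` gw_tree c))" if "v \<in> gw_tree c" for v
    using that Max_ge[of "length ` gw_tree c" "length v"]
    by (metis finite_imageI image_eqI not_less_eq_eq order_refl)
  then show "\<exists>n. generation_size c n = 0"
    by (auto simp: generation_size_eq_0_iff)
next
  assume "\<exists>n. generation_size c n = 0"
  then obtain n where n: "generation_size c n = 0" by blast
  have "gw_tree c \<subseteq> (\<Union>m<n. {v \<in> gw_tree c. length v = m})"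
    using generation_size_eq_0_mono[OF n] by (auto simp: generation_size_eq_0_iff not_less)
       (metis not_less)
  then show "finite (gw_tree c)"
    using finite_generation by (auto intro: finite_subset)
qed

text \<open>The label at \<open>v\<close> only decides about its children, so even the membership of
  \<open>v\<close> itself is unchanged.\<close>

lemma gw_tree_graft:
  assumes "\<not> strict_prefix v u"
  shows "u \<in> gw_tree (graft v c d) \<longleftrightarrow> u \<in> gw_tree c"
  using assms
proof (induction u rule: rev_induct)
  case (snoc k u)
  then have "\<not> prefix v u" by (metis prefix_order.le_less_trans strict_prefix_def prefixI append_self_conv not_Cons_self2)
  with snoc show ?case
    by (auto simp: graft_def strict_prefix_def prefix_length_le dest: prefix_length_le)
qed simp

lemma infinite_subtree_prefix:
  assumes "prefix u v" "v \<in> gw_tree c" "infinite (gw_tree (reroot v c))"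
  shows "infinite (subtree c u)"
proof -
  have "subtree c v \<subseteq> subtree c u"
    using assms by (auto simp: subtree_def)
  with assms show ?thesis
    using finite_subtree_iff[of v c] finite_subset by blast
qed

text \<open>The ancestors of \<open>v\<close>, and \<open>v\<close> itself, have an infinite subtree
  before and after the exchange; the remaining vertices considered keep their subtrees. This is why
  the sizes shown to the players reveal nothing about an infinite subtree except that it is
  infinite.\<close>

lemma subtree_size_graft:
  assumes "\<not> strict_prefix v u" "v \<in> gw_tree c" "infinite (gw_tree (reroot v c))" "infinite (gw_tree d)"
  shows "subtree_size (graft v c d) u = subtree_size c u"
proof (cases "prefix u v")
  case True
  have "v \<in> gw_tree (graft v c d)" using assms(2) by (simp add: gw_tree_graft)
  then have "infinite (subtree (graft v c d) u)" "infinite (subtree c u)"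
    using infinite_subtree_prefix True assms(2-4) by auto
  then show ?thesis by (simp add: subtree_size_def)
next
  case False
  then have np: "\<not> prefix v u" using assms(1) by (auto simp: strict_prefix_def)
  have "\<not> strict_prefix v w" if "prefix u w" for w
    using that np False by (metis prefix_same_cases strict_prefix_def)
  then have "subtree (graft v c d) u = subtree c u"
    by (auto simp: subtree_def gw_tree_graft)
  then show ?thesis by (simp add: subtree_size_def)
qed

section \<open>Discrete functions of the tree\<close>

text \<open>A countable range is built in because it makes the class closed under arbitrary
  functions (\<open>tree_rv_comp\<close>), in particular under strategies. The \<sigma>-algebra is
  that of the labels, whatever the offspring law.\<close>

definition tree_rv :: "((node \<Rightarrow> nat) \<Rightarrow> 'a) \<Rightarrow> bool" where
  "tree_rv F \<longleftrightarrow> countable (range F) \<and> F \<in> (\<Pi>\<^sub>M v\<in>UNIV. count_space UNIV) \<rightarrow>\<^sub>M count_space UNIV"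

lemma sets_GW: "sets (GW xi) = sets (\<Pi>\<^sub>M v\<in>UNIV. count_space UNIV)"
  unfolding GW_def by (rule sets_PiM_cong) simp_all

lemma space_GW [simp]: "space (GW xi) = UNIV"
  by (simp add: GW_def space_PiM)

lemma prob_space_GW: "prob_space (GW xi)"
  unfolding GW_def by (intro prob_space_PiM measure_pmf.prob_space_axioms)

lemma tree_rv_measurable: "tree_rv F \<Longrightarrow> F \<in> GW xi \<rightarrow>\<^sub>M count_space UNIV"
  by (simp add: tree_rv_def measurable_cong_sets[OF sets_GW refl])

lemma tree_rv_countable: "tree_rv F \<Longrightarrow> countable (range F)"
  by (simp add: tree_rv_def)

lemma tree_rv_const: "tree_rv (\<lambda>c. x)"
  by (simp add: tree_rv_def)

lemma tree_rv_component: "tree_rv (\<lambda>c. c v)"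
  by (simp add: tree_rv_def measurable_component_singleton)

text \<open>\<open>H\<close> has to be well behaved only at values that \<open>F\<close> attains.
  Later this gives access to invariants of reached positions, such as finiteness of the fixated
  set.\<close>

lemma tree_rv_bind:
  assumes F: "tree_rv F" and H: "\<And>c. tree_rv (H (F c))"
  shows "tree_rv (\<lambda>c. H (F c) c)"
  unfolding tree_rv_def
proof
  let ?M = "\<Pi>\<^sub>M v\<in>(UNIV :: node set). count_space (UNIV :: nat set)"
  have cF: "countable (range F)" and mF: "F \<in> ?M \<rightarrow>\<^sub>M count_space UNIV"
    using F by (simp_all add: tree_rv_def)
  have cH: "countable (range (H x))" and mH: "H x \<in> ?M \<rightarrow>\<^sub>M count_space UNIV" if x: "x \<in> range F" for x
    using H x by (auto simp: tree_rv_def)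
  have "range (\<lambda>c. H (F c) c) \<subseteq> (\<Union>x\<in>range F. range (H x))" by auto
  moreover have "countable (\<Union>x\<in>range F. range (H x))"
    by (rule countable_UN[OF cF cH])
  ultimately show "countable (range (\<lambda>c. H (F c) c))"
    by (rule countable_subset)
  have "F \<in> ?M \<rightarrow>\<^sub>M count_space (range F)"
  proof (rule measurableI)
    fix A assume "A \<in> sets (count_space (range F))"
    show "F -` A \<inter> space ?M \<in> sets ?M"
      using measurable_sets[OF mF, of A] by simp
  qed auto
  from measurable_compose_countable'[where f = H, OF mH this cF]
  show "(\<lambda>c. H (F c) c) \<in> ?M \<rightarrow>\<^sub>M count_space UNIV" .
qed

lemma tree_rv_comp: "tree_rv F \<Longrightarrow> tree_rv (\<lambda>c. G (F c))"
  by (erule tree_rv_bind[where H = "\<lambda>x _. G x"]) (rule tree_rv_const)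

lemma tree_rv_comp2: "tree_rv F \<Longrightarrow> tree_rv F' \<Longrightarrow> tree_rv (\<lambda>c. G (F c) (F' c))"
  by (erule tree_rv_bind[where H = "\<lambda>x c. G x (F' c)"])
     (erule tree_rv_comp[where F = F' and G = "G x" for x])

lemma tree_rv_pred:
  "tree_rv P \<longleftrightarrow> Measurable.pred (\<Pi>\<^sub>M v\<in>UNIV. count_space UNIV) P"
  by (auto simp: tree_rv_def intro: countable_finite)

lemma tree_rvI:
  assumes cF: "countable (range F)" and "\<And>x. tree_rv (\<lambda>c. F c = x)"
  shows "tree_rv F"
  unfolding tree_rv_def
proof
  let ?M = "\<Pi>\<^sub>M v\<in>(UNIV :: node set). count_space (UNIV :: nat set)"
  show "F \<in> ?M \<rightarrow>\<^sub>M count_space UNIV"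
  proof (rule measurableI)
    fix A
    have "{c \<in> space ?M. F c = x} \<in> sets ?M" for x
      using assms(2)[of x] by (simp add: tree_rv_pred pred_def)
    then have "(\<Union>x\<in>A \<inter> range F. {c \<in> space ?M. F c = x}) \<in> sets ?M"
      using cF by (intro sets.countable_UN'') auto
    also have "(\<Union>x\<in>A \<inter> range F. {c \<in> space ?M. F c = x}) = F -` A \<inter> space ?M"
      by auto
    finally show "F -` A \<inter> space ?M \<in> sets ?M" .
  qed auto
qed (rule cF)

lemma tree_rv_ex: "(\<And>i::'i::countable. tree_rv (P i)) \<Longrightarrow> tree_rv (\<lambda>c. \<exists>i. P i c)"
  unfolding tree_rv_pred by (rule pred_intros_countable)

lemma tree_rv_all: "(\<And>i::'i::countable. tree_rv (P i)) \<Longrightarrow> tree_rv (\<lambda>c. \<forall>i. P i c)"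
  unfolding tree_rv_pred by (rule pred_intros_countable)

lemma tree_rv_Not: "tree_rv P \<Longrightarrow> tree_rv (\<lambda>c. \<not> P c)"
  by (rule tree_rv_comp[where G = Not])

lemma tree_rv_conj: "tree_rv P \<Longrightarrow> tree_rv Q \<Longrightarrow> tree_rv (\<lambda>c. P c \<and> Q c)"
  by (rule tree_rv_comp2[where G = "(\<and>)"])

lemma tree_rv_finite_Collect:
  assumes "finite A" "\<And>v. v \<in> A \<Longrightarrow> tree_rv (P v)"
  shows "tree_rv (\<lambda>c. {v \<in> A. P v c})"
  using assms
proof (induction A)
  case (insert a A)
  have "tree_rv (\<lambda>c. if P a c then insert a {v \<in> A. P v c} else {v \<in> A. P v c})"
    using insert by (intro tree_rv_comp2[where G = "\<lambda>b X. if b then insert a X else X"]) auto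
  also have "(\<lambda>c. if P a c then insert a {v \<in> A. P v c} else {v \<in> A. P v c})
      = (\<lambda>c. {v \<in> insert a A. P v c})"
    by (auto simp: fun_eq_iff)
  finally show ?case .
qed (simp add: tree_rv_const)

lemma tree_rv_compose_measurable:
  assumes "tree_rv F" "r \<in> (\<Pi>\<^sub>M v\<in>UNIV. count_space UNIV) \<rightarrow>\<^sub>M (\<Pi>\<^sub>M v\<in>UNIV. count_space UNIV)"
  shows "tree_rv (\<lambda>c. F (r c))"
  unfolding tree_rv_def
proof
  show "countable (range (\<lambda>c. F (r c)))"
    using tree_rv_countable[OF assms(1)] by (rule countable_subset[rotated]) auto
  show "(\<lambda>c. F (r c)) \<in> (\<Pi>\<^sub>M v\<in>UNIV. count_space UNIV) \<rightarrow>\<^sub>M count_space UNIV"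
    using assms by (auto simp: tree_rv_def intro: measurable_compose)
qed

lemma tree_rv_reroot: "tree_rv F \<Longrightarrow> tree_rv (\<lambda>c. F (reroot v c))"
  by (erule tree_rv_compose_measurable)
     (auto simp: reroot_def intro!: measurable_PiM_single' measurable_component_singleton)

lemma tree_rv_graft: "tree_rv F \<Longrightarrow> tree_rv (\<lambda>c. F (graft v c d))"
proof (erule tree_rv_compose_measurable)
  show "(\<lambda>c. graft v c d) \<in> (\<Pi>\<^sub>M v\<in>UNIV. count_space UNIV) \<rightarrow>\<^sub>M (\<Pi>\<^sub>M v\<in>UNIV. count_space UNIV)"
  proof (intro measurable_PiM_single')
    show "(\<lambda>c. graft v c d u) \<in> (\<Pi>\<^sub>M v\<in>UNIV. count_space UNIV) \<rightarrow>\<^sub>M count_space UNIV" for u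
      by (cases "prefix v u") (auto simp: graft_def intro: measurable_component_singleton)
  qed auto
qed

section \<open>Measurability of extinction and of subtree sizes\<close>

lemma tree_rv_in_gw_tree: "tree_rv (\<lambda>c. u \<in> gw_tree c)"
proof (induction u rule: rev_induct)
  case (snoc k u)
  then show ?case
    unfolding gw_tree_snoc
    by (intro tree_rv_conj tree_rv_comp[where G = "\<lambda>n. k < n"] tree_rv_component)
qed (simp add: tree_rv_const)

lemma tree_rv_generation_size_eq_0: "tree_rv (\<lambda>c. generation_size c n = 0)"
  unfolding generation_size_eq_0_iff Ball_def
  by (intro tree_rv_all tree_rv_comp2[where G = "(\<longrightarrow>)"] tree_rv_in_gw_tree tree_rv_const)

lemma tree_rv_finite_gw_tree: "tree_rv (\<lambda>c. finite (gw_tree c))"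
  unfolding finite_gw_tree_iff by (intro tree_rv_ex tree_rv_generation_size_eq_0)

lemma tree_rv_immortal_children: "tree_rv immortal_children"
proof -
  have "tree_rv (\<lambda>c. {i \<in> {..<n}. infinite (gw_tree (reroot [i] c))})" for n
    by (intro tree_rv_finite_Collect tree_rv_Not tree_rv_reroot tree_rv_finite_gw_tree) auto
  then have "tree_rv (\<lambda>c. {i \<in> {..<c []}. infinite (gw_tree (reroot [i] c))})"
    by (rule tree_rv_bind[where F = "\<lambda>c. c []", OF tree_rv_component])
  moreover have "immortal_children = (\<lambda>c. {i \<in> {..<c []}. infinite (gw_tree (reroot [i] c))})"
    by (auto simp: immortal_children_def)
  ultimately show ?thesis by simp
qed

lemma tree_rv_finite_subtree: "tree_rv (\<lambda>c. finite (subtree c v))"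
proof -
  have "finite (subtree c v) \<longleftrightarrow> v \<notin> gw_tree c \<or> finite (gw_tree (reroot v c))" for c
    using finite_subtree_iff[of v c] gw_tree_prefix[of _ c v]
    by (cases "v \<in> gw_tree c") (auto simp: subtree_def intro!: finite_subset[of _ "{}"])
  moreover have "tree_rv (\<lambda>c. v \<notin> gw_tree c \<or> finite (gw_tree (reroot v c)))"
    by (intro tree_rv_comp2[where G = "(\<or>)"] tree_rv_Not tree_rv_in_gw_tree
        tree_rv_reroot tree_rv_finite_gw_tree)
  ultimately show ?thesis by simp
qed

text \<open>The size is read off the set-valued variable \<open>F\<close>: a countable vertex set
  has only countably many finite subsets, and each event \<open>F c = Some A\<close> is a countable
  conjunction of conditions on the membership of single vertices.\<close>

lemma tree_rv_subtree_size: "tree_rv (\<lambda>c. subtree_size c v)"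
proof -
  define F where "F c = (if finite (subtree c v) then Some (subtree c v) else None)" for c
  have "range F \<subseteq> insert None (Some ` Collect finite)"
    by (auto simp: F_def)
  then have cF: "countable (range F)"
    by (rule countable_subset) (simp add: countable_Collect_finite)
  have "tree_rv (\<lambda>c. F c = x)" for x
  proof (cases x)
    case None
    then have "(\<lambda>c. F c = x) = (\<lambda>c. \<not> finite (subtree c v))" by (auto simp: F_def)
    then show ?thesis by (simp add: tree_rv_Not tree_rv_finite_subtree)
  next
    case (Some A)
    have "(\<lambda>c. F c = x)
        = (\<lambda>c. finite (subtree c v) \<and> (\<forall>w. (w \<in> gw_tree c) \<and> prefix v w \<longleftrightarrow> w \<in> A))"
      using Some by (auto simp: F_def subtree_def fun_eq_iff)
    moreover have "tree_rv (\<lambda>c. finite (subtree c v) \<and> (\<forall>w. (w \<in> gw_tree c) \<and> prefix v w \<longleftrightarrow> w \<in> A))"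
      by (intro tree_rv_conj tree_rv_finite_subtree tree_rv_all tree_rv_in_gw_tree
          tree_rv_comp2[where G = "(=)"] tree_rv_const)
    ultimately show ?thesis by simp
  qed
  with cF have "tree_rv F"
    by (rule tree_rvI)
  then have "tree_rv (\<lambda>c. case F c of None \<Rightarrow> \<infinity> | Some A \<Rightarrow> enat (card A))"
    by (rule tree_rv_comp)
  also have "(\<lambda>c. case F c of None \<Rightarrow> \<infinity> | Some A \<Rightarrow> enat (card A)) = (\<lambda>c. subtree_size c v)"
    by (auto simp: F_def subtree_size_def)
  finally show ?thesis .
qed

section \<open>Independence of subtrees\<close>

lemma measurable_graft:
  "(\<lambda>(c, d). graft v c d) \<in> GW xi \<Otimes>\<^sub>M GW xi \<rightarrow>\<^sub>M GW xi"
proof -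
  have "(\<lambda>(c, d). graft v c d) \<in> GW xi \<Otimes>\<^sub>M GW xi \<rightarrow>\<^sub>M (\<Pi>\<^sub>M v\<in>UNIV. measure_pmf xi)"
  proof (intro measurable_PiM_single')
    fix u :: node
    have "(\<lambda>c. c w) \<in> GW xi \<rightarrow>\<^sub>M measure_pmf xi" for w
      unfolding GW_def by (intro measurable_component_singleton) simp
    then show "(\<lambda>x. (case x of (c, d) \<Rightarrow> graft v c d) u) \<in> GW xi \<Otimes>\<^sub>M GW xi \<rightarrow>\<^sub>M measure_pmf xi"
      by (cases "prefix v u") (auto simp: graft_def split_beta')
  qed auto
  then show ?thesis by (simp add: GW_def)
qed

text \<open>Resampling all labels below \<open>v\<close> preserves the law. A cylinder over
  \<open>J\<close> splits into the coordinates outside the subtree (\<open>J1\<close>) and, with the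
  prefix \<open>v\<close> stripped, those inside it (\<open>J2\<close>), and the product measure
  factorises accordingly.\<close>

lemma distr_graft: "distr (GW xi \<Otimes>\<^sub>M GW xi) (GW xi) (\<lambda>(c, d). graft v c d) = GW xi"
proof -
  interpret GW: prob_space "GW xi" by (rule prob_space_GW)
  interpret product_prob_space "\<lambda>_::node. measure_pmf xi" UNIV
    by standard
  let ?M = "\<lambda>_::node. measure_pmf xi"
  have "distr (GW xi \<Otimes>\<^sub>M GW xi) (GW xi) (\<lambda>(c, d). graft v c d) = PiM UNIV ?M"
  proof (rule PiM_eq)
    fix J :: "node set" and E
    assume J: "finite J" "J \<subseteq> UNIV" "\<And>j. j \<in> J \<Longrightarrow> E j \<in> sets (measure_pmf xi)"
    define J1 where "J1 = {u \<in> J. \<not> prefix v u}"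
    define J2 where "J2 = {u. v @ u \<in> J}"
    have "(@) v -` J = J2" by (auto simp: J2_def)
    then have fin: "finite J1" "finite J2"
      using J finite_vimageI[of J "(@) v"] by (auto simp: J1_def inj_on_def)
    have J_eq: "J = J1 \<union> (@) v ` J2" "J1 \<inter> (@) v ` J2 = {}"
      by (auto simp: J1_def J2_def prefix_def)
    let ?X = "prod_emb UNIV ?M J (\<Pi>\<^sub>E j\<in>J. E j)"
    let ?X1 = "prod_emb UNIV ?M J1 (\<Pi>\<^sub>E j\<in>J1. E j)"
    let ?X2 = "prod_emb UNIV ?M J2 (\<Pi>\<^sub>E j\<in>J2. E (v @ j))"
    have "(\<lambda>(c, d). graft v c d) -` ?X \<inter> space (GW xi \<Otimes>\<^sub>M GW xi) = ?X1 \<times> ?X2"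
    proof -
      have emb: "prod_emb UNIV ?M I (\<Pi>\<^sub>E j\<in>I. A j) = {x. \<forall>j\<in>I. x j \<in> A j}" for I A
        by (auto simp: prod_emb_def PiE_iff)
      have "(\<forall>j\<in>J. graft v c d j \<in> E j) \<longleftrightarrow> (\<forall>j\<in>J1. c j \<in> E j) \<and> (\<forall>j\<in>J2. d j \<in> E (v @ j))" for c d
        by (auto simp: J1_def J2_def graft_def prefix_def)
      then show ?thesis
        unfolding emb by (simp add: space_pair_measure set_eq_iff)
    qed
    then have "emeasure (distr (GW xi \<Otimes>\<^sub>M GW xi) (GW xi) (\<lambda>(c, d). graft v c d)) ?X
        = emeasure (GW xi \<Otimes>\<^sub>M GW xi) (?X1 \<times> ?X2)"
      by (subst emeasure_distr[OF measurable_graft]) (auto simp: GW_def J intro!: sets_PiM_I)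
    also have "\<dots> = emeasure (GW xi) ?X1 * emeasure (GW xi) ?X2"
      using fin by (intro GW.emeasure_pair_measure_Times) (auto simp: GW_def intro!: sets_PiM_I)
    also have "emeasure (GW xi) ?X1 = (\<Prod>j\<in>J1. emeasure (measure_pmf xi) (E j))"
      unfolding GW_def using fin by (intro emeasure_PiM_emb) auto
    also have "emeasure (GW xi) ?X2 = (\<Prod>j\<in>J2. emeasure (measure_pmf xi) (E (v @ j)))"
      unfolding GW_def using fin by (intro emeasure_PiM_emb) auto
    also have "\<dots> = (\<Prod>j\<in>(@) v ` J2. emeasure (measure_pmf xi) (E j))"
      by (subst prod.reindex) (auto simp: inj_on_def)
    also have "(\<Prod>j\<in>J1. emeasure (measure_pmf xi) (E j)) * \<dots> = (\<Prod>j\<in>J. emeasure (measure_pmf xi) (E j))"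
      using fin J_eq by (metis finite_imageI prod.union_disjoint)
    finally show "emeasure (distr (GW xi \<Otimes>\<^sub>M GW xi) (GW xi) (\<lambda>(c, d). graft v c d)) ?X
        = (\<Prod>j\<in>J. emeasure (measure_pmf xi) (E j))" .
  qed (simp add: GW_def)
  then show ?thesis by (simp add: GW_def)
qed

lemma tree_rv_borel: "tree_rv F \<Longrightarrow> F \<in> borel_measurable (GW xi)"
  for F :: "_ \<Rightarrow> real"
  using measurable_compose[OF tree_rv_measurable[of F xi], of "\<lambda>x. x" borel] by simp

lemma integrable_tree_rv:
  fixes F :: "_ \<Rightarrow> real"
  assumes "tree_rv F" "\<And>c. \<bar>F c\<bar> \<le> B"
  shows "integrable (GW xi) F"
proof -
  interpret prob_space "GW xi" by (rule prob_space_GW)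
  show ?thesis
    using assms by (intro integrable_const_bound[where B = B]) (auto intro: tree_rv_borel)
qed

lemma GW_graft:
  fixes F :: "_ \<Rightarrow> real"
  assumes "tree_rv F" "\<And>c. \<bar>F c\<bar> \<le> B"
  shows "(\<integral>c. F c \<partial>GW xi) = (\<integral>c. (\<integral>d. F (graft v c d) \<partial>GW xi) \<partial>GW xi)"
proof -
  interpret prob_space "GW xi" by (rule prob_space_GW)
  interpret P: pair_prob_space "GW xi" "GW xi" ..
  have m: "(\<lambda>p. F (case p of (c, d) \<Rightarrow> graft v c d)) \<in> borel_measurable (GW xi \<Otimes>\<^sub>M GW xi)"
    by (rule measurable_compose[OF measurable_graft tree_rv_borel]) fact
  have "(\<integral>c. F c \<partial>GW xi) = (\<integral>c. F c \<partial>distr (GW xi \<Otimes>\<^sub>M GW xi) (GW xi) (\<lambda>(c, d). graft v c d))"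
    by (simp add: distr_graft)
  also have "\<dots> = (\<integral>p. F (case p of (c, d) \<Rightarrow> graft v c d) \<partial>(GW xi \<Otimes>\<^sub>M GW xi))"
    using assms by (intro integral_distr measurable_graft tree_rv_borel)
  also have "\<dots> = (\<integral>p. (\<lambda>(c, d). F (graft v c d)) p \<partial>(GW xi \<Otimes>\<^sub>M GW xi))"
    by (simp add: split_beta')
  also have "\<dots> = (\<integral>c. (\<integral>d. F (graft v c d) \<partial>GW xi) \<partial>GW xi)"
    using m assms(2)
    by (intro P.integral_fst[symmetric] P.integrable_const_bound[where B = B]) (auto simp: split_beta')
  finally show ?thesis .
qed

text \<open>After resampling the subtree at \<open>v\<close>, the factor \<open>H\<close> depends on
  the old tree only and \<open>Y\<close> on the new subtree only, so the double integral
  factorises.\<close>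

lemma GW_indep_subtree:
  fixes H Y :: "_ \<Rightarrow> real"
  assumes H: "tree_rv H" "\<And>c. \<bar>H c\<bar> \<le> A" and Y: "tree_rv Y" "\<And>c. \<bar>Y c\<bar> \<le> B"
    and graft: "\<And>c d. H (graft v c d) = H c"
  shows "(\<integral>c. H c * Y (reroot v c) \<partial>GW xi) = (\<integral>c. H c \<partial>GW xi) * (\<integral>c. Y c \<partial>GW xi)"
proof -
  have "\<bar>H c * Y d\<bar> \<le> A * B" for c d
    unfolding abs_mult using H(2)[of c] Y(2)[of d] by (intro mult_mono) auto
  then have "(\<integral>c. H c * Y (reroot v c) \<partial>GW xi)
      = (\<integral>c. (\<integral>d. H (graft v c d) * Y (reroot v (graft v c d)) \<partial>GW xi) \<partial>GW xi)"
    using H Y by (intro GW_graft[where B = "A * B"] tree_rv_comp2[where G = "(*)"] tree_rv_reroot)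
  then show ?thesis by (simp add: graft)
qed


section \<open>Independence given survival of a subtree\<close>

lemma graft_reroot [simp]: "graft v c (reroot v c) = c"
  by (auto simp: graft_def reroot_def prefix_def fun_eq_iff)

lemma graft_graft [simp]: "graft v (graft v c d) e = graft v c e"
  by (auto simp: graft_def fun_eq_iff)

lemma integral_of_bool: "(\<integral>c. of_bool (P c) \<partial>GW xi) = measure (GW xi) {c. P c}"
proof -
  have "(\<lambda>c. of_bool (P c) :: real) = indicator {c. P c}"
    by (auto simp: fun_eq_iff indicator_def)
  then show ?thesis by (simp add: Bochner_Integration.integral_indicator)
qed

text \<open>Here \<open>H\<close> is insensitive to the subtree at \<open>v\<close> only as long as
  that subtree stays infinite. Planting one fixed infinite tree \<open>e\<close> yields the fully
  insensitive \<open>H'\<close>, and \<open>H\<close> is \<open>H'\<close> times the indicator that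
  the subtree survives. The identity is stated without division, so it includes survival probability
  0.\<close>

lemma GW_indep_infinite_subtree:
  fixes H Y :: "_ \<Rightarrow> real"
  assumes H: "tree_rv H" "\<And>c. \<bar>H c\<bar> \<le> A" and Y: "tree_rv Y" "\<And>c. \<bar>Y c\<bar> \<le> B"
    and supp: "\<And>c. finite (gw_tree (reroot v c)) \<Longrightarrow> H c = 0"
    and graft: "\<And>c d. infinite (gw_tree (reroot v c)) \<Longrightarrow> infinite (gw_tree d) \<Longrightarrow> H (graft v c d) = H c"
  shows "(\<integral>c. H c * Y (reroot v c) \<partial>GW xi) * measure (GW xi) {c. infinite (gw_tree c)}
    = (\<integral>c. H c \<partial>GW xi) * (\<integral>c. of_bool (infinite (gw_tree c)) * Y c \<partial>GW xi)"
proof (cases "\<exists>e. infinite (gw_tree e)")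
  case False
  then have "H c = 0" for c using supp by blast
  then show ?thesis by simp
next
  case True
  then obtain e where e: "infinite (gw_tree e)" by blast
  define H' where "H' c = H (graft v c e)" for c
  have H': "tree_rv H'" "\<And>c. \<bar>H' c\<bar> \<le> A" "\<And>c d. H' (graft v c d) = H' c"
    unfolding H'_def using H by (auto intro: tree_rv_graft[of H])
  have H_eq: "H c = H' c * of_bool (infinite (gw_tree (reroot v c)))" for c
    using supp[of c] graft[of c e] e by (auto simp: H'_def)
  have inf: "tree_rv (\<lambda>c. of_bool (infinite (gw_tree c)) :: real)"
    by (intro tree_rv_comp[where G = of_bool] tree_rv_Not tree_rv_finite_gw_tree)
  have B: "0 \<le> B" using Y(2)[of e] by simp
  have "(\<integral>c. H c \<partial>GW xi) = (\<integral>c. H' c * of_bool (infinite (gw_tree (reroot v c))) \<partial>GW xi)"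
    by (simp add: H_eq)
  also have "\<dots> = (\<integral>c. H' c \<partial>GW xi) * (\<integral>c. of_bool (infinite (gw_tree c)) \<partial>GW xi)"
    using H' inf by (intro GW_indep_subtree[where A = A and B = 1]) auto
  also have "(\<integral>c. of_bool (infinite (gw_tree c)) \<partial>GW xi) = measure (GW xi) {c. infinite (gw_tree c)}"
    by (rule integral_of_bool)
  finally have *: "(\<integral>c. H c \<partial>GW xi) = (\<integral>c. H' c \<partial>GW xi) * measure (GW xi) {c. infinite (gw_tree c)}" .
  have "(\<integral>c. H c * Y (reroot v c) \<partial>GW xi)
      = (\<integral>c. H' c * (\<lambda>d. of_bool (infinite (gw_tree d)) * Y d) (reroot v c) \<partial>GW xi)"
    by (simp add: H_eq mult.assoc)
  also have "\<dots> = (\<integral>c. H' c \<partial>GW xi) * (\<integral>c. of_bool (infinite (gw_tree c)) * Y c \<partial>GW xi)"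
    using H' Y B inf
    by (intro GW_indep_subtree[where A = A and B = B] tree_rv_comp2[where G = "(*)"]) (auto simp: of_bool_def)
  finally show ?thesis using * by simp
qed

lemma sums_integral_partition:
  fixes F :: "_ \<Rightarrow> real" and N :: "_ \<Rightarrow> nat"
  assumes F: "tree_rv F" "\<And>c. \<bar>F c\<bar> \<le> B" and N: "tree_rv N"
  shows "(\<lambda>n. \<integral>c. of_bool (N c = n) * F c \<partial>GW xi) sums (\<integral>c. F c \<partial>GW xi)"
proof -
  interpret prob_space "GW xi" by (rule prob_space_GW)
  have B: "0 \<le> B" using F(2) by (meson abs_ge_zero order_trans)
  have rv: "tree_rv (\<lambda>c. of_bool (P (N c)) * F c)" for P
    using F N by (intro tree_rv_comp2[where F = N and G = "\<lambda>n x. of_bool (P n) * x"])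
  have int: "integrable (GW xi) (\<lambda>c. of_bool (P (N c)) * F c)" for P
    using F B by (intro integrable_tree_rv[where B = B] rv) (auto simp: of_bool_def)
  have "(\<Sum>n<k. \<integral>c. of_bool (N c = n) * F c \<partial>GW xi) = (\<integral>c. of_bool (N c < k) * F c \<partial>GW xi)" for k
  proof -
    have "(\<Sum>n<k. of_bool (N c = n) * F c) = of_bool (N c < k) * F c" for c
      by (auto simp: of_bool_def if_distrib[of "\<lambda>x. x * _"] cong: if_cong)
    then show ?thesis
      using int[of "\<lambda>m. m = n" for n]
      by (subst Bochner_Integration.integral_sum[symmetric]) (simp_all only: simp_thms)
  qed
  moreover have "(\<lambda>k. \<integral>c. of_bool (N c < k) * F c \<partial>GW xi) \<longlonglongrightarrow> (\<integral>c. F c \<partial>GW xi)"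
  proof (rule integral_dominated_convergence[where w = "\<lambda>_. B"])
    show "AE c in GW xi. (\<lambda>k. of_bool (N c < k) * F c) \<longlonglongrightarrow> F c"
    proof (rule AE_I2, rule tendsto_eventually)
      fix c show "\<forall>\<^sub>F k in sequentially. of_bool (N c < k) * F c = F c"
        using eventually_gt_at_top[of "N c"] by eventually_elim simp
    qed
  qed (use F B rv in \<open>auto intro!: tree_rv_borel simp: of_bool_def\<close>)
  ultimately show ?thesis
    by (simp add: sums_def)
qed

text \<open>The vertex \<open>V c\<close> may depend on everything that is known outside the subtree below it; given
  that this subtree is infinite, it is distributed as a surviving Galton-Watson tree.\<close>

lemma GW_indep_selected_subtree:
  fixes X Y :: "_ \<Rightarrow> real" and V :: "_ \<Rightarrow> node"
  assumes rv: "tree_rv B" "tree_rv V" "tree_rv X" "tree_rv Y"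
    and bd: "\<And>c. \<bar>X c\<bar> \<le> A" "\<And>c. \<bar>Y c\<bar> \<le> D"
    and inf: "\<And>c. B c \<Longrightarrow> infinite (gw_tree (reroot (V c) c))"
    and graft: "\<And>c d. B c \<Longrightarrow> infinite (gw_tree d) \<Longrightarrow>
      B (graft (V c) c d) \<and> V (graft (V c) c d) = V c \<and> X (graft (V c) c d) = X c"
  shows "(\<integral>c. of_bool (B c) * X c * Y (reroot (V c) c) \<partial>GW xi) * measure (GW xi) {c. infinite (gw_tree c)}
    = (\<integral>c. of_bool (B c) * X c \<partial>GW xi) * (\<integral>c. of_bool (infinite (gw_tree c)) * Y c \<partial>GW xi)"
proof -
  define F where "F c = of_bool (B c) * X c" for c
  have F: "tree_rv F"
    unfolding F_def using rv by (intro tree_rv_comp2[where G = "\<lambda>b x. of_bool b * x"])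
  have bF: "\<bar>F c\<bar> \<le> A" for c
    using bd(1)[of c] by (auto simp: F_def of_bool_def)
  \<comment> \<open>Coding the selected vertex as a number reduces the claim to the countably many
    events on which it is a fixed \<open>v\<close>.\<close>
  define N where "N c = to_nat (V c)" for c
  have N: "tree_rv N" unfolding N_def using rv(2) by (rule tree_rv_comp)
  have YV: "tree_rv (\<lambda>c. Y (reroot (V c) c))"
    using rv(2) by (rule tree_rv_bind) (intro tree_rv_reroot rv)
  have FY: "tree_rv (\<lambda>c. F c * Y (reroot (V c) c))"
    using F YV by (rule tree_rv_comp2)
  have bFY: "\<bar>F c * Y (reroot (V c) c)\<bar> \<le> A * D" for c
    unfolding abs_mult using bF[of c] bd(2)[of "reroot (V c) c"] by (intro mult_mono) auto
  let ?s = "measure (GW xi) {c. infinite (gw_tree c)}"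
  let ?t = "\<integral>c. of_bool (infinite (gw_tree c)) * Y c \<partial>GW xi"
  have eq: "(\<integral>c. of_bool (N c = n) * (F c * Y (reroot (V c) c)) \<partial>GW xi) * ?s
      = (\<integral>c. of_bool (N c = n) * F c \<partial>GW xi) * ?t" for n
  proof (cases "\<exists>v::node. to_nat v = n")
    case False
    then have "N c \<noteq> n" for c by (auto simp: N_def)
    then show ?thesis by simp
  next
    case True
    then obtain v :: node where v: "n = to_nat v" by blast
    have N_iff: "N c = n \<longleftrightarrow> V c = v" for c by (simp add: N_def v)
    define H where "H c = of_bool (V c = v) * F c" for c
    have graft': "B (graft v c d) \<and> V (graft v c d) = v \<and> X (graft v c d) = X c"
      if "B c" "V c = v" "infinite (gw_tree d)" for c d
      using graft[of c d] that by simp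
    have HG: "H (graft v c d) = H c"
      if c: "infinite (gw_tree (reroot v c))" and d: "infinite (gw_tree d)" for c d
    proof (cases "B c \<and> V c = v")
      case True
      with graft'[of c d] d show ?thesis by (simp add: H_def F_def)
    next
      case False
      \<comment> \<open>Grafting the original subtree back undoes the exchange. So if the exchanged
        tree satisfied \<open>B\<close> and selected \<open>v\<close>, then so would
        \<open>c\<close>.\<close>
      then have "\<not> (B (graft v c d) \<and> V (graft v c d) = v)"
        using graft'[of "graft v c d" "reroot v c"] c by auto
      with False show ?thesis by (auto simp: H_def F_def)
    qed
    have "(\<integral>c. H c * Y (reroot v c) \<partial>GW xi) * ?s = (\<integral>c. H c \<partial>GW xi) * ?t"
    proof (rule GW_indep_infinite_subtree[where A = A and B = D])
      show "tree_rv H"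
        unfolding H_def using F rv(2)
        by (intro tree_rv_comp2[where F = V and G = "\<lambda>u x. of_bool (u = v) * x"])
      show "\<bar>H c\<bar> \<le> A" for c using bF[of c] by (auto simp: H_def of_bool_def)
      show "H c = 0" if "finite (gw_tree (reroot v c))" for c
        using inf[of c] that by (auto simp: H_def F_def)
    qed (use rv bd HG in auto)
    moreover have "(\<lambda>c. H c * Y (reroot v c)) = (\<lambda>c. of_bool (N c = n) * (F c * Y (reroot (V c) c)))"
      by (auto simp: H_def N_iff)
    moreover have "H = (\<lambda>c. of_bool (N c = n) * F c)"
      by (auto simp: H_def N_iff)
    ultimately show ?thesis by simp
  qed
  have "(\<lambda>n. (\<integral>c. of_bool (N c = n) * (F c * Y (reroot (V c) c)) \<partial>GW xi) * ?s)
      sums ((\<integral>c. F c * Y (reroot (V c) c) \<partial>GW xi) * ?s)"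
    by (intro sums_mult2 sums_integral_partition[where B = "A * D"] FY bFY N)
  moreover have "(\<lambda>n. (\<integral>c. of_bool (N c = n) * F c \<partial>GW xi) * ?t) sums ((\<integral>c. F c \<partial>GW xi) * ?t)"
    by (intro sums_mult2 sums_integral_partition[where B = A] F bF N)
  ultimately show ?thesis
    unfolding eq by (simp add: F_def sums_unique2)
qed

text \<open>The branching property: the subtrees of the children are independent copies of the tree,
  and independent of the offspring number of the root.\<close>

lemma GW_prod_children:
  fixes f :: "_ \<Rightarrow> real"
  assumes f: "tree_rv f" "\<And>c. 0 \<le> f c" "\<And>c. f c \<le> 1"
  shows "(\<integral>c. (\<Prod>i<c []. f (reroot [i] c)) \<partial>GW xi) = offspring_pgf xi (\<integral>c. f c \<partial>GW xi)"
proof -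
  interpret prob_space "GW xi" by (rule prob_space_GW)
  define e where "e = (\<integral>c. f c \<partial>GW xi)"
  have prod: "tree_rv (\<lambda>c. \<Prod>i<j. f (reroot [i] c))" for j
  proof (induction j)
    case (Suc j)
    have "tree_rv (\<lambda>c. (\<Prod>i<j. f (reroot [i] c)) * f (reroot [j] c))"
      using Suc f by (intro tree_rv_comp2[where G = "(*)"] tree_rv_reroot)
    then show ?case by (simp add: mult.commute)
  qed (simp add: tree_rv_const)
  have bd: "\<bar>\<Prod>i<j. f (reroot [i] c)\<bar> \<le> 1" for c j
    using f by (simp add: abs_prod prod_le_1)
  \<comment> \<open>The number of factors is decoupled from the offspring number \<open>n\<close>.
    This makes sense because labels outside the tree carry offspring numbers too; grafting at
    \<open>[j]\<close> then affects only the last factor.\<close>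
  have step: "(\<integral>c. of_bool (c [] = n) * (\<Prod>i<j. f (reroot [i] c)) \<partial>GW xi) = pmf xi n * e ^ j" for n j
  proof (induction j)
    case 0
    have "(\<integral>c. of_bool (c [] = n) \<partial>GW xi) = measure (GW xi) {c. c [] = n}"
      by (rule integral_of_bool)
    also have "\<dots> = measure (distr (GW xi) (measure_pmf xi) (\<lambda>c. c [])) {n}"
      by (subst measure_distr) (auto simp: vimage_def GW_def[symmetric] intro: tree_rv_measurable
          intro!: tree_rv_measurable[OF tree_rv_component] cong: measurable_cong_sets)
    also have "distr (GW xi) (measure_pmf xi) (\<lambda>c. c []) = measure_pmf xi"
      unfolding GW_def by (rule distr_PiM_component) (auto intro: measure_pmf.prob_space_axioms)
    finally show ?case by (simp add: pmf.rep_eq)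
  next
    case (Suc j)
    have "(\<integral>c. (of_bool (c [] = n) * (\<Prod>i<j. f (reroot [i] c))) * f (reroot [j] c) \<partial>GW xi)
        = (\<integral>c. of_bool (c [] = n) * (\<Prod>i<j. f (reroot [i] c)) \<partial>GW xi) * (\<integral>c. f c \<partial>GW xi)"
    proof (rule GW_indep_subtree[where A = 1 and B = 1])
      show "tree_rv (\<lambda>c. of_bool (c [] = n) * (\<Prod>i<j. f (reroot [i] c)))"
        using prod tree_rv_component[of "[]"]
        by (rule tree_rv_comp2[where G = "\<lambda>x m. of_bool (m = n) * x"])
      show "\<bar>of_bool (c [] = n) * (\<Prod>i<j. f (reroot [i] c))\<bar> \<le> 1" for c
        using bd[of c j] by (auto simp: of_bool_def)
      show "of_bool (graft [j] c d [] = n) * (\<Prod>i<j. f (reroot [i] (graft [j] c d)))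
          = of_bool (c [] = n) * (\<Prod>i<j. f (reroot [i] c))" for c d
      proof -
        have "graft [j] c d [] = c []" by (simp add: graft_def)
        then show ?thesis by (simp add: reroot_graft_disjoint)
      qed
    qed (use f in auto)
    with Suc show ?case by (simp add: e_def mult_ac)
  qed
  have rv: "tree_rv (\<lambda>c. \<Prod>i<c []. f (reroot [i] c))"
    using tree_rv_component[of "[]"] prod by (rule tree_rv_bind)
  have "(\<lambda>n. \<integral>c. of_bool (c [] = n) * (\<Prod>i<c []. f (reroot [i] c)) \<partial>GW xi)
      sums (\<integral>c. (\<Prod>i<c []. f (reroot [i] c)) \<partial>GW xi)"
    using rv bd by (intro sums_integral_partition[where B = 1] tree_rv_component)
  moreover have "(\<integral>c. of_bool (c [] = n) * (\<Prod>i<c []. f (reroot [i] c)) \<partial>GW xi) = pmf xi n * e ^ n" for n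
  proof -
    have "of_bool (c [] = n) * (\<Prod>i<c []. f (reroot [i] c))
        = of_bool (c [] = n) * (\<Prod>i<n. f (reroot [i] c))" for c
      by simp
    then show ?thesis by (simp only: step)
  qed
  ultimately show ?thesis
    by (simp add: offspring_pgf_def e_def sums_iff)
qed

section \<open>Extinction and the surviving children of the root\<close>

lemma tree_rv_sets: "tree_rv P \<Longrightarrow> {c. P c} \<in> sets (GW xi)"
  using tree_rv_measurable[of P xi] by (simp add: pred_def)

lemma extinction_prob_eq_lim:
  "(\<lambda>n. \<P>(c in GW xi. generation_size c n = 0)) \<longlonglongrightarrow> measure (GW xi) {c. finite (gw_tree c)}"
proof -
  interpret prob_space "GW xi" by (rule prob_space_GW)
  have "(\<lambda>n. prob {c. generation_size c n = 0}) \<longlonglongrightarrow> prob (\<Union>n. {c. generation_size c n = 0})"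
    by (intro finite_Lim_measure_incseq)
       (auto simp: incseq_def intro: tree_rv_sets tree_rv_generation_size_eq_0
         generation_size_eq_0_mono)
  moreover have "(\<Union>n. {c. generation_size c n = 0}) = {c. finite (gw_tree c)}"
    by (auto simp: finite_gw_tree_iff)
  ultimately show ?thesis by simp
qed

lemma extinction_prob_eq: "extinction_prob xi = measure (GW xi) {c. finite (gw_tree c)}"
  unfolding extinction_prob_def using extinction_prob_eq_lim by (rule limI)

lemma survival_prob_eq: "measure (GW xi) {c. infinite (gw_tree c)} = 1 - extinction_prob xi"
proof -
  interpret prob_space "GW xi" by (rule prob_space_GW)
  have "prob (space (GW xi) - {c. finite (gw_tree c)}) = 1 - prob {c. finite (gw_tree c)}"
    by (intro prob_compl tree_rv_sets tree_rv_finite_gw_tree)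
  moreover have "space (GW xi) - {c. finite (gw_tree c)} = {c. infinite (gw_tree c)}"
    by auto
  ultimately show ?thesis by (simp add: extinction_prob_eq)
qed

lemma extinction_prob_bounds: "0 \<le> extinction_prob xi" "extinction_prob xi \<le> 1"
  using prob_space.prob_le_1[OF prob_space_GW] by (auto simp: extinction_prob_eq)

text \<open>The probabilities of an empty generation are the iterates of the generating function
  started at 0, and monotonicity keeps them below every such r.\<close>

lemma extinction_prob_le:
  assumes "0 \<le> r" "r \<le> 1" "offspring_pgf xi r \<le> r"
  shows "extinction_prob xi \<le> r"
proof -
  interpret prob_space "GW xi" by (rule prob_space_GW)
  have "prob {c. generation_size c n = 0} \<le> r" for n
  proof (induction n)
    case (Suc n)
    have "(\<Prod>i<c []. of_bool (generation_size (reroot [i] c) n = 0))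
        = (of_bool (generation_size c (Suc n) = 0) :: real)" for c
      by (auto simp: generation_size_Suc_eq_0_iff of_bool_def)
    then have "prob {c. generation_size c (Suc n) = 0}
        = (\<integral>c. (\<Prod>i<c []. of_bool (generation_size (reroot [i] c) n = 0)) \<partial>GW xi)"
      by (simp only: integral_of_bool)
    also have "\<dots> = offspring_pgf xi (\<integral>c. of_bool (generation_size c n = 0) \<partial>GW xi)"
      by (intro GW_prod_children tree_rv_comp[where G = of_bool] tree_rv_generation_size_eq_0) auto
    also have "\<dots> = offspring_pgf xi (prob {c. generation_size c n = 0})"
      by (simp only: integral_of_bool)
    also have "\<dots> \<le> offspring_pgf xi r"
      using Suc assms by (intro pgf_mono) auto
    finally show ?case using assms by simp
  qed (simp add: assms)
  then show ?thesis
    unfolding extinction_prob_eq using extinction_prob_eq_lim[of xi] by (intro LIMSEQ_le_const2) auto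
qed

lemma extinction_prob_less_one:
  assumes "offspring_mean xi > 1" shows "extinction_prob xi < 1"
  using pgf_le_id_supercritical[OF assms] extinction_prob_le[of _ xi] by (metis less_imp_le order_le_less_trans)

lemma extinction_prob_eq_0: "pmf xi 0 = 0 \<Longrightarrow> extinction_prob xi = 0"
  using extinction_prob_le[of 0 xi] extinction_prob_bounds[of xi] by auto

text \<open>On infinite trees this is the K of the overview; on finite trees it is 0.\<close>

definition broods :: "(node \<Rightarrow> nat) \<Rightarrow> nat" where
  "broods c = card (immortal_children c)"

lemma tree_rv_broods: "tree_rv broods"
  unfolding broods_def[abs_def] by (rule tree_rv_comp[OF tree_rv_immortal_children])

lemma broods_pos: "infinite (gw_tree c) \<Longrightarrow> 0 < broods c"
  by (simp add: broods_def card_immortal_children_pos)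

lemma broods_eq_0: "finite (gw_tree c) \<Longrightarrow> broods c = 0"
  using infinite_gw_tree_iff[of c] by (auto simp: broods_def)

lemma tree_rv_survives: "tree_rv (\<lambda>c. infinite (gw_tree c))"
  by (intro tree_rv_Not tree_rv_finite_gw_tree)

text \<open>Each child of the root contributes the factor t if its subtree is infinite and 1
  otherwise, with mean t (1 - q) + q. The q subtracted at the end comes from the finite trees, on
  which the power is 1.\<close>

lemma integral_broods:
  assumes t: "0 \<le> t" "t \<le> 1"
  shows "(\<integral>c. of_bool (infinite (gw_tree c)) * t ^ broods c \<partial>GW xi)
      = offspring_pgf xi (t * (1 - extinction_prob xi) + extinction_prob xi) - extinction_prob xi"
proof -
  interpret prob_space "GW xi" by (rule prob_space_GW)
  define f where "f c = t * of_bool (infinite (gw_tree c)) + of_bool (finite (gw_tree c))" for c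
  have fin: "tree_rv (\<lambda>c. of_bool (finite (gw_tree c)) :: real)"
    by (intro tree_rv_comp[where G = of_bool] tree_rv_finite_gw_tree)
  have inf: "tree_rv (\<lambda>c. of_bool (infinite (gw_tree c)) :: real)"
    by (intro tree_rv_comp[where G = of_bool] tree_rv_survives)
  have f: "tree_rv f" "0 \<le> f c" "f c \<le> 1" for c
    unfolding f_def using t fin inf by (auto intro: tree_rv_comp2[where G = "\<lambda>x y. t * x + y"])
  have int: "integrable (GW xi) (\<lambda>c. of_bool (finite (gw_tree c)) :: real)"
    "integrable (GW xi) (\<lambda>c. of_bool (infinite (gw_tree c)) :: real)"
    using fin inf by (auto intro: integrable_tree_rv[where B = 1])
  have pow: "tree_rv (\<lambda>c. t ^ broods c)"
    using tree_rv_broods by (rule tree_rv_comp)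
  then have int': "integrable (GW xi) (\<lambda>c. t ^ broods c)"
    using t by (intro integrable_tree_rv[where B = 1]) (auto simp: power_le_one)
  have int'': "integrable (GW xi) (\<lambda>c. of_bool (infinite (gw_tree c)) * t ^ broods c)"
    using t pow inf
    by (intro integrable_tree_rv[where B = 1] tree_rv_comp2[where G = "(*)"])
       (auto simp: power_le_one of_bool_def)
  have E: "(\<integral>c. f c \<partial>GW xi) = t * (1 - extinction_prob xi) + extinction_prob xi"
    unfolding f_def using int
    by (simp add: integral_of_bool survival_prob_eq extinction_prob_eq[symmetric])
  have "(\<Prod>i<c []. f (reroot [i] c)) = t ^ broods c" for c
  proof -
    have "f (reroot [i] c) = (if infinite (gw_tree (reroot [i] c)) then t else 1)" for i
      by (simp add: f_def)
    then have "(\<Prod>i<c []. f (reroot [i] c)) = (\<Prod>i\<in>{i\<in>{..<c []}. infinite (gw_tree (reroot [i] c))}. t)"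
      by (subst prod.inter_filter) auto
    then show ?thesis by (simp add: broods_def immortal_children_def)
  qed
  with GW_prod_children[OF f, of xi] E
  have *: "(\<integral>c. t ^ broods c \<partial>GW xi)
      = offspring_pgf xi (t * (1 - extinction_prob xi) + extinction_prob xi)" by simp
  have "t ^ broods c = of_bool (infinite (gw_tree c)) * t ^ broods c + of_bool (finite (gw_tree c))" for c
    by (auto simp: broods_eq_0)
  then have "(\<integral>c. t ^ broods c \<partial>GW xi)
      = (\<integral>c. of_bool (infinite (gw_tree c)) * t ^ broods c + of_bool (finite (gw_tree c)) \<partial>GW xi)"
    by (metis (no_types, lifting))
  also have "\<dots> = (\<integral>c. of_bool (infinite (gw_tree c)) * t ^ broods c \<partial>GW xi) + extinction_prob xi"
    using int int'' by (simp add: integral_of_bool extinction_prob_eq)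
  finally show "(\<integral>c. of_bool (infinite (gw_tree c)) * t ^ broods c \<partial>GW xi)
      = offspring_pgf xi (t * (1 - extinction_prob xi) + extinction_prob xi) - extinction_prob xi"
    using * by simp
qed

text \<open>At t = 0 the integral in \<open>integral_broods\<close> vanishes, because an infinite
  tree has a child with an infinite subtree.\<close>

lemma pgf_extinction_prob: "offspring_pgf xi (extinction_prob xi) = extinction_prob xi"
proof -
  have "of_bool (infinite (gw_tree c)) * 0 ^ broods c = (0 :: real)" for c
    using broods_pos[of c] by (cases "finite (gw_tree c)") auto
  then have "(\<integral>c. of_bool (infinite (gw_tree c)) * 0 ^ broods c \<partial>GW xi) = (0 :: real)"
    by (simp only: Bochner_Integration.integral_zero)
  then show ?thesis using integral_broods[of 0 xi] by simp
qed

section \<open>The mean number of children with infinite subtrees\<close>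

lemma nn_integral_nat_tail:
  fixes N :: "'a \<Rightarrow> nat"
  assumes [measurable]: "N \<in> M \<rightarrow>\<^sub>M count_space UNIV"
  shows "(\<integral>\<^sup>+x. of_nat (N x) \<partial>M) = (\<Sum>i. emeasure M {x \<in> space M. i < N x})"
proof -
  have "(of_nat n :: ennreal) = (\<Sum>i. indicator {..<n} i)" for n :: nat
    by (subst suminf_finite[of "{..<n}"]) auto
  then have "(\<integral>\<^sup>+x. of_nat (N x) \<partial>M) = (\<integral>\<^sup>+x. (\<Sum>i. indicator {..<N x} i) \<partial>M)"
    by simp
  also have "\<dots> = (\<Sum>i. \<integral>\<^sup>+x. indicator {..<N x} i \<partial>M)"
    by (intro nn_integral_suminf) (simp add: indicator_def)
  also have "(\<lambda>i. \<integral>\<^sup>+x. indicator {..<N x} i \<partial>M) = (\<lambda>i. emeasure M {x \<in> space M. i < N x})"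
  proof
    fix i
    have "(\<integral>\<^sup>+x. indicator {..<N x} i \<partial>M) = (\<integral>\<^sup>+x. indicator {x \<in> space M. i < N x} x \<partial>M)"
      by (intro nn_integral_cong) (auto simp: indicator_def)
    then show "(\<integral>\<^sup>+x. indicator {..<N x} i \<partial>M) = emeasure M {x \<in> space M. i < N x}" by simp
  qed
  finally show ?thesis .
qed

lemma GW_component_tail: "measure (GW xi) {c. i < c []} = measure_pmf.prob xi {k. i < k}"
proof -
  have "measure_pmf.prob xi {k. i < k} = measure (distr (GW xi) (measure_pmf xi) (\<lambda>c. c [])) {k. i < k}"
    unfolding GW_def by (subst distr_PiM_component) (auto intro: measure_pmf.prob_space_axioms)
  also have "\<dots> = measure (GW xi) {c. i < c []}"
    by (subst measure_distr) (auto simp: vimage_def intro!: tree_rv_measurable[OF tree_rv_component]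
        cong: measurable_cong_sets)
  finally show ?thesis by simp
qed

text \<open>Linearity over the potential children: child \<open>i\<close> exists and survives with
  probability P(\<xi> > i)(1 - q), and the tail probabilities sum to the mean. In
  \<open>ennreal\<close> this includes infinite means.\<close>

lemma nn_integral_broods:
  "(\<integral>\<^sup>+c. of_nat (broods c) \<partial>GW xi) = ennreal (1 - extinction_prob xi) * offspring_mean xi"
proof -
  interpret prob_space "GW xi" by (rule prob_space_GW)
  define s where "s = 1 - extinction_prob xi"
  have s: "0 \<le> s" using extinction_prob_bounds by (simp add: s_def)
  define A where "A i = {c. i < c [] \<and> infinite (gw_tree (reroot [i] c))}" for i
  have A: "A i \<in> sets (GW xi)" for i
    unfolding A_def by (intro tree_rv_sets tree_rv_conj tree_rv_reroot tree_rv_survives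
        tree_rv_comp[where G = "\<lambda>k. i < k"] tree_rv_component)
  have PA: "emeasure (GW xi) (A i) = ennreal s * emeasure (measure_pmf xi) {k. i < k}" for i
  proof -
    have "measure (GW xi) (A i) = (\<integral>c. of_bool (i < c []) * of_bool (infinite (gw_tree (reroot [i] c))) \<partial>GW xi)"
      unfolding A_def integral_of_bool[symmetric] by (simp only: of_bool_conj)
    also have "\<dots> = (\<integral>c. of_bool (i < c []) \<partial>GW xi) * (\<integral>c. of_bool (infinite (gw_tree c)) \<partial>GW xi)"
    proof (rule GW_indep_subtree[where A = 1 and B = 1])
      show "tree_rv (\<lambda>c. of_bool (i < c []) :: real)"
        using tree_rv_component by (rule tree_rv_comp)
      show "tree_rv (\<lambda>c. of_bool (infinite (gw_tree c)) :: real)"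
        using tree_rv_survives by (rule tree_rv_comp)
    qed (auto simp: graft_def)
    also have "\<dots> = measure_pmf.prob xi {k. i < k} * s"
      by (simp add: integral_of_bool survival_prob_eq GW_component_tail s_def)
    finally show ?thesis
      using s by (simp add: emeasure_eq_measure measure_pmf.emeasure_eq_measure ennreal_mult' mult.commute)
  qed
  have "(of_nat (broods c) :: ennreal) = (\<Sum>i. indicator (A i) c)" for c
  proof -
    have "(\<Sum>i. indicator (A i) c) = (\<Sum>i\<in>immortal_children c. indicator (A i) c :: ennreal)"
      by (rule suminf_finite) (auto simp: A_def immortal_children_def)
    also have "\<dots> = (\<Sum>i\<in>immortal_children c. 1)"
      by (rule sum.cong) (auto simp: A_def immortal_children_def)
    finally show ?thesis by (simp add: broods_def)
  qed
  then have "(\<integral>\<^sup>+c. of_nat (broods c) \<partial>GW xi) = (\<integral>\<^sup>+c. (\<Sum>i. indicator (A i) c) \<partial>GW xi)"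
    by simp
  also have "\<dots> = (\<Sum>i. \<integral>\<^sup>+c. indicator (A i) c \<partial>GW xi)"
    using A by (intro nn_integral_suminf) auto
  also have "\<dots> = (\<Sum>i. ennreal s * emeasure (measure_pmf xi) {k. i < k})"
    using A by (simp add: PA)
  also have "\<dots> = ennreal s * (\<Sum>i. emeasure (measure_pmf xi) {k. i < k})"
    by simp
  also have "(\<Sum>i. emeasure (measure_pmf xi) {k. i < k}) = offspring_mean xi"
    unfolding offspring_mean_def by (subst nn_integral_nat_tail) auto
  finally show ?thesis by (simp add: s_def)
qed


text \<open>The law of K - 1 given survival. The weights sum to 1 only for q < 1, which is why the
  lemmas about its values assume this.\<close>

definition excess_pmf :: "nat pmf \<Rightarrow> nat pmf" where
  "excess_pmf xi = embed_pmf (\<lambda>k. measure (GW xi) {c. broods c = Suc k} / (1 - extinction_prob xi))"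

lemma broods_power_sums:
  assumes t: "0 \<le> t" "t \<le> 1"
  shows "(\<lambda>k. measure (GW xi) {c. broods c = Suc k} * t ^ k)
    sums (\<integral>c. of_bool (infinite (gw_tree c)) * t ^ (broods c - 1) \<partial>GW xi)"
proof -
  interpret prob_space "GW xi" by (rule prob_space_GW)
  have rv: "tree_rv (\<lambda>c. of_bool (infinite (gw_tree c)) * t ^ (broods c - 1))"
    using tree_rv_survives tree_rv_broods
    by (rule tree_rv_comp2[where G = "\<lambda>b n. of_bool b * t ^ (n - 1)"])
  have N: "tree_rv (\<lambda>c. broods c - 1)"
    using tree_rv_broods by (rule tree_rv_comp)
  have "(\<integral>c. of_bool (broods c - 1 = k) * (of_bool (infinite (gw_tree c)) * t ^ (broods c - 1)) \<partial>GW xi)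
      = measure (GW xi) {c. broods c = Suc k} * t ^ k" for k
  proof -
    \<comment> \<open>Truncated subtraction sends finite trees to 0 as well, but the survival
      indicator removes them.\<close>
    have "of_bool (broods c - 1 = k) * (of_bool (infinite (gw_tree c)) * t ^ (broods c - 1))
        = of_bool (broods c = Suc k) * t ^ k" for c
      using broods_pos[of c] broods_eq_0[of c] by (cases "finite (gw_tree c)") auto
    then show ?thesis
      by (simp add: integral_of_bool)
  qed
  with sums_integral_partition[OF rv _ N, of 1 xi] t show ?thesis
    by (simp add: power_le_one of_bool_def)
qed

lemma pmf_excess_pmf:
  assumes "extinction_prob xi < 1"
  shows "pmf (excess_pmf xi) k = measure (GW xi) {c. broods c = Suc k} / (1 - extinction_prob xi)"
  unfolding excess_pmf_def
proof (rule pmf_embed_pmf)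
  have "(\<lambda>k. measure (GW xi) {c. broods c = Suc k}) sums (1 - extinction_prob xi)"
    using broods_power_sums[of 1 xi] by (simp add: integral_of_bool survival_prob_eq)
  from sums_divide[OF this, of "1 - extinction_prob xi"]
  have "(\<lambda>k. measure (GW xi) {c. broods c = Suc k} / (1 - extinction_prob xi)) sums 1"
    using assms by simp
  then have "(\<lambda>k. ennreal (measure (GW xi) {c. broods c = Suc k} / (1 - extinction_prob xi))) sums ennreal 1"
    using assms by (subst sums_ennreal) auto
  then show "(\<integral>\<^sup>+k. ennreal (measure (GW xi) {c. broods c = Suc k} / (1 - extinction_prob xi))
      \<partial>count_space UNIV) = 1"
    by (simp add: nn_integral_count_space_nat sums_iff)
qed (use assms in simp)

lemma pgf_excess_pmf:
  assumes "extinction_prob xi < 1" "0 \<le> t" "t \<le> 1"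
  shows "(1 - extinction_prob xi) * offspring_pgf (excess_pmf xi) t
    = (\<integral>c. of_bool (infinite (gw_tree c)) * t ^ (broods c - 1) \<partial>GW xi)"
  using sums_divide[OF broods_power_sums[OF assms(2,3), of xi], of "1 - extinction_prob xi"] assms(1)
  by (simp add: offspring_pgf_def pmf_excess_pmf sums_iff)

text \<open>Passing from K - 1 to K costs one factor t. At a fixed point of \<phi> this factor turns
  the left side into (1 - q) t^2, the left side of the equation for the game.\<close>

lemma pgf_excess_pmf_eq:
  assumes "extinction_prob xi < 1" "0 \<le> t" "t \<le> 1"
  shows "(1 - extinction_prob xi) * (t * offspring_pgf (excess_pmf xi) t)
    = offspring_pgf xi (t * (1 - extinction_prob xi) + extinction_prob xi) - extinction_prob xi"
proof -
  have "t * (of_bool (infinite (gw_tree c)) * t ^ (broods c - 1))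
      = of_bool (infinite (gw_tree c)) * t ^ broods c" for c
    using broods_pos[of c] by (cases "broods c") auto
  then have "t * (\<integral>c. of_bool (infinite (gw_tree c)) * t ^ (broods c - 1) \<partial>GW xi)
      = (\<integral>c. of_bool (infinite (gw_tree c)) * t ^ broods c \<partial>GW xi)"
    by (simp only: Bochner_Integration.integral_mult_right_zero[symmetric])
  then show ?thesis
    using pgf_excess_pmf[OF assms] integral_broods[OF assms(2,3), of xi] by (simp add: mult_ac)
qed

text \<open>The unconditioned mean of \<open>broods\<close> is (1 - q) \<mu>, so K has mean \<mu>
  given survival. Adding 1 on the left, rather than subtracting it on the right, suits
  \<open>ennreal\<close> and infinite means.\<close>

lemma offspring_mean_excess_pmf:
  assumes "extinction_prob xi < 1"
  shows "offspring_mean (excess_pmf xi) + 1 = offspring_mean xi"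
proof -
  interpret prob_space "GW xi" by (rule prob_space_GW)
  define s where "s = 1 - extinction_prob xi"
  have s: "0 < s" using assms by (simp add: s_def)
  have meas [measurable]: "broods \<in> GW xi \<rightarrow>\<^sub>M count_space UNIV"
    by (intro tree_rv_measurable tree_rv_broods)
  have inf: "{c. infinite (gw_tree c)} \<in> sets (GW xi)"
    by (intro tree_rv_sets tree_rv_survives)
  have brk: "{c. broods c = Suc k} \<in> sets (GW xi)" for k
    by (intro tree_rv_sets tree_rv_comp[where G = "\<lambda>n. n = Suc k"] tree_rv_broods)
  have "ennreal s * offspring_mean (excess_pmf xi)
      = (\<Sum>k. ennreal s * (ennreal (pmf (excess_pmf xi) k) * of_nat k))"
    by (simp add: offspring_mean_def nn_integral_measure_pmf nn_integral_count_space_nat)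
  also have "\<dots> = (\<Sum>k. \<integral>\<^sup>+c. of_nat k * indicator {c. broods c = Suc k} c \<partial>GW xi)"
  proof (intro suminf_cong)
    fix k
    have "ennreal s * ennreal (pmf (excess_pmf xi) k) = emeasure (GW xi) {c. broods c = Suc k}"
      using s by (simp add: pmf_excess_pmf[OF assms] emeasure_eq_measure s_def flip: ennreal_mult)
    then show "ennreal s * (ennreal (pmf (excess_pmf xi) k) * of_nat k)
        = (\<integral>\<^sup>+c. of_nat k * indicator {c. broods c = Suc k} c \<partial>GW xi)"
      by (subst nn_integral_cmult_indicator[OF brk]) (simp only: mult.assoc[symmetric] mult.commute)
  qed
  also have "\<dots> = (\<integral>\<^sup>+c. (\<Sum>k. of_nat k * indicator {c. broods c = Suc k} c) \<partial>GW xi)"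
    using brk by (intro nn_integral_suminf[symmetric]) auto
  also have "\<dots> = (\<integral>\<^sup>+c. of_nat (broods c - 1) \<partial>GW xi)"
  proof (intro nn_integral_cong)
    fix c
    have "(\<Sum>k. of_nat k * indicator {c. broods c = Suc k} c)
        = (\<Sum>k\<in>{broods c - 1}. of_nat k * indicator {c. broods c = Suc k} c :: ennreal)"
      by (rule suminf_finite) (auto split: split_indicator)
    also have "\<dots> = of_nat (broods c - 1)"
      by (cases "broods c") auto
    finally show "(\<Sum>k. of_nat k * indicator {c. broods c = Suc k} c) = (of_nat (broods c - 1) :: ennreal)" .
  qed
  finally have 1: "ennreal s * offspring_mean (excess_pmf xi) = (\<integral>\<^sup>+c. of_nat (broods c - 1) \<partial>GW xi)" .
  have "of_nat (broods c) = of_nat (broods c - 1) + (indicator {c. infinite (gw_tree c)} c :: ennreal)" for c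
  proof (cases "finite (gw_tree c)")
    case False
    then obtain n where "broods c = Suc n" using broods_pos[of c] gr0_implies_Suc by blast
    with False show ?thesis by simp
  qed (simp add: broods_eq_0)
  then have "(\<integral>\<^sup>+c. of_nat (broods c) \<partial>GW xi)
      = (\<integral>\<^sup>+c. of_nat (broods c - 1) + indicator {c. infinite (gw_tree c)} c \<partial>GW xi)"
    by (rule nn_integral_cong)
  also have "\<dots> = (\<integral>\<^sup>+c. of_nat (broods c - 1) \<partial>GW xi) + emeasure (GW xi) {c. infinite (gw_tree c)}"
    using inf by (subst nn_integral_add) auto
  also have "emeasure (GW xi) {c. infinite (gw_tree c)} = ennreal s"
    by (simp add: emeasure_eq_measure survival_prob_eq s_def)
  finally have "ennreal s * offspring_mean xi = ennreal s * (offspring_mean (excess_pmf xi) + 1)"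
    using 1 nn_integral_broods[of xi] by (simp add: s_def ring_distribs)
  then show ?thesis
    using s by (simp add: ennreal_mult_cancel_left)
qed

section \<open>The value of the game\<close>

text \<open>The least fixed point of the generating function of the excess, i.e. the probability that the
  number of infinite external subtrees, which changes by one less than the excess in each round,
  ever drops by one.\<close>

definition breaker_value :: "nat pmf \<Rightarrow> real" where
  "breaker_value xi = Inf {t \<in> {0..1}. offspring_pgf (excess_pmf xi) t \<le> t}"

lemma breaker_value_le:
  "0 \<le> t \<Longrightarrow> t \<le> 1 \<Longrightarrow> offspring_pgf (excess_pmf xi) t \<le> t \<Longrightarrow> breaker_value xi \<le> t"
  unfolding breaker_value_def by (intro cInf_lower) (auto intro: bdd_belowI[of _ 0])

lemma breaker_value_bounds: "0 \<le> breaker_value xi" "breaker_value xi \<le> 1"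
proof -
  show "0 \<le> breaker_value xi"
    unfolding breaker_value_def by (intro cInf_greatest) (auto intro: exI[of _ 1])
  show "breaker_value xi \<le> 1" by (intro breaker_value_le) auto
qed

text \<open>As in the Knaster-Tarski theorem, monotonicity alone makes the infimum of all t with
  \<phi>(t) \<le> t a fixed point.\<close>

lemma pgf_breaker_value: "offspring_pgf (excess_pmf xi) (breaker_value xi) = breaker_value xi"
proof (rule antisym)
  let ?x = "breaker_value xi"
  show le: "offspring_pgf (excess_pmf xi) ?x \<le> ?x"
    unfolding breaker_value_def[of xi, THEN arg_cong, of "\<lambda>x. _ \<le> x"]
  proof (rule cInf_greatest)
    fix t assume t: "t \<in> {t \<in> {0..1}. offspring_pgf (excess_pmf xi) t \<le> t}"
    then have "offspring_pgf (excess_pmf xi) ?x \<le> offspring_pgf (excess_pmf xi) t"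
      using breaker_value_bounds[of xi] by (intro pgf_mono breaker_value_le) auto
    with t show "offspring_pgf (excess_pmf xi) ?x \<le> t" by simp
  qed (auto intro: exI[of _ 1])
  show "?x \<le> offspring_pgf (excess_pmf xi) ?x"
    using le breaker_value_bounds[of xi]
    by (intro breaker_value_le pgf_mono pgf_nonneg pgf_le_one) auto
qed

lemma less_pgf_below_breaker_value:
  "0 \<le> y \<Longrightarrow> y < breaker_value xi \<Longrightarrow> y < offspring_pgf (excess_pmf xi) y"
  using breaker_value_le[of y xi] breaker_value_bounds[of xi] by force

lemma breaker_value_solution:
  assumes "extinction_prob xi < 1"
  shows "(breaker_value xi)\<^sup>2 * (1 - extinction_prob xi)
    = offspring_pgf xi (breaker_value xi * (1 - extinction_prob xi) + extinction_prob xi) - extinction_prob xi"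
  using pgf_excess_pmf_eq[OF assms breaker_value_bounds[of xi]] pgf_breaker_value[of xi]
  by (simp add: power2_eq_square mult_ac)

text \<open>Translated to g, the bound \<phi>(t) \<le> t says that g - q is quadratically small at
  q. Both degenerate excess laws, constantly 1 and never 0, are handled through this.\<close>

lemma excess_pgf_flat:
  assumes q: "extinction_prob xi < 1"
    and flat: "\<And>t. 0 < t \<Longrightarrow> t \<le> 1 \<Longrightarrow> offspring_pgf (excess_pmf xi) t \<le> t"
  shows "extinction_prob xi = 0" "pmf xi 0 = 0" "pmf xi 1 = 0"
proof -
  have "offspring_pgf xi (extinction_prob xi + (1 - extinction_prob xi) * t) - extinction_prob xi
      \<le> (1 - extinction_prob xi) * t\<^sup>2" if t: "0 < t" "t \<le> 1" for t
  proof -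
    have "(1 - extinction_prob xi) * (t * offspring_pgf (excess_pmf xi) t)
        \<le> (1 - extinction_prob xi) * (t * t)"
      using q t flat[of t] by (intro mult_left_mono) auto
    then have "offspring_pgf xi (t * (1 - extinction_prob xi) + extinction_prob xi) - extinction_prob xi
        \<le> (1 - extinction_prob xi) * t\<^sup>2"
      using pgf_excess_pmf_eq[OF q, of t] t by (simp add: power2_eq_square)
    also have "t * (1 - extinction_prob xi) + extinction_prob xi
        = extinction_prob xi + (1 - extinction_prob xi) * t"
      by (simp add: mult.commute)
    finally show ?thesis .
  qed
  from pgf_quadratically_flat[OF extinction_prob_bounds(1) q pgf_extinction_prob this]
  show "extinction_prob xi = 0" "pmf xi 0 = 0" "pmf xi 1 = 0" by blast+
qed

text \<open>With excess mean at most 1, a fixed point below 1 forces the excess to be constantly 1.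
  Then \<phi> is the identity, q = 0 and g(t) = t^2, which only the offspring number 2
  produces.\<close>

lemma breaker_value_eq_1:
  assumes q: "extinction_prob xi < 1" and mean: "offspring_mean xi \<le> 2" and "pmf xi 2 \<noteq> 1"
  shows "breaker_value xi = 1"
proof (rule ccontr)
  assume "breaker_value xi \<noteq> 1"
  then have x: "breaker_value xi < 1" using breaker_value_bounds[of xi] by simp
  have "offspring_mean (excess_pmf xi) + 1 \<le> 1 + 1"
    using offspring_mean_excess_pmf[OF q] mean by simp
  then have mean': "offspring_mean (excess_pmf xi) \<le> 1"
    using ennreal_add_left_cancel_le[of 1 "offspring_mean (excess_pmf xi)" 1] by (simp add: add.commute)
  have one: "pmf (excess_pmf xi) 1 = 1"
    using pgf_no_fixpoint_subcritical[OF mean' _ breaker_value_bounds(1) x] pgf_breaker_value by blast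
  then have "measure_pmf.prob (excess_pmf xi) {1} = 1" by (simp add: measure_pmf_single)
  then have "set_pmf (excess_pmf xi) \<subseteq> {0, 1}"
    by (auto simp: measure_pmf.prob_eq_1 AE_measure_pmf_iff)
  then have id: "offspring_pgf (excess_pmf xi) t = t" if "0 \<le> t" "t \<le> 1" for t
    using pgf_support_le_one(1)[OF _ that] one by simp
  have "extinction_prob xi = 0" "pmf xi 0 = 0" "pmf xi 1 = 0"
    using excess_pgf_flat[OF q] id by auto
  moreover from this have "offspring_pgf xi (1/2) = (1/2)\<^sup>2"
    using pgf_excess_pmf_eq[OF q, of "1/2"] id[of "1/2"] by (simp add: power2_eq_square)
  ultimately show False
    using pgf_eq_square_imp[of xi] assms(3) by simp
qed

text \<open>With at least two children q = 0 and t \<phi>(t) = g(t) \<le> t^2, so every t in (0, 1]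
  is an upper bound of the value.\<close>

lemma breaker_value_eq_0:
  assumes "AE k in measure_pmf xi. 2 \<le> k"
  shows "extinction_prob xi = 0" "breaker_value xi = 0"
proof -
  have supp: "2 \<le> k" if "k \<in> set_pmf xi" for k
    using assms that by (simp add: AE_measure_pmf_iff)
  then have "0 \<notin> set_pmf xi" by fastforce
  then show q: "extinction_prob xi = 0"
    by (intro extinction_prob_eq_0) (simp add: set_pmf_iff)
  have "breaker_value xi \<le> t" if t: "0 < t" "t \<le> 1" for t
  proof (rule breaker_value_le)
    have "t * offspring_pgf (excess_pmf xi) t = offspring_pgf xi t"
      using pgf_excess_pmf_eq[of xi t] t q by simp
    also have "\<dots> = measure_pmf.expectation xi (\<lambda>k. t ^ k)"
      using t by (intro pgf_sums) auto
    also have "\<dots> \<le> measure_pmf.expectation xi (\<lambda>k. t ^ 2)"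
      using t supp by (intro integral_mono_AE integrable_power_pmf)
        (auto simp: AE_measure_pmf_iff intro: power_decreasing)
    finally show "offspring_pgf (excess_pmf xi) t \<le> t"
      using t by (simp add: power2_eq_square)
  qed (use t in auto)
  then have "breaker_value xi \<le> 0 + e" if "e > 0" for e
    using that by (cases "e \<le> 1") (auto intro: order_trans[OF breaker_value_bounds(2)])
  then have "breaker_value xi \<le> 0"
    by (rule field_le_epsilon)
  then show "breaker_value xi = 0"
    using breaker_value_bounds[of xi] by simp
qed

lemma breaker_value_supercritical:
  assumes mean: "offspring_mean xi > 2" and pos: "pmf xi 0 + pmf xi 1 > 0"
  shows "extinction_prob xi < 1" "0 < breaker_value xi" "breaker_value xi < 1"
    and "0 < z \<Longrightarrow> z < 1 \<Longrightarrow>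
      z\<^sup>2 * (1 - extinction_prob xi) = offspring_pgf xi (z * (1 - extinction_prob xi) + extinction_prob xi) - extinction_prob xi
      \<Longrightarrow> z = breaker_value xi"
proof -
  have "(1::ennreal) < 2" by simp
  with mean show q: "extinction_prob xi < 1"
    by (intro extinction_prob_less_one) (rule less_trans)
  have mean': "offspring_mean (excess_pmf xi) > 1"
  proof (rule ccontr)
    assume "\<not> offspring_mean (excess_pmf xi) > 1"
    then have "offspring_mean (excess_pmf xi) + 1 \<le> 1 + 1"
      by (intro add_right_mono) simp
    with mean show False
      using offspring_mean_excess_pmf[OF q] by simp
  qed
  from pgf_le_id_supercritical[OF this] show x1: "breaker_value xi < 1"
    using breaker_value_le[of _ xi] by (metis less_imp_le order_le_less_trans)
  show x0: "0 < breaker_value xi"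
  proof (rule ccontr)
    assume "\<not> 0 < breaker_value xi"
    then have "breaker_value xi = 0" using breaker_value_bounds[of xi] by simp
    \<comment> \<open>If 0 is a fixed point, the excess is almost surely at least 1. Then \<phi>(t)
      \<le> t everywhere, and flatness gives p_0 = p_1 = 0.\<close>
    then have "0 \<notin> set_pmf (excess_pmf xi)"
      using pgf_breaker_value[of xi] by (simp add: set_pmf_iff)
    then have supp: "1 \<le> k" if "k \<in> set_pmf (excess_pmf xi)" for k
      using that by (cases k) auto
    have "offspring_pgf (excess_pmf xi) t \<le> t" if t: "0 < t" "t \<le> 1" for t
    proof -
      have "offspring_pgf (excess_pmf xi) t = measure_pmf.expectation (excess_pmf xi) (\<lambda>k. t ^ k)"
        using t by (intro pgf_sums) auto
      also have "\<dots> \<le> measure_pmf.expectation (excess_pmf xi) (\<lambda>k. t ^ 1)"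
        using t supp by (intro integral_mono_AE integrable_power_pmf)
          (auto simp: AE_measure_pmf_iff intro: power_decreasing[of 1, simplified])
      finally show ?thesis by simp
    qed
    from excess_pgf_flat[OF q this] pos show False by simp
  qed
  show "z = breaker_value xi"
    if z: "0 < z" "z < 1" and sol: "z\<^sup>2 * (1 - extinction_prob xi)
      = offspring_pgf xi (z * (1 - extinction_prob xi) + extinction_prob xi) - extinction_prob xi"
  proof (rule ccontr)
    assume ne: "z \<noteq> breaker_value xi"
    have "(1 - extinction_prob xi) * (z * offspring_pgf (excess_pmf xi) z)
        = (1 - extinction_prob xi) * (z * z)"
      using pgf_excess_pmf_eq[OF q, of z] z sol by (simp add: power2_eq_square mult_ac)
    then have "offspring_pgf (excess_pmf xi) z = z" using q z by simp
    then show False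
      using ne z x0 x1 pgf_breaker_value[of xi] pgf_fixpoint_unique_supercritical[OF mean', of z "breaker_value xi"]
        pgf_fixpoint_unique_supercritical[OF mean', of "breaker_value xi" z]
      by (cases "z < breaker_value xi") auto
  qed
qed

section \<open>Positions of the game\<close>

lemma path_edges_Nil [simp]: "path_edges [] = {}"
  by (auto simp: path_edges_def)

lemma path_edges_rec: "v \<noteq> [] \<Longrightarrow> path_edges v = insert v (path_edges (butlast v))"
  by (cases v rule: rev_cases) (auto simp: path_edges_def)

lemma path_edges_snoc [simp]: "path_edges (v @ [k]) = insert (v @ [k]) (path_edges v)"
  by (simp add: path_edges_rec)

lemma strict_prefix_butlast: "strict_prefix v w \<Longrightarrow> prefix v (butlast w)"
  by (cases w rule: rev_cases) (auto simp: strict_prefix_def)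

text \<open>Invariant of the positions reached in a play: the fixated edges form a finite tree at
  the root, and every claimed edge hangs off an internal node. Hence no claimed edge lies strictly
  below an external node.\<close>

definition legal :: "(node \<Rightarrow> nat) \<Rightarrow> position \<Rightarrow> bool" where
  "legal c s \<longleftrightarrow> finite (fst s) \<and> fst s \<inter> snd s = {} \<and>
     (\<forall>u\<in>fst s. u \<in> gw_tree c \<and> u \<noteq> [] \<and> butlast u \<in> insert [] (fst s)) \<and>
     (\<forall>u\<in>snd s. u \<noteq> [] \<and> butlast u \<in> insert [] (fst s))"

lemma legal_path_edges:
  assumes "legal c s" "u \<in> insert [] (fst s)"
  shows "path_edges u \<subseteq> fst s"
  using assms(2)
proof (induction u rule: rev_induct)
  case (snoc k u)
  then have "u \<in> insert [] (fst s)" using assms(1) by (fastforce simp: legal_def)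
  with snoc show ?case by auto
qed simp

lemma internal_legal:
  assumes "legal c s" shows "internal c s = insert [] (fst s)"
proof
  show "internal c s \<subseteq> insert [] (fst s)"
  proof
    fix v assume "v \<in> internal c s"
    then show "v \<in> insert [] (fst s)"
      by (cases v rule: rev_cases) (auto simp: internal_def)
  qed
  show "insert [] (fst s) \<subseteq> internal c s"
    using legal_path_edges[OF assms] assms by (auto simp: internal_def legal_def)
qed

text \<open>The path to the parent is fixated, so the only edge whose removal could cut
  \<open>v\<close> off is its own.\<close>

lemma external_legal:
  assumes "legal c s"
  shows "external c s = {v \<in> gw_tree c. v \<noteq> [] \<and> v \<notin> fst s \<and> v \<notin> snd s \<and> butlast v \<in> insert [] (fst s)}"
proof -
  have "path_edges v \<inter> snd s = {} \<longleftrightarrow> v \<notin> snd s" if "v \<noteq> []" "butlast v \<in> insert [] (fst s)" for v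
    using legal_path_edges[OF assms that(2)] that(1) assms by (auto simp: path_edges_rec legal_def)
  then show ?thesis
    unfolding external_def internal_legal[OF assms] root_component_def by auto
qed

lemma legal_initial: "legal c ({}, {})"
  by (simp add: legal_def)

lemma legal_remove: "legal c s \<Longrightarrow> v \<in> external c s \<Longrightarrow> legal c (fst s, insert v (snd s))"
  by (auto simp: external_legal) (auto simp: legal_def)

lemma legal_fixate: "legal c s \<Longrightarrow> v \<in> external c s \<Longrightarrow> legal c (insert v (fst s), snd s)"
  by (auto simp: external_legal) (auto simp: legal_def)

lemma external_remove:
  "legal c s \<Longrightarrow> v \<in> external c s \<Longrightarrow> external c (fst s, insert v (snd s)) = external c s - {v}"
  using legal_remove[of c s v] by (auto simp: external_legal)

lemma external_fixate:
  assumes s: "legal c s" and v: "v \<in> external c s"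
  shows "external c (insert v (fst s), snd s) = external c s - {v} \<union> (\<lambda>i. v @ [i]) ` {..<c v}"
    (is "?L = ?R")
proof -
  have v': "v \<in> gw_tree c" "v \<noteq> []" "v \<notin> fst s"
    using v by (auto simp: external_legal[OF s])
  \<comment> \<open>Every claimed edge hangs off an internal node, and \<open>v\<close> was not
    internal before this move.\<close>
  have new: "v @ [i] \<notin> fst s" "v @ [i] \<notin> snd s" for i
  proof -
    have "\<forall>u\<in>fst s \<union> snd s. butlast u \<in> insert [] (fst s)"
      using s by (auto simp: legal_def)
    moreover have "butlast (v @ [i]) \<notin> insert [] (fst s)" using v' by simp
    ultimately show "v @ [i] \<notin> fst s" "v @ [i] \<notin> snd s" by blast+
  qed
  show ?thesis
  proof (rule set_eqI)
    fix w
    show "w \<in> ?L \<longleftrightarrow> w \<in> ?R"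
    proof (cases w rule: rev_cases)
      case Nil
      then show ?thesis
        by (simp add: image_iff external_legal[OF s] external_legal[OF legal_fixate[OF s v]])
    next
      case (snoc u k)
      have im: "w \<in> (\<lambda>i. v @ [i]) ` {..<c v} \<longleftrightarrow> u = v \<and> k < c v"
        using snoc by (simp add: image_iff)
      show ?thesis
      proof (cases "u = v")
        case True
        then show ?thesis
          using snoc v' new[of k] unfolding Un_iff im
          by (simp add: external_legal[OF s] external_legal[OF legal_fixate[OF s v]])
      next
        case False
        then show ?thesis
          using snoc unfolding Un_iff im
          by (simp add: external_legal[OF s] external_legal[OF legal_fixate[OF s v]]) blast
      qed
    qed
  qed
qed

lemma finite_external:
  assumes "legal c s" shows "finite (external c s)"
proof -
  have "external c s \<subseteq> (\<Union>u\<in>insert [] (fst s). (\<lambda>i. u @ [i]) ` {..<c u})"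
  proof
    fix v assume v: "v \<in> external c s"
    then obtain u i where "v = u @ [i]" by (cases v rule: rev_cases) (auto simp: external_legal[OF assms])
    with v show "v \<in> (\<Union>u\<in>insert [] (fst s). (\<lambda>i. u @ [i]) ` {..<c u})"
      by (auto simp: external_legal[OF assms])
  qed
  then show ?thesis using assms by (auto simp: legal_def intro: finite_subset)
qed

section \<open>Counting the infinite external subtrees\<close>

definition immortal_external :: "(node \<Rightarrow> nat) \<Rightarrow> position \<Rightarrow> node set" where
  "immortal_external c s = {v \<in> external c s. infinite (gw_tree (reroot v c))}"

text \<open>This is the L of the overview.\<close>

definition lives :: "(node \<Rightarrow> nat) \<Rightarrow> position \<Rightarrow> nat" where
  "lives c s = card (immortal_external c s)"

lemma finite_immortal_external: "legal c s \<Longrightarrow> finite (immortal_external c s)"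
  using finite_external by (simp add: immortal_external_def)

lemma lives_eq_0_iff: "legal c s \<Longrightarrow> lives c s = 0 \<longleftrightarrow> immortal_external c s = {}"
  using finite_immortal_external by (auto simp: lives_def)

lemma lives_initial: "lives c ({}, {}) = broods c"
proof -
  have "immortal_external c ({}, {}) = (\<lambda>i. [i]) ` immortal_children c"
  proof (intro equalityI subsetI)
    fix v assume v: "v \<in> immortal_external c ({}, {})"
    then obtain u i where "v = u @ [i]"
      by (cases v rule: rev_cases) (auto simp: immortal_external_def external_legal[OF legal_initial])
    with v show "v \<in> (\<lambda>i. [i]) ` immortal_children c"
      by (auto simp: immortal_external_def external_legal[OF legal_initial] immortal_children_def gw_tree_Cons)
  qed (auto simp: immortal_external_def external_legal[OF legal_initial] immortal_children_def gw_tree_Cons)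
  then show ?thesis
    by (simp add: lives_def broods_def card_image inj_on_def)
qed

lemma lives_remove:
  assumes "legal c s" "v \<in> external c s"
  shows "lives c (fst s, insert v (snd s)) = (if v \<in> immortal_external c s then lives c s - 1 else lives c s)"
proof -
  have "immortal_external c (fst s, insert v (snd s)) = immortal_external c s - {v}"
    using external_remove[OF assms] by (auto simp: immortal_external_def)
  then show ?thesis
    using finite_immortal_external[OF assms(1)] by (simp add: lives_def)
qed

text \<open>A fixated node gives way to its children with infinite subtrees. A node with a finite
  subtree was not counted and has no such children, hence the second branch.\<close>

lemma lives_fixate:
  assumes "legal c s" "v \<in> external c s"
  shows "lives c (insert v (fst s), snd s)
    = (if v \<in> immortal_external c s then lives c s - 1 + broods (reroot v c) else lives c s)"
proof -
  let ?C = "(\<lambda>i. v @ [i]) ` immortal_children (reroot v c)"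
  have "immortal_external c (insert v (fst s), snd s) = immortal_external c s - {v} \<union> ?C"
    using external_fixate[OF assms]
    by (auto simp: immortal_external_def immortal_children_def reroot_reroot reroot_apply)
  moreover have "(immortal_external c s - {v}) \<inter> ?C = {}"
    using assms by (auto simp: immortal_external_def external_legal)
  ultimately have "lives c (insert v (fst s), snd s) = card (immortal_external c s - {v}) + card ?C"
    using finite_immortal_external[OF assms(1)] by (simp add: lives_def card_Un_disjoint)
  also have "card ?C = broods (reroot v c)"
    by (simp add: broods_def card_image inj_on_def)
  finally show ?thesis
    using assms(2) finite_immortal_external[OF assms(1)] broods_eq_0[of "reroot v c"]
    by (auto simp: lives_def immortal_external_def)
qed

lemma infinite_if_lives:
  assumes "legal c s" "0 < lives c s"
  shows "infinite (gw_tree c)"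
proof -
  obtain v where v: "v \<in> immortal_external c s"
    using assms lives_eq_0_iff[OF assms(1)] by auto
  then have "v \<in> gw_tree c" "infinite (gw_tree (reroot v c))"
    using assms by (auto simp: immortal_external_def external_legal)
  then have "infinite (subtree c v)" by (simp add: finite_subtree_iff)
  then show ?thesis by (rule contrapos_nn) (auto simp: subtree_def)
qed

text \<open>Nothing below an external node has been claimed, so its whole subtree is still attached
  to the root. Conversely, the component is covered by the internal nodes and the subtrees of the
  finitely many external nodes.\<close>

lemma finite_root_component_iff:
  assumes s: "legal c s"
  shows "finite (root_component c s) \<longleftrightarrow> lives c s = 0"
proof
  assume fin: "finite (root_component c s)"
  have False if "v \<in> immortal_external c s" for v
  proof -
    have v: "v \<in> gw_tree c" "v \<notin> fst s" "infinite (gw_tree (reroot v c))" "v \<noteq> []"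
      using that s by (auto simp: immortal_external_def external_legal)
    have vr: "v \<in> root_component c s"
      using that by (simp add: immortal_external_def external_def)
    have "subtree c v \<subseteq> root_component c s"
    proof
      fix w assume w: "w \<in> subtree c v"
      have "u \<notin> snd s" if u: "u \<in> path_edges w" for u
      proof (cases "prefix u v")
        case True
        then show ?thesis using u vr by (auto simp: root_component_def path_edges_def)
      next
        case False
        then have "strict_prefix v u"
          using u w by (auto simp: path_edges_def subtree_def strict_prefix_def dest: prefix_same_cases)
        \<comment> \<open>A removed edge strictly below \<open>v\<close> would hang off an internal
          node at or below \<open>v\<close>, so \<open>v\<close> itself would be fixated.\<close>
        then have "v \<in> path_edges (butlast u)"
          using v strict_prefix_butlast by (auto simp: path_edges_def)
        then show ?thesis
          using legal_path_edges[OF s, of "butlast u"] s v by (auto simp: legal_def)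
      qed
      with w show "w \<in> root_component c s" by (auto simp: root_component_def subtree_def)
    qed
    with fin v show False
      using finite_subtree_iff[OF v(1)] finite_subset by blast
  qed
  then show "lives c s = 0" using lives_eq_0_iff[OF s] by blast
next
  assume 0: "lives c s = 0"
  have "root_component c s \<subseteq> insert [] (fst s) \<union> (\<Union>v\<in>external c s. subtree c v)"
  proof
    fix w assume "w \<in> root_component c s"
    then show "w \<in> insert [] (fst s) \<union> (\<Union>v\<in>external c s. subtree c v)"
    proof (induction w rule: rev_induct)
      case (snoc k u)
      then have w: "u @ [k] \<in> root_component c s" and u: "u \<in> root_component c s"
        by (auto simp: root_component_def)
      from snoc.IH[OF u] show ?case
      proof
        assume "u \<in> insert [] (fst s)"
        then have "u @ [k] \<in> fst s \<or> u @ [k] \<in> external c s"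
          using w by (auto simp: external_legal[OF s] root_component_def)
        then show ?thesis
          using w by (auto simp: subtree_def root_component_def)
      next
        assume "u \<in> (\<Union>v\<in>external c s. subtree c v)"
        then show ?thesis
          using w by (auto simp: subtree_def root_component_def)
      qed
    qed simp
  qed
  moreover have "finite (subtree c v)" if "v \<in> external c s" for v
    using 0 that s lives_eq_0_iff[OF s]
    by (auto simp: immortal_external_def finite_subtree_iff external_legal)
  ultimately show "finite (root_component c s)"
    using s finite_external[OF s] by (auto simp: legal_def intro: finite_subset)
qed

section \<open>Plays\<close>

definition pos :: "strategy \<Rightarrow> strategy \<Rightarrow> nat \<Rightarrow> (node \<Rightarrow> nat) \<Rightarrow> position" where
  "pos \<sigma> \<tau> n c = last (play \<sigma> \<tau> c n)"

text \<open>Meaningful only while external nodes exist; afterwards \<open>pos_Suc\<close> ignores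
  the value.\<close>

definition choice :: "strategy \<Rightarrow> strategy \<Rightarrow> nat \<Rightarrow> (node \<Rightarrow> nat) \<Rightarrow> node" where
  "choice \<sigma> \<tau> n c = (if even n then \<sigma> else \<tau>) (map (observe c) (play \<sigma> \<tau> c n))"

lemma play_Suc: "play \<sigma> \<tau> c (Suc n) = play \<sigma> \<tau> c n @
   [if external c (pos \<sigma> \<tau> n c) = {} then pos \<sigma> \<tau> n c
    else if even n then (fst (pos \<sigma> \<tau> n c), insert (choice \<sigma> \<tau> n c) (snd (pos \<sigma> \<tau> n c)))
    else (insert (choice \<sigma> \<tau> n c) (fst (pos \<sigma> \<tau> n c)), snd (pos \<sigma> \<tau> n c))]"
  by (simp add: Let_def pos_def choice_def)

lemma pos_0: "pos \<sigma> \<tau> 0 c = ({}, {})"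
  by (simp add: pos_def)

lemma pos_Suc: "pos \<sigma> \<tau> (Suc n) c =
   (if external c (pos \<sigma> \<tau> n c) = {} then pos \<sigma> \<tau> n c
    else if even n then (fst (pos \<sigma> \<tau> n c), insert (choice \<sigma> \<tau> n c) (snd (pos \<sigma> \<tau> n c)))
    else (insert (choice \<sigma> \<tau> n c) (fst (pos \<sigma> \<tau> n c)), snd (pos \<sigma> \<tau> n c)))"
  by (simp only: pos_def[of _ _ "Suc n"] play_Suc last_snoc)

declare play.simps(2) [simp del]

lemma play_neq_Nil [simp]: "play \<sigma> \<tau> c n \<noteq> []"
  by (cases n) (auto simp: play_Suc)

lemma play_snoc_pos: "\<exists>ss. play \<sigma> \<tau> c n = ss @ [pos \<sigma> \<tau> n c]"
  unfolding pos_def by (metis append_butlast_last_id play_neq_Nil)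

lemma choice_external:
  assumes "\<sigma> \<in> strategies" "\<tau> \<in> strategies" "external c (pos \<sigma> \<tau> n c) \<noteq> {}"
  shows "choice \<sigma> \<tau> n c \<in> external c (pos \<sigma> \<tau> n c)"
proof -
  obtain ss where "play \<sigma> \<tau> c n = ss @ [pos \<sigma> \<tau> n c]" using play_snoc_pos by blast
  then show ?thesis using assms by (auto simp: choice_def strategies_def observe_def)
qed

lemma set_play: "set (play \<sigma> \<tau> c n) = (\<lambda>m. pos \<sigma> \<tau> m c) ` {..n}"
  by (induction n) (auto simp: pos_0 play_Suc pos_Suc atMost_Suc)

context
  fixes \<sigma> \<tau> :: strategy
  assumes strategies: "\<sigma> \<in> strategies" "\<tau> \<in> strategies"
begin

lemma legal_pos: "legal c (pos \<sigma> \<tau> n c)"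
proof (induction n)
  case (Suc n)
  then show ?case
    using choice_external[OF strategies, of c n] legal_remove legal_fixate by (simp add: pos_Suc)
qed (simp add: pos_0 legal_initial)

lemma fst_pos_mono: "m \<le> n \<Longrightarrow> fst (pos \<sigma> \<tau> m c) \<subseteq> fst (pos \<sigma> \<tau> n c)"
  by (induction n rule: dec_induct) (auto simp: pos_Suc)

lemma lives_pos_Suc:
  "lives c (pos \<sigma> \<tau> (Suc n) c) =
    (if choice \<sigma> \<tau> n c \<in> immortal_external c (pos \<sigma> \<tau> n c)
     then lives c (pos \<sigma> \<tau> n c) - 1 + (if even n then 0 else broods (reroot (choice \<sigma> \<tau> n c) c))
     else lives c (pos \<sigma> \<tau> n c))"
proof (cases "external c (pos \<sigma> \<tau> n c) = {}")
  case True
  then show ?thesis by (simp add: pos_Suc immortal_external_def)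
next
  case False
  then show ?thesis
    using choice_external[OF strategies False] lives_remove[OF legal_pos] lives_fixate[OF legal_pos]
    by (simp add: pos_Suc)
qed

lemma lives_pos_eq_0_mono:
  assumes "lives c (pos \<sigma> \<tau> m c) = 0" "m \<le> n" shows "lives c (pos \<sigma> \<tau> n c) = 0"
  using assms(2)
proof (induction n rule: dec_induct)
  case (step n)
  then have "immortal_external c (pos \<sigma> \<tau> n c) = {}" using lives_eq_0_iff[OF legal_pos] by blast
  with step show ?case by (simp add: lives_pos_Suc)
qed (rule assms(1))

lemma breaker_wins_iff: "breaker_wins \<sigma> \<tau> c \<longleftrightarrow> (\<exists>n. lives c (pos \<sigma> \<tau> n c) = 0)"
  using finite_root_component_iff[OF legal_pos] by (simp add: breaker_wins_def pos_def)

end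

section \<open>Unobserved subtrees\<close>

text \<open>As long as \<open>v\<close> is not fixated, no internal node lies at or below it and no
  external node strictly below it. So an exchange of its subtree leaves both node sets alone, and
  \<open>subtree_size_graft\<close> takes care of the displayed sizes.\<close>

lemma
  assumes s: "legal c s" and v: "v \<in> gw_tree c" "v \<noteq> []" "v \<notin> fst s"
  shows legal_graft: "legal (graft v c d) s"
    and external_graft: "external (graft v c d) s = external c s"
    and observe_graft: "infinite (gw_tree (reroot v c)) \<Longrightarrow> infinite (gw_tree d) \<Longrightarrow>
      observe (graft v c d) s = observe c s"
proof -
  have np: "\<not> prefix v u" if "u \<in> insert [] (fst s)" for u
    using legal_path_edges[OF s that] v by (auto simp: path_edges_def)
  then have np_int: "\<not> strict_prefix v u" if "u \<in> insert [] (fst s)" for u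
    using that by (auto simp: strict_prefix_def)
  have np_ext: "\<not> strict_prefix v w" if "butlast w \<in> insert [] (fst s)" for w
    using np[OF that] strict_prefix_butlast by blast
  show legal: "legal (graft v c d) s"
    using s np_int by (auto simp: legal_def gw_tree_graft)
  show ext: "external (graft v c d) s = external c s"
    using np_ext by (auto simp: external_legal s legal gw_tree_graft)
  show "observe (graft v c d) s = observe c s"
    if inf: "infinite (gw_tree (reroot v c))" "infinite (gw_tree d)"
  proof -
    have "subtree_size (graft v c d) u = subtree_size c u"
      if "u \<in> insert [] (fst s) \<union> external c s" for u
      using that np_int np_ext v inf by (intro subtree_size_graft) (auto simp: external_legal[OF s])
    then show ?thesis
      unfolding observe_def ext internal_legal[OF s] internal_legal[OF legal]
      by (auto simp: restrict_map_def fun_eq_iff)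
  qed
qed

lemma immortal_external_graft:
  assumes s: "legal c s" and v: "v \<in> immortal_external c s" and d: "infinite (gw_tree d)"
  shows "immortal_external (graft v c d) s = immortal_external c s"
proof -
  have v': "v \<in> gw_tree c" "v \<noteq> []" "v \<notin> fst s" "butlast v \<in> insert [] (fst s)"
    "infinite (gw_tree (reroot v c))"
    using v s by (auto simp: immortal_external_def external_legal)
  have "infinite (gw_tree (reroot w (graft v c d))) \<longleftrightarrow> infinite (gw_tree (reroot w c))"
    if w: "w \<in> external c s" for w
  proof (cases "w = v")
    case False
    have w': "w \<noteq> []" "w \<notin> fst s" "butlast w \<in> insert [] (fst s)"
      using w by (auto simp: external_legal[OF s])
    \<comment> \<open>External nodes form an antichain: all proper ancestors of \<open>b\<close> are
      internal, and \<open>a\<close> is not.\<close>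
    have "\<not> prefix a b" if "a \<noteq> b" "a \<noteq> []" "a \<notin> fst s" "butlast b \<in> insert [] (fst s)" for a b
    proof
      assume "prefix a b"
      then have "a \<in> path_edges (butlast b)"
        using that strict_prefix_butlast[of a b] by (auto simp: path_edges_def strict_prefix_def)
      with legal_path_edges[OF s that(4)] that show False by auto
    qed
    then show ?thesis
      using False v' w' by (simp add: reroot_graft_disjoint)
  qed (use d v' in simp)
  then show ?thesis
    using external_graft[OF s v'(1-3)] by (auto simp: immortal_external_def)
qed

context
  fixes \<sigma> \<tau> :: strategy
  assumes strategies: "\<sigma> \<in> strategies" "\<tau> \<in> strategies"
begin

text \<open>Fixated edges stay fixated, so \<open>v\<close> was unfixated at all earlier times as
  well, possibly before it was even visible. Inductively both trees produce the same observations,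
  hence the same moves, including the observation at time \<open>n\<close> on which the next choice
  rests.\<close>

lemma play_graft:
  assumes v: "v \<in> immortal_external c (pos \<sigma> \<tau> n c)" and d: "infinite (gw_tree d)" and "m \<le> n"
  shows "play \<sigma> \<tau> (graft v c d) m = play \<sigma> \<tau> c m \<and>
    map (observe (graft v c d)) (play \<sigma> \<tau> c m) = map (observe c) (play \<sigma> \<tau> c m)"
proof -
  note legal = legal_pos[OF strategies]
  have v': "v \<in> gw_tree c" "v \<noteq> []" "infinite (gw_tree (reroot v c))" "v \<notin> fst (pos \<sigma> \<tau> n c)"
    using v legal by (auto simp: immortal_external_def external_legal)
  have vm: "v \<notin> fst (pos \<sigma> \<tau> m c)" if "m \<le> n" for m
    using v' fst_pos_mono[OF strategies that, of c] by auto
  have obs: "map (observe (graft v c d)) (play \<sigma> \<tau> c m) = map (observe c) (play \<sigma> \<tau> c m)" if "m \<le> n" for m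
    using that vm v' d by (auto simp: set_play intro!: observe_graft legal)
  have "play \<sigma> \<tau> (graft v c d) m = play \<sigma> \<tau> c m"
    using \<open>m \<le> n\<close>
  proof (induction m)
    case (Suc m)
    then have eq: "play \<sigma> \<tau> (graft v c d) m = play \<sigma> \<tau> c m" and m: "m \<le> n" by auto
    then have pos: "pos \<sigma> \<tau> m (graft v c d) = pos \<sigma> \<tau> m c" by (simp add: pos_def)
    have choice: "choice \<sigma> \<tau> m (graft v c d) = choice \<sigma> \<tau> m c"
      by (simp only: choice_def eq obs[OF m])
    have "external (graft v c d) (pos \<sigma> \<tau> m c) = external c (pos \<sigma> \<tau> m c)"
      using vm[OF m] v' by (intro external_graft legal)
    then show ?case by (simp only: play_Suc eq pos choice)
  qed simp
  with obs \<open>m \<le> n\<close> show ?thesis by blast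
qed

lemma
  assumes v: "v \<in> immortal_external c (pos \<sigma> \<tau> n c)" and d: "infinite (gw_tree d)"
  shows pos_graft: "pos \<sigma> \<tau> n (graft v c d) = pos \<sigma> \<tau> n c"
    and choice_graft: "choice \<sigma> \<tau> n (graft v c d) = choice \<sigma> \<tau> n c"
    and immortal_external_pos_graft:
      "immortal_external (graft v c d) (pos \<sigma> \<tau> n c) = immortal_external c (pos \<sigma> \<tau> n c)"
proof -
  have eq: "play \<sigma> \<tau> (graft v c d) n = play \<sigma> \<tau> c n"
    and obs: "map (observe (graft v c d)) (play \<sigma> \<tau> c n) = map (observe c) (play \<sigma> \<tau> c n)"
    using play_graft[OF v d order_refl] by blast+
  show "pos \<sigma> \<tau> n (graft v c d) = pos \<sigma> \<tau> n c" by (simp only: pos_def eq)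
  show "choice \<sigma> \<tau> n (graft v c d) = choice \<sigma> \<tau> n c" by (simp only: choice_def eq obs)
  show "immortal_external (graft v c d) (pos \<sigma> \<tau> n c) = immortal_external c (pos \<sigma> \<tau> n c)"
    by (rule immortal_external_graft[OF legal_pos[OF strategies] v d])
qed

end

section \<open>Measurability of plays\<close>

lemma tree_rv_internal:
  assumes "finite (fst s)" shows "tree_rv (\<lambda>c. internal c s)"
proof -
  have "internal c s = {v \<in> insert [] (fst s). v \<in> gw_tree c \<and> path_edges v \<subseteq> fst s}" for c
  proof -
    have "v \<in> insert [] (fst s)" if "path_edges v \<subseteq> fst s" for v
      using that by (cases v rule: rev_cases) auto
    then show ?thesis by (auto simp: internal_def)
  qed
  moreover have "tree_rv (\<lambda>c. {v \<in> insert [] (fst s). v \<in> gw_tree c \<and> path_edges v \<subseteq> fst s})"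
    using assms by (intro tree_rv_finite_Collect tree_rv_conj tree_rv_in_gw_tree tree_rv_const) simp
  ultimately show ?thesis by simp
qed

text \<open>The last index of an external node is below the total offspring of the candidates for
  internal nodes. Once this sum is fixed, the external set is cut out of a fixed finite set by
  measurable conditions.\<close>

lemma external_finite_cover:
  assumes "finite (fst s)"
  shows "external c s = {v \<in> (\<lambda>(u, k). u @ [k]) ` (insert [] (fst s) \<times> {..<\<Sum>u\<in>insert [] (fst s). c u}).
    v \<in> gw_tree c \<and> path_edges v \<inter> snd s = {} \<and> v \<notin> internal c s \<and> butlast v \<in> internal c s}"
proof -
  have "v \<in> (\<lambda>(u, k). u @ [k]) ` (insert [] (fst s) \<times> {..<\<Sum>u\<in>insert [] (fst s). c u})"
    if v: "v \<in> external c s" for v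
  proof -
    have "v \<noteq> []" using v by (auto simp: external_def internal_def)
    then obtain u k where uk: "v = u @ [k]" by (cases v rule: rev_cases) auto
    have "u \<in> internal c s" using v uk by (simp add: external_def)
    then have u: "u \<in> insert [] (fst s)"
      by (cases u rule: rev_cases) (auto simp: internal_def)
    have "k < c u" using v uk by (auto simp: external_def root_component_def)
    also have "c u \<le> (\<Sum>u\<in>insert [] (fst s). c u)"
      using assms u by (intro member_le_sum) auto
    finally show ?thesis using uk u by force
  qed
  then show ?thesis by (auto simp: external_def root_component_def)
qed

lemma tree_rv_sum: "finite A \<Longrightarrow> tree_rv (\<lambda>c. \<Sum>u\<in>A. c u :: nat)"
  by (induction A rule: finite_induct)
     (auto intro: tree_rv_const tree_rv_comp2[where G = "(+)"] tree_rv_component)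

lemma tree_rv_external:
  assumes s: "finite (fst s)" shows "tree_rv (\<lambda>c. external c s)"
proof -
  define A where "A n = (\<lambda>(u, k). u @ [k]) ` (insert [] (fst s) \<times> {..<n::nat})" for n
  define E where "E n c = {v \<in> A n. v \<in> gw_tree c \<and> path_edges v \<inter> snd s = {} \<and>
      v \<notin> internal c s \<and> butlast v \<in> internal c s}" for n c
  have int: "tree_rv (\<lambda>c. v \<notin> internal c s \<and> w \<in> internal c s)" for v w
    using tree_rv_internal[OF s] by (rule tree_rv_comp)
  have E: "tree_rv (E n)" for n
    unfolding E_def
  proof (rule tree_rv_finite_Collect)
    show "finite (A n)" using s by (simp add: A_def)
    show "tree_rv (\<lambda>c. v \<in> gw_tree c \<and> path_edges v \<inter> snd s = {} \<and>
        v \<notin> internal c s \<and> butlast v \<in> internal c s)" for v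
      by (rule tree_rv_conj[OF tree_rv_in_gw_tree tree_rv_conj[OF tree_rv_const int]])
  qed
  have "tree_rv (\<lambda>c. \<Sum>u\<in>insert [] (fst s). c u)" using s by (intro tree_rv_sum) simp
  from tree_rv_bind[where H = E, OF this E] show ?thesis
    by (simp only: E_def A_def external_finite_cover[OF s, symmetric])
qed

lemma tree_rv_restrict_map:
  assumes "finite D" "\<And>v. tree_rv (\<lambda>c. f c v)"
  shows "tree_rv (\<lambda>c. (\<lambda>v. Some (f c v)) |` D)"
  using assms(1)
proof (induction D)
  case (insert a D)
  have "(\<lambda>v. Some (f c v)) |` insert a D = ((\<lambda>v. Some (f c v)) |` D)(a \<mapsto> f c a)" for c
    by (auto simp: fun_eq_iff restrict_map_def)
  moreover have "tree_rv (\<lambda>c. ((\<lambda>v. Some (f c v)) |` D)(a \<mapsto> f c a))"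
    using insert.IH assms(2)[of a] by (rule tree_rv_comp2[where G = "\<lambda>m x. m(a \<mapsto> x)"])
  ultimately show ?case by (simp only:)
qed (simp add: tree_rv_const)

lemma finite_internal: "finite (fst s) \<Longrightarrow> finite (internal c s)"
proof -
  assume "finite (fst s)"
  moreover have "internal c s \<subseteq> insert [] (fst s)"
  proof
    fix v assume "v \<in> internal c s"
    then show "v \<in> insert [] (fst s)"
      by (cases v rule: rev_cases) (auto simp: internal_def)
  qed
  ultimately show ?thesis by (auto intro: finite_subset)
qed

lemma tree_rv_observe:
  assumes s: "finite (fst s)" shows "tree_rv (\<lambda>c. observe c s)"
proof -
  have D: "tree_rv (\<lambda>c. internal c s \<union> external c s)"
    by (intro tree_rv_comp2[where G = "(\<union>)"] tree_rv_internal tree_rv_external s)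
  have "finite (external c s)" for c
    unfolding external_finite_cover[OF s] using s by auto
  then have "finite (internal c s \<union> external c s)" for c
    using finite_internal[OF s] by auto
  then have "tree_rv (\<lambda>c. (\<lambda>v. Some (subtree_size c v)) |` (internal c s \<union> external c s))"
    by (intro tree_rv_bind[where H = "\<lambda>D c. (\<lambda>v. Some (subtree_size c v)) |` D", OF D]
        tree_rv_restrict_map tree_rv_subtree_size)
  then show ?thesis
    unfolding observe_def
    by (intro tree_rv_comp2[where G = Pair] tree_rv_internal tree_rv_external s)
qed

lemma tree_rv_map_observe:
  assumes "\<And>s. s \<in> set ss \<Longrightarrow> finite (fst s)"
  shows "tree_rv (\<lambda>c. map (observe c) ss)"
  using assms
proof (induction ss)
  case (Cons s ss)
  then have "tree_rv (\<lambda>c. observe c s)" "tree_rv (\<lambda>c. map (observe c) ss)"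
    using tree_rv_observe[of s] by simp_all
  then show ?case
    unfolding list.map by (rule tree_rv_comp2)
qed (simp add: tree_rv_const)

context
  fixes \<sigma> \<tau> :: strategy
  assumes strategies: "\<sigma> \<in> strategies" "\<tau> \<in> strategies"
begin

lemma finite_fst_play: "s \<in> set (play \<sigma> \<tau> c n) \<Longrightarrow> finite (fst s)"
  using legal_pos[OF strategies] by (auto simp: set_play legal_def)

lemma tree_rv_history:
  assumes "tree_rv (\<lambda>c. play \<sigma> \<tau> c n)"
  shows "tree_rv (\<lambda>c. map (observe c) (play \<sigma> \<tau> c n))"
  by (rule tree_rv_bind[where H = "\<lambda>ss c. map (observe c) ss", OF assms],
      rule tree_rv_map_observe, rule finite_fst_play)

lemma tree_rv_play: "tree_rv (\<lambda>c. play \<sigma> \<tau> c n)"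
proof (induction n)
  case (Suc n)
  define P where "P c = play \<sigma> \<tau> c n" for c
  have P: "tree_rv P" using Suc by (simp add: P_def[abs_def])
  have "finite (fst (last (P c)))" for c
    using finite_fst_play[of "last (P c)" c n] by (simp add: P_def)
  then have ext: "tree_rv (\<lambda>c. external c (last (P c)))"
    by (intro tree_rv_bind[where H = "\<lambda>ss c. external c (last ss)", OF P] tree_rv_external)
  have hist: "tree_rv (\<lambda>c. map (observe c) (P c))"
    using tree_rv_history[OF Suc] by (simp add: P_def)
  \<comment> \<open>The strategies enter only through the arbitrary function \<open>G\<close>,
    applied to variables with countably many values.\<close>
  define G where "G E h ss = (let s = last ss in ss @ [if E = {} then s
              else if even n then (fst s, insert (\<sigma> h) (snd s))
              else (insert (\<tau> h) (fst s), snd s)])" for E :: "node set" and h ss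
  have "tree_rv (\<lambda>c. (external c (last (P c)), map (observe c) (P c)))"
    using ext hist by (rule tree_rv_comp2)
  from tree_rv_comp2[where G = "\<lambda>x. G (fst x) (snd x)", OF this P]
  have "tree_rv (\<lambda>c. G (external c (last (P c))) (map (observe c) (P c)) (P c))" by simp
  then show ?case by (simp add: G_def P_def play.simps(2) Let_def)
qed (simp add: tree_rv_const)

lemma tree_rv_pos: "tree_rv (pos \<sigma> \<tau> n)"
  using tree_rv_comp[OF tree_rv_play[of n], of last] by (simp add: pos_def[abs_def])

lemma tree_rv_choice: "tree_rv (choice \<sigma> \<tau> n)"
  using tree_rv_comp[OF tree_rv_history[OF tree_rv_play[of n]], of "if even n then \<sigma> else \<tau>"]
  by (simp add: choice_def[abs_def])

lemma tree_rv_immortal_external: "tree_rv (\<lambda>c. immortal_external c (pos \<sigma> \<tau> n c))"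
proof -
  have E: "tree_rv (\<lambda>c. external c (pos \<sigma> \<tau> n c))"
    by (rule tree_rv_bind[where H = "\<lambda>s c. external c s", OF tree_rv_pos], rule tree_rv_external)
       (use legal_pos[OF strategies] in \<open>simp add: legal_def\<close>)
  show ?thesis
    unfolding immortal_external_def using finite_external[OF legal_pos[OF strategies]]
    by (intro tree_rv_bind[where H = "\<lambda>E c. {v \<in> E. infinite (gw_tree (reroot v c))}", OF E]
        tree_rv_finite_Collect tree_rv_Not tree_rv_reroot tree_rv_finite_gw_tree)
qed

lemma tree_rv_lives: "tree_rv (\<lambda>c. lives c (pos \<sigma> \<tau> n c))"
  unfolding lives_def by (rule tree_rv_comp[OF tree_rv_immortal_external])

end

section \<open>Greedy strategies\<close>

text \<open>The same strategy is optimal for both players.\<close>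

definition greedy :: strategy where
  "greedy h = (case last h of (I, E, S) \<Rightarrow>
     if \<exists>v\<in>E. S v = Some \<infinity> then SOME v. v \<in> E \<and> S v = Some \<infinity> else SOME v. v \<in> E)"

lemma greedy_strategies: "greedy \<in> strategies"
proof -
  have "greedy (h @ [(I, E, S)]) \<in> E" if "E \<noteq> {}" for h I E S
  proof (cases "\<exists>v\<in>E. S v = Some \<infinity>")
    case True
    then have "(SOME v. v \<in> E \<and> S v = Some \<infinity>) \<in> E" by (metis (mono_tags, lifting) someI_ex)
    with True show ?thesis by (simp add: greedy_def)
  next
    case False
    then show ?thesis using that some_in_eq[of E] by (simp add: greedy_def)
  qed
  then show ?thesis by (simp add: strategies_def)
qed

lemma greedy_immortal:
  assumes "legal c s" "immortal_external c s \<noteq> {}"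
  shows "greedy (h @ [observe c s]) \<in> immortal_external c s"
proof -
  define S where "S = (\<lambda>v. Some (subtree_size c v)) |` (internal c s \<union> external c s)"
  have S: "v \<in> external c s \<and> S v = Some \<infinity> \<longleftrightarrow> v \<in> immortal_external c s" for v
    using assms(1)
    by (auto simp: S_def immortal_external_def external_legal subtree_size_def finite_subtree_iff split: if_splits)
  have "greedy (h @ [observe c s]) = (SOME v. v \<in> immortal_external c s)"
    using assms(2) S by (auto simp: greedy_def observe_def S_def[symmetric])
  then show ?thesis using assms(2) by (simp add: some_in_eq)
qed

section \<open>Winning probabilities\<close>

context
  fixes \<sigma> \<tau> :: strategy
  assumes strategies: "\<sigma> \<in> strategies" "\<tau> \<in> strategies"
begin

section \<open>Expected potentials along a play\<close>

abbreviation "L n c \<equiv> lives c (pos \<sigma> \<tau> n c)"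
abbreviation "hits n c \<equiv> choice \<sigma> \<tau> n c \<in> immortal_external c (pos \<sigma> \<tau> n c)"

lemma hits_imp_lives: "hits n c \<Longrightarrow> 0 < L n c"
  using lives_eq_0_iff[OF legal_pos[OF strategies], of c n] by auto

lemma lives_imp_infinite: "0 < L n c \<Longrightarrow> infinite (gw_tree c)"
  by (rule infinite_if_lives[OF legal_pos[OF strategies]])

lemma tree_rv_hits: "tree_rv (\<lambda>c. hits n c)"
  using tree_rv_choice[OF strategies] tree_rv_immortal_external[OF strategies]
  by (rule tree_rv_comp2)

lemma integrable_state:
  fixes f :: "bool \<Rightarrow> bool \<Rightarrow> nat \<Rightarrow> nat \<Rightarrow> real"
  assumes "\<And>a b k l. \<bar>f a b k l\<bar> \<le> 1"
  shows "integrable (GW xi) (\<lambda>c. f (infinite (gw_tree c)) (hits n c) (L n c) (L (Suc n) c))"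
proof (rule integrable_tree_rv)
  have "tree_rv (\<lambda>c. f (infinite (gw_tree c)) (hits n c))"
    using tree_rv_survives tree_rv_hits by (rule tree_rv_comp2)
  from tree_rv_comp2[where G = "\<lambda>g k. g k", OF this tree_rv_lives[OF strategies, of n]]
  have "tree_rv (\<lambda>c. f (infinite (gw_tree c)) (hits n c) (L n c))" .
  from tree_rv_comp2[where G = "\<lambda>g k. g k", OF this tree_rv_lives[OF strategies, of "Suc n"]]
  show "tree_rv (\<lambda>c. f (infinite (gw_tree c)) (hits n c) (L n c) (L (Suc n) c))" .
qed (rule assms)

text \<open>A hit replaces L - 1 by (L - 1) + (K - 1), where K belongs to the subtree at the chosen
  node. The choice and the value of L before the move are unaffected by exchanging this subtree for
  another infinite one, so it acts as a fresh surviving tree and contributes the factor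
  \<phi>(y).\<close>

lemma maker_hits:
  assumes q: "extinction_prob xi < 1" and n: "odd n" and y: "0 \<le> y" "y \<le> 1"
  shows "(\<integral>c. of_bool (hits n c) * y ^ (L (Suc n) c - 1) \<partial>GW xi)
    = offspring_pgf (excess_pmf xi) y * (\<integral>c. of_bool (hits n c) * y ^ (L n c - 1) \<partial>GW xi)"
proof -
  let ?V = "choice \<sigma> \<tau> n"
  have indep: "(\<integral>c. of_bool (hits n c) * y ^ (L n c - 1) * y ^ (broods (reroot (?V c) c) - 1) \<partial>GW xi)
      * measure (GW xi) {c. infinite (gw_tree c)}
    = (\<integral>c. of_bool (hits n c) * y ^ (L n c - 1) \<partial>GW xi)
      * (\<integral>c. of_bool (infinite (gw_tree c)) * y ^ (broods c - 1) \<partial>GW xi)"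
  proof (rule GW_indep_selected_subtree[where A = 1 and D = 1])
    show "tree_rv (\<lambda>c. y ^ (L n c - 1))"
      using tree_rv_lives[OF strategies] by (rule tree_rv_comp)
    show "tree_rv (\<lambda>c. y ^ (broods c - 1))"
      using tree_rv_broods by (rule tree_rv_comp)
    show "hits n (graft (?V c) c d) \<and> ?V (graft (?V c) c d) = ?V c \<and>
        y ^ (L n (graft (?V c) c d) - 1) = y ^ (L n c - 1)"
      if "hits n c" "infinite (gw_tree d)" for c d
      using pos_graft[OF strategies that] choice_graft[OF strategies that]
        immortal_external_pos_graft[OF strategies that] that
      by (simp add: lives_def)
  qed (use y tree_rv_hits tree_rv_choice[OF strategies] in \<open>auto simp: power_le_one immortal_external_def\<close>)
  have step: "of_bool (hits n c) * y ^ (L (Suc n) c - 1)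
      = of_bool (hits n c) * y ^ (L n c - 1) * y ^ (broods (reroot (?V c) c) - 1)" for c
  proof (cases "hits n c")
    case True
    then have "0 < L n c" "0 < broods (reroot (?V c) c)"
      by (auto intro: hits_imp_lives broods_pos simp: immortal_external_def)
    \<comment> \<open>All subtractions are genuine here because L and K are positive.\<close>
    then have "L (Suc n) c - 1 = (L n c - 1) + (broods (reroot (?V c) c) - 1)"
      using True n lives_pos_Suc[OF strategies, of c n] by simp
    then show ?thesis by (simp add: power_add)
  qed simp
  have "(1 - extinction_prob xi) * (\<integral>c. of_bool (hits n c) * y ^ (L (Suc n) c - 1) \<partial>GW xi)
    = (1 - extinction_prob xi) * (offspring_pgf (excess_pmf xi) y
        * (\<integral>c. of_bool (hits n c) * y ^ (L n c - 1) \<partial>GW xi))"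
    unfolding step using indep
    by (simp only: survival_prob_eq pgf_excess_pmf[OF q y, symmetric] mult_ac)
  then show ?thesis using q by simp
qed

text \<open>A miss leaves L unchanged and thus contributes the factor 1 \<ge> \<phi>(y): a move
  wasted by Maker never spoils the lower bound.\<close>

lemma maker_turn_ge:
  assumes q: "extinction_prob xi < 1" and n: "odd n" and y: "0 \<le> y" "y \<le> 1"
  shows "offspring_pgf (excess_pmf xi) y * (\<integral>c. of_bool (0 < L n c) * y ^ (L n c - 1) \<partial>GW xi)
    \<le> (\<integral>c. of_bool (0 < L n c) * y ^ (L (Suc n) c - 1) \<partial>GW xi)"
proof -
  let ?\<phi> = "offspring_pgf (excess_pmf xi) y"
  note bd = power_le_one of_bool_def abs_mult
  let ?miss = "\<lambda>c. of_bool (0 < L n c \<and> \<not> hits n c) :: real"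
  have int: "integrable (GW xi) (\<lambda>c. of_bool (hits n c) * y ^ (L n c - 1))"
    "integrable (GW xi) (\<lambda>c. of_bool (hits n c) * y ^ (L (Suc n) c - 1))"
    "integrable (GW xi) (\<lambda>c. ?miss c * y ^ (L n c - 1))"
    using y
    by (intro integrable_state[where f = "\<lambda>a b k l. of_bool b * y ^ (k - 1)"]
        integrable_state[where f = "\<lambda>a b k l. of_bool b * y ^ (l - 1)"]
        integrable_state[where f = "\<lambda>a b k l. of_bool (0 < k \<and> \<not> b) * y ^ (k - 1)"]; simp add: bd)+
  have split: "of_bool (0 < L n c) * z = of_bool (hits n c) * z + ?miss c * z" for c and z :: real
    using hits_imp_lives[of n c] by (auto simp: of_bool_def)
  have "of_bool (0 < L n c) * y ^ (L (Suc n) c - 1)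
      = of_bool (hits n c) * y ^ (L (Suc n) c - 1) + ?miss c * y ^ (L n c - 1)" for c
    unfolding split using lives_pos_Suc[OF strategies, of c n] by (auto simp: of_bool_def)
  then have "(\<integral>c. of_bool (0 < L n c) * y ^ (L (Suc n) c - 1) \<partial>GW xi)
      = (\<integral>c. of_bool (hits n c) * y ^ (L (Suc n) c - 1) \<partial>GW xi) + (\<integral>c. ?miss c * y ^ (L n c - 1) \<partial>GW xi)"
    using int by (simp only: Bochner_Integration.integral_add)
  also have "\<dots> = ?\<phi> * (\<integral>c. of_bool (hits n c) * y ^ (L n c - 1) \<partial>GW xi)
      + (\<integral>c. ?miss c * y ^ (L n c - 1) \<partial>GW xi)"
    by (simp only: maker_hits[OF q n y])
  finally have E: "(\<integral>c. of_bool (0 < L n c) * y ^ (L (Suc n) c - 1) \<partial>GW xi) = \<dots>" .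
  have "(\<integral>c. of_bool (0 < L n c) * y ^ (L n c - 1) \<partial>GW xi)
      = (\<integral>c. of_bool (hits n c) * y ^ (L n c - 1) \<partial>GW xi) + (\<integral>c. ?miss c * y ^ (L n c - 1) \<partial>GW xi)"
    unfolding split using int by (intro Bochner_Integration.integral_add)
  moreover have "?\<phi> * (\<integral>c. ?miss c * y ^ (L n c - 1) \<partial>GW xi) \<le> 1 * (\<integral>c. ?miss c * y ^ (L n c - 1) \<partial>GW xi)"
    using y by (intro mult_right_mono pgf_le_one Bochner_Integration.integral_nonneg) auto
  ultimately show ?thesis
    unfolding E by (simp add: distrib_left)
qed

lemma maker_turn_eq:
  assumes q: "extinction_prob xi < 1" and n: "odd n" and y: "0 \<le> y" "y \<le> 1"
    and hits: "\<And>c. 0 < L n c \<Longrightarrow> hits n c"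
  shows "(\<integral>c. of_bool (0 < L n c) * y ^ (L (Suc n) c - 1) \<partial>GW xi)
    = offspring_pgf (excess_pmf xi) y * (\<integral>c. of_bool (0 < L n c) * y ^ (L n c - 1) \<partial>GW xi)"
proof -
  have "0 < L n c \<longleftrightarrow> hits n c" for c using hits hits_imp_lives by blast
  then show ?thesis using maker_hits[OF q n y] by (simp only:)
qed

definition decided :: "nat pmf \<Rightarrow> nat \<Rightarrow> real" where
  "decided xi n = measure (GW xi) {c. infinite (gw_tree c) \<and> L n c = 0}"

text \<open>Once L = 0 it stays 0, so on decided surviving trees the integrand is
  \<open>f 0 0 = 1\<close>. The potentials satisfy this because the truncated exponent 0 - 1 is
  0.\<close>

lemma integral_survival_split:
  assumes f: "\<And>k l. 0 < k \<Longrightarrow> \<bar>f k l\<bar> \<le> 1" "f 0 0 = (1::real)"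
  shows "(\<integral>c. of_bool (infinite (gw_tree c)) * f (L n c) (L (Suc n) c) \<partial>GW xi)
    = decided xi n + (\<integral>c. of_bool (0 < L n c) * f (L n c) (L (Suc n) c) \<partial>GW xi)"
proof -
  have eq: "of_bool (infinite (gw_tree c)) * f (L n c) (L (Suc n) c)
      = of_bool (infinite (gw_tree c) \<and> L n c = 0) + of_bool (0 < L n c) * f (L n c) (L (Suc n) c)" for c
  proof (cases "L n c = 0")
    case True
    then show ?thesis
      using f(2) lives_pos_eq_0_mono[OF strategies True, of "Suc n"] by simp
  next
    case False
    then show ?thesis using lives_imp_infinite[of c n] by simp
  qed
  have int: "integrable (GW xi) (\<lambda>c. of_bool (infinite (gw_tree c) \<and> L n c = 0) :: real)"
    "integrable (GW xi) (\<lambda>c. of_bool (0 < L n c) * f (L n c) (L (Suc n) c))"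
    using f(1)
    by (intro integrable_state[where f = "\<lambda>a b k l. of_bool (a \<and> k = 0)"]
        integrable_state[where f = "\<lambda>a b k l. of_bool (0 < k) * f k l"]; simp add: of_bool_def)+
  show ?thesis
    unfolding eq using int
    by (simp only: Bochner_Integration.integral_add integral_of_bool decided_def)
qed

text \<open>L stays 0 once it is 0, so Breaker's win is the increasing union of the events decided
  at even times, that is, at his own turns.\<close>

lemma breaker_wins_survival:
  "measure (GW xi) {c. infinite (gw_tree c) \<and> breaker_wins \<sigma> \<tau> c} \<ge> decided xi n"
  "(\<And>n. decided xi (2 * n) \<le> b) \<Longrightarrow> measure (GW xi) {c. infinite (gw_tree c) \<and> breaker_wins \<sigma> \<tau> c} \<le> b"
  "tree_rv (breaker_wins \<sigma> \<tau>)"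
proof -
  interpret prob_space "GW xi" by (rule prob_space_GW)
  have rv0: "tree_rv (\<lambda>c. L n c = 0)" for n
    using tree_rv_lives[OF strategies] by (rule tree_rv_comp)
  show rv: "tree_rv (breaker_wins \<sigma> \<tau>)"
    unfolding breaker_wins_iff[OF strategies, abs_def] by (intro tree_rv_ex rv0)
  show "measure (GW xi) {c. infinite (gw_tree c) \<and> breaker_wins \<sigma> \<tau> c} \<ge> decided xi n"
    unfolding decided_def
    by (intro finite_measure_mono tree_rv_sets tree_rv_conj tree_rv_survives rv)
       (auto simp: breaker_wins_iff[OF strategies])
  have "(\<lambda>n. prob {c. infinite (gw_tree c) \<and> L (2 * n) c = 0})
      \<longlonglongrightarrow> prob (\<Union>n. {c. infinite (gw_tree c) \<and> L (2 * n) c = 0})"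
  proof (rule finite_Lim_measure_incseq)
    show "range (\<lambda>n. {c. infinite (gw_tree c) \<and> L (2 * n) c = 0}) \<subseteq> events"
      by (auto intro!: tree_rv_sets tree_rv_conj tree_rv_survives rv0)
    show "incseq (\<lambda>n. {c. infinite (gw_tree c) \<and> L (2 * n) c = 0})"
      by (auto simp: incseq_def intro: lives_pos_eq_0_mono[OF strategies])
  qed
  moreover have "(\<Union>n. {c. infinite (gw_tree c) \<and> L (2 * n) c = 0})
      = {c. infinite (gw_tree c) \<and> breaker_wins \<sigma> \<tau> c}"
  proof -
    have "\<exists>n. L (2 * n) c = 0" if "L n c = 0" for c n
      using lives_pos_eq_0_mono[OF strategies that, of "2 * n"] by auto
    then show ?thesis by (auto simp: breaker_wins_iff[OF strategies])
  qed
  ultimately show "measure (GW xi) {c. infinite (gw_tree c) \<and> breaker_wins \<sigma> \<tau> c} \<le> b"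
    if "\<And>n. decided xi (2 * n) \<le> b"
    using that by (intro LIMSEQ_le_const2) (auto simp: decided_def)
qed

lemma integral_lives_0:
  assumes "extinction_prob xi < 1" "0 \<le> y" "y \<le> 1"
  shows "(\<integral>c. of_bool (infinite (gw_tree c)) * y ^ (L 0 c - 1) \<partial>GW xi)
    = (1 - extinction_prob xi) * offspring_pgf (excess_pmf xi) y"
  using pgf_excess_pmf[OF assms] by (simp add: pos_0 lives_initial)

end

section \<open>Bounds for greedy play\<close>

lemma greedy_hits:
  assumes "\<sigma> \<in> strategies" "\<tau> \<in> strategies" "(if even n then \<sigma> else \<tau>) = greedy"
    and "0 < lives c (pos \<sigma> \<tau> n c)"
  shows "choice \<sigma> \<tau> n c \<in> immortal_external c (pos \<sigma> \<tau> n c)"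
proof -
  obtain ss where "play \<sigma> \<tau> c n = ss @ [pos \<sigma> \<tau> n c]" using play_snoc_pos by blast
  moreover have "immortal_external c (pos \<sigma> \<tau> n c) \<noteq> {}"
    using assms(4) lives_eq_0_iff[OF legal_pos[OF assms(1,2)], of c n] by auto
  ultimately show ?thesis
    unfolding choice_def assms(3) by (simp add: greedy_immortal[OF legal_pos[OF assms(1,2)]])
qed

text \<open>Against a greedy Maker, \<open>x ^ (L - 1)\<close> is a supermartingale at Breaker's turns.\<close>

lemma greedy_maker:
  assumes q: "extinction_prob xi < 1" and \<sigma>: "\<sigma> \<in> strategies"
  shows "measure (GW xi) {c. infinite (gw_tree c) \<and> breaker_wins \<sigma> greedy c}
    \<le> (1 - extinction_prob xi) * breaker_value xi"
proof (rule breaker_wins_survival(2)[OF \<sigma> greedy_strategies])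
  let ?L = "\<lambda>n c. lives c (pos \<sigma> greedy n c)"
  define x where "x = breaker_value xi"
  have x: "0 \<le> x" "x \<le> 1" "offspring_pgf (excess_pmf xi) x = x"
    using breaker_value_bounds pgf_breaker_value by (auto simp: x_def)
  define W where "W n = (\<integral>c. of_bool (infinite (gw_tree c)) * x ^ (?L n c - 1) \<partial>GW xi)" for n
  note int = integrable_state[OF \<sigma> greedy_strategies]
  \<comment> \<open>One round, followed backwards: Maker's hit gives the factor \<phi>(x) = x, this
    factor raises the exponent from L - 1 to L, and Breaker's preceding move lowered L by at most
    one.\<close>
  have step: "W (Suc (Suc n)) \<le> W n" if "even n" for n
  proof -
    have "W (Suc (Suc n)) = decided \<sigma> greedy xi (Suc n)
        + (\<integral>c. of_bool (0 < ?L (Suc n) c) * x ^ (?L (Suc (Suc n)) c - 1) \<partial>GW xi)"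
      unfolding W_def using x
      by (intro integral_survival_split[OF \<sigma> greedy_strategies, where f = "\<lambda>k l. x ^ (l - 1)"])
         (auto simp: power_le_one)
    also have "(\<integral>c. of_bool (0 < ?L (Suc n) c) * x ^ (?L (Suc (Suc n)) c - 1) \<partial>GW xi)
        = x * (\<integral>c. of_bool (0 < ?L (Suc n) c) * x ^ (?L (Suc n) c - 1) \<partial>GW xi)"
      using maker_turn_eq[OF \<sigma> greedy_strategies q _ x(1,2), of "Suc n"] that x(3)
        greedy_hits[OF \<sigma> greedy_strategies, of "Suc n"] by simp
    also have "\<dots> = (\<integral>c. x * (of_bool (0 < ?L (Suc n) c) * x ^ (?L (Suc n) c - 1)) \<partial>GW xi)"
      by simp
    also have "\<dots> = (\<integral>c. of_bool (0 < ?L (Suc n) c) * x ^ ?L (Suc n) c \<partial>GW xi)"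
    proof (rule Bochner_Integration.integral_cong[OF refl])
      fix c show "x * (of_bool (0 < ?L (Suc n) c) * x ^ (?L (Suc n) c - 1))
          = of_bool (0 < ?L (Suc n) c) * x ^ ?L (Suc n) c"
        by (cases "?L (Suc n) c") auto
    qed
    also have "decided \<sigma> greedy xi (Suc n) + \<dots>
        = (\<integral>c. of_bool (infinite (gw_tree c)) * x ^ ?L (Suc n) c \<partial>GW xi)"
      using x
      by (intro integral_survival_split[OF \<sigma> greedy_strategies, where f = "\<lambda>k l. x ^ k", symmetric])
         (auto simp: power_le_one)
    also have "\<dots> \<le> W n"
      unfolding W_def
    proof (rule integral_mono)
      show "integrable (GW xi) (\<lambda>c. of_bool (infinite (gw_tree c)) * x ^ ?L (Suc n) c)"
        using x by (intro int[where f = "\<lambda>a b k l. of_bool a * x ^ l"]) (simp add: abs_mult power_le_one of_bool_def)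
      show "integrable (GW xi) (\<lambda>c. of_bool (infinite (gw_tree c)) * x ^ (?L n c - 1))"
        using x by (intro int[where f = "\<lambda>a b k l. of_bool a * x ^ (k - 1)"]) (simp add: abs_mult power_le_one of_bool_def)
      show "of_bool (infinite (gw_tree c)) * x ^ ?L (Suc n) c \<le> of_bool (infinite (gw_tree c)) * x ^ (?L n c - 1)" for c
        using x that lives_pos_Suc[OF \<sigma> greedy_strategies, of c n]
        by (intro mult_left_mono power_decreasing) auto
    qed
    finally show ?thesis .
  qed
  fix n
  have "W (2 * n) \<le> W 0"
    by (induction n) (auto intro: order_trans[OF step])
  also have "W 0 = (1 - extinction_prob xi) * x"
    unfolding W_def using integral_lives_0[OF \<sigma> greedy_strategies q x(1,2)] x(3) by simp
  finally have "W (2 * n) \<le> (1 - extinction_prob xi) * x" .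
  moreover have "decided \<sigma> greedy xi (2 * n) \<le> W (2 * n)"
  proof -
    have "W (2 * n) = decided \<sigma> greedy xi (2 * n) + (\<integral>c. of_bool (0 < ?L (2 * n) c) * x ^ (?L (2 * n) c - 1) \<partial>GW xi)"
      unfolding W_def using x
      by (intro integral_survival_split[OF \<sigma> greedy_strategies, where f = "\<lambda>k l. x ^ (k - 1)"])
         (auto simp: power_le_one)
    moreover have "(\<integral>c. of_bool (0 < ?L (2 * n) c) * x ^ (?L (2 * n) c - 1) \<partial>GW xi) \<ge> 0"
      using x by (intro Bochner_Integration.integral_nonneg) auto
    ultimately show ?thesis by simp
  qed
  ultimately show "decided \<sigma> greedy xi (2 * n) \<le> (1 - extinction_prob xi) * breaker_value xi"
    by (simp add: x_def)
qed

text \<open>For \<open>y\<close> below the least fixed point, \<open>y ^ (L - 1)\<close> gains a fixed factor in every round that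
  does not start with \<open>L \<le> 1\<close>. As it is bounded, the contribution of these rounds tends to 0.\<close>

lemma greedy_breaker_below:
  assumes q: "extinction_prob xi < 1" and \<tau>: "\<tau> \<in> strategies" and y: "0 \<le> y" "y < breaker_value xi"
  shows "(1 - extinction_prob xi) * y \<le> measure (GW xi) {c. infinite (gw_tree c) \<and> breaker_wins greedy \<tau> c}"
proof -
  interpret prob_space "GW xi" by (rule prob_space_GW)
  let ?L = "\<lambda>n c. lives c (pos greedy \<tau> n c)"
  let ?\<phi> = "offspring_pgf (excess_pmf xi) y"
  let ?w = "measure (GW xi) {c. infinite (gw_tree c) \<and> breaker_wins greedy \<tau> c}"
  have y1: "y \<le> 1" and \<phi>: "y < ?\<phi>"
    using y breaker_value_bounds[of xi] less_pgf_below_breaker_value[of y xi] by auto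
  define W where "W n = (\<integral>c. of_bool (infinite (gw_tree c)) * y ^ (?L n c - 1) \<partial>GW xi)" for n
  define A where "A n = (\<integral>c. of_bool (0 < ?L (Suc n) c) * y ^ (?L (Suc n) c - 1) \<partial>GW xi)" for n
  have A0: "0 \<le> A n" for n
    unfolding A_def using y by (intro Bochner_Integration.integral_nonneg) auto
  \<comment> \<open>A greedy Breaker always hits while L > 0; at L = 0 truncation keeps the formula
    true.\<close>
  have L_Suc: "?L (Suc n) c = ?L n c - 1" if "even n" for n c
    using lives_pos_Suc[OF greedy_strategies \<tau>, of c n] that
      greedy_hits[OF greedy_strategies \<tau>, of n c] by (cases "?L n c = 0") auto
  have W_eq: "W n = decided greedy \<tau> xi (Suc n) + y * A n" if "even n" for n
  proof -
    have "W n = (\<integral>c. of_bool (infinite (gw_tree c)) * y ^ ?L (Suc n) c \<partial>GW xi)"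
      unfolding W_def by (simp only: L_Suc[OF that])
    also have "\<dots> = decided greedy \<tau> xi (Suc n) + (\<integral>c. of_bool (0 < ?L (Suc n) c) * y ^ ?L (Suc n) c \<partial>GW xi)"
      using y(1) y1 by (intro integral_survival_split[OF greedy_strategies \<tau>, where f = "\<lambda>k l. y ^ k"])
         (auto simp: power_le_one)
    also have "(\<integral>c. of_bool (0 < ?L (Suc n) c) * y ^ ?L (Suc n) c \<partial>GW xi)
        = (\<integral>c. y * (of_bool (0 < ?L (Suc n) c) * y ^ (?L (Suc n) c - 1)) \<partial>GW xi)"
    proof (rule Bochner_Integration.integral_cong[OF refl])
      fix c show "of_bool (0 < ?L (Suc n) c) * y ^ ?L (Suc n) c
          = y * (of_bool (0 < ?L (Suc n) c) * y ^ (?L (Suc n) c - 1))"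
        by (cases "?L (Suc n) c") auto
    qed
    also have "\<dots> = y * A n" by (simp add: A_def)
    finally show ?thesis .
  qed
  \<comment> \<open>In \<open>W n\<close> the undecided part \<open>A n\<close> carries the weight
    y, whereas Maker's move multiplies it by at least \<phi>(y) > y.\<close>
  have step: "W n + (?\<phi> - y) * A n \<le> W (Suc (Suc n))" if "even n" for n
  proof -
    have "W (Suc (Suc n)) = decided greedy \<tau> xi (Suc n)
        + (\<integral>c. of_bool (0 < ?L (Suc n) c) * y ^ (?L (Suc (Suc n)) c - 1) \<partial>GW xi)"
      unfolding W_def using y(1) y1
      by (intro integral_survival_split[OF greedy_strategies \<tau>, where f = "\<lambda>k l. y ^ (l - 1)"])
         (auto simp: power_le_one)
    moreover have "?\<phi> * A n \<le> (\<integral>c. of_bool (0 < ?L (Suc n) c) * y ^ (?L (Suc (Suc n)) c - 1) \<partial>GW xi)"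
      unfolding A_def using that by (intro maker_turn_ge[OF greedy_strategies \<tau> q _ y(1) y1]) simp
    ultimately show ?thesis using W_eq[OF that] by (simp add: algebra_simps)
  qed
  have sum: "W 0 + (?\<phi> - y) * (\<Sum>k<m. A (2 * k)) \<le> W (2 * m)" for m
  proof (induction m)
    case (Suc m)
    then show ?case using step[of "2 * m"] by (simp add: algebra_simps)
  qed simp
  have W1: "W n \<le> 1" for n
  proof -
    have "W n \<le> (\<integral>c. 1 \<partial>GW xi)"
      unfolding W_def using y(1) y1
      by (intro integral_mono integrable_state[OF greedy_strategies \<tau>, where f = "\<lambda>a b k l. of_bool a * y ^ (k - 1)"])
         (auto simp: abs_mult power_le_one of_bool_def)
    then show ?thesis using prob_space by simp
  qed
  have W0: "W 0 = (1 - extinction_prob xi) * ?\<phi>"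
    unfolding W_def by (rule integral_lives_0[OF greedy_strategies \<tau> q y(1) y1])
  \<comment> \<open>If every round gained at least (\<phi>(y) - y) e, the potential \<open>W\<close>
    would eventually exceed its bound 1.\<close>
  have small: "\<exists>k. A (2 * k) \<le> e" if e: "0 < e" for e
  proof (rule ccontr)
    assume "\<not> ?thesis"
    then have A: "e \<le> A (2 * k)" for k by (meson less_imp_le not_less)
    obtain m :: nat where m: "1 < real m * ((?\<phi> - y) * e)"
      using reals_Archimedean3[of "(?\<phi> - y) * e"] \<phi> e by auto
    have "real m * e \<le> (\<Sum>k<m. A (2 * k))"
      using sum_bounded_below[of "{..<m}" e "\<lambda>k. A (2 * k)"] A by simp
    then have "(?\<phi> - y) * (real m * e) \<le> (?\<phi> - y) * (\<Sum>k<m. A (2 * k))"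
      using \<phi> by (intro mult_left_mono) auto
    moreover have "0 \<le> W 0"
      unfolding W0 using y(1) y1 extinction_prob_bounds[of xi] by (intro mult_nonneg_nonneg pgf_nonneg) auto
    ultimately show False using sum[of m] W1[of "2 * m"] m by (simp add: mult_ac)
  qed
  show ?thesis
  proof (rule field_le_epsilon)
    fix e :: real assume "0 < e"
    from small[OF this] obtain k where k: "A (2 * k) \<le> e" by blast
    have "(1 - extinction_prob xi) * y \<le> W 0"
      unfolding W0 using \<phi> q by (intro mult_left_mono) auto
    also have "\<dots> \<le> W (2 * k)"
    proof -
      have "0 \<le> (?\<phi> - y) * (\<Sum>j<k. A (2 * j))" using \<phi> A0 by (intro mult_nonneg_nonneg sum_nonneg) auto
      then show ?thesis using sum[of k] by simp
    qed
    also have "\<dots> = decided greedy \<tau> xi (Suc (2 * k)) + y * A (2 * k)" by (rule W_eq) simp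
    also have "\<dots> \<le> ?w + e"
      using breaker_wins_survival(1)[OF greedy_strategies \<tau>, of xi "Suc (2 * k)"] k A0[of "2 * k"]
        mult_right_mono[OF y1 A0[of "2 * k"]] by simp
    finally show "(1 - extinction_prob xi) * y \<le> ?w + e" .
  qed
qed

text \<open>The strict gain per round exists only below the fixed point, so the bound at the fixed
  point itself is reached by letting y increase to it.\<close>

lemma greedy_breaker:
  assumes q: "extinction_prob xi < 1" and \<tau>: "\<tau> \<in> strategies"
  shows "(1 - extinction_prob xi) * breaker_value xi
    \<le> measure (GW xi) {c. infinite (gw_tree c) \<and> breaker_wins greedy \<tau> c}" (is "_ \<le> ?w")
proof -
  have "breaker_value xi \<le> ?w / (1 - extinction_prob xi)"
  proof (rule dense_le)
    fix y assume y: "y < breaker_value xi"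
    show "y \<le> ?w / (1 - extinction_prob xi)"
    proof (cases "0 \<le> y")
      case True
      then show ?thesis using greedy_breaker_below[OF q \<tau> True y] q by (simp add: field_simps)
    next
      case False
      moreover have "0 \<le> ?w / (1 - extinction_prob xi)" using q by simp
      ultimately show ?thesis by linarith
    qed
  qed
  then show ?thesis using q by (simp add: field_simps)
qed

section \<open>From bounds to minimax values\<close>

lemma win_prob_eq:
  assumes "\<sigma> \<in> strategies" "\<tau> \<in> strategies"
  shows "win_prob xi \<sigma> \<tau>
    = extinction_prob xi + measure (GW xi) {c. infinite (gw_tree c) \<and> breaker_wins \<sigma> \<tau> c}"
proof -
  interpret prob_space "GW xi" by (rule prob_space_GW)
  \<comment> \<open>On a finite tree L = 0 at time 0 already; this is the source of the summand
    q.\<close>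
  have "breaker_wins \<sigma> \<tau> c" if "finite (gw_tree c)" for c
    using that unfolding breaker_wins_iff[OF assms]
    by (intro exI[of _ 0]) (simp add: pos_0 lives_initial broods_eq_0)
  then have "{c. breaker_wins \<sigma> \<tau> c}
      = {c. finite (gw_tree c)} \<union> {c. infinite (gw_tree c) \<and> breaker_wins \<sigma> \<tau> c}"
    by auto
  moreover have "prob ({c. finite (gw_tree c)} \<union> {c. infinite (gw_tree c) \<and> breaker_wins \<sigma> \<tau> c})
      = prob {c. finite (gw_tree c)} + prob {c. infinite (gw_tree c) \<and> breaker_wins \<sigma> \<tau> c}"
    by (intro finite_measure_Union tree_rv_sets tree_rv_finite_gw_tree tree_rv_conj tree_rv_survives
        breaker_wins_survival(3)[OF assms]) auto
  ultimately show ?thesis by (simp add: win_prob_def extinction_prob_eq)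
qed

lemma win_prob_given_survival_eq:
  assumes "extinction_prob xi < 1"
  shows "win_prob_given_survival xi \<sigma> \<tau>
    = measure (GW xi) {c. infinite (gw_tree c) \<and> breaker_wins \<sigma> \<tau> c} / (1 - extinction_prob xi)"
  using assms by (simp add: win_prob_given_survival_def cond_prob_def survival_prob_eq conj_commute)

text \<open>A saddle point (\<open>\<sigma>0\<close>, \<open>\<tau>0\<close>) fixes both minimax
  values. The bounds \<open>a\<close> and \<open>b\<close> give meaning to the infima and suprema of
  reals.\<close>

lemma game_valueI:
  assumes bounds: "\<And>\<sigma> \<tau>. \<sigma> \<in> strategies \<Longrightarrow> \<tau> \<in> strategies \<Longrightarrow> a \<le> w \<sigma> \<tau> \<and> w \<sigma> \<tau> \<le> b"
    and \<sigma>0: "\<sigma>0 \<in> strategies" "\<And>\<tau>. \<tau> \<in> strategies \<Longrightarrow> p \<le> w \<sigma>0 \<tau>"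
    and \<tau>0: "\<tau>0 \<in> strategies" "\<And>\<sigma>. \<sigma> \<in> strategies \<Longrightarrow> w \<sigma> \<tau>0 \<le> p"
  shows "game_value w p"
  unfolding game_value_def
proof (intro conjI antisym)
  have ne: "strategies \<noteq> {}" using \<sigma>0 by blast
  have below: "bdd_below (w \<sigma> ` strategies)" if "\<sigma> \<in> strategies" for \<sigma>
    using bounds[OF that] by (intro bdd_belowI2[of _ a]) auto
  have above: "bdd_above ((\<lambda>\<sigma>. w \<sigma> \<tau>) ` strategies)" if "\<tau> \<in> strategies" for \<tau>
    using bounds[OF _ that] by (intro bdd_aboveI2[of _ _ b]) auto
  have inf_le: "(INF \<tau>\<in>strategies. w \<sigma> \<tau>) \<le> p" if "\<sigma> \<in> strategies" for \<sigma>
    using that \<tau>0 by (intro cINF_lower2[OF below[OF that] \<tau>0(1)]) auto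
  have le_sup: "p \<le> (SUP \<sigma>\<in>strategies. w \<sigma> \<tau>)" if "\<tau> \<in> strategies" for \<tau>
    using that \<sigma>0 by (intro cSUP_upper2[OF above[OF that] \<sigma>0(1)]) auto
  show "(SUP \<sigma>\<in>strategies. INF \<tau>\<in>strategies. w \<sigma> \<tau>) \<le> p"
    using ne inf_le by (intro cSUP_least)
  show "p \<le> (INF \<tau>\<in>strategies. SUP \<sigma>\<in>strategies. w \<sigma> \<tau>)"
    using ne le_sup by (intro cINF_greatest)
  have "p \<le> (INF \<tau>\<in>strategies. w \<sigma>0 \<tau>)"
    using ne \<sigma>0 by (intro cINF_greatest) auto
  also have "\<dots> \<le> (SUP \<sigma>\<in>strategies. INF \<tau>\<in>strategies. w \<sigma> \<tau>)"
    using \<sigma>0(1) inf_le by (intro cSUP_upper bdd_aboveI2[of _ _ p]) auto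
  finally show "p \<le> (SUP \<sigma>\<in>strategies. INF \<tau>\<in>strategies. w \<sigma> \<tau>)" .
  have "(INF \<tau>\<in>strategies. SUP \<sigma>\<in>strategies. w \<sigma> \<tau>) \<le> (SUP \<sigma>\<in>strategies. w \<sigma> \<tau>0)"
    using \<tau>0(1) le_sup by (intro cINF_lower bdd_belowI2[of _ p]) auto
  also have "\<dots> \<le> p"
    using ne \<tau>0 by (intro cSUP_least) auto
  finally show "(INF \<tau>\<in>strategies. SUP \<sigma>\<in>strategies. w \<sigma> \<tau>) \<le> p" .
qed

text \<open>For q < 1 the unconditional payoff is an increasing affine function of the conditional
  one, so \<open>greedy\<close> against \<open>greedy\<close> is a saddle point for both.\<close>

lemma game_values:
  assumes q: "extinction_prob xi < 1"
  shows "game_value (win_prob_given_survival xi) (breaker_value xi)"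
    and "game_value (win_prob xi) (extinction_prob xi + (1 - extinction_prob xi) * breaker_value xi)"
proof -
  interpret prob_space "GW xi" by (rule prob_space_GW)
  let ?W = "\<lambda>\<sigma> \<tau>. measure (GW xi) {c. infinite (gw_tree c) \<and> breaker_wins \<sigma> \<tau> c}"
  show "game_value (win_prob_given_survival xi) (breaker_value xi)"
  proof (rule game_valueI[OF _ greedy_strategies _ greedy_strategies])
    show "0 \<le> win_prob_given_survival xi \<sigma> \<tau> \<and>
        win_prob_given_survival xi \<sigma> \<tau> \<le> 1 / (1 - extinction_prob xi)" for \<sigma> \<tau>
      unfolding win_prob_given_survival_eq[OF q] using q by (simp add: divide_right_mono)
    show "breaker_value xi \<le> win_prob_given_survival xi greedy \<tau>" if "\<tau> \<in> strategies" for \<tau>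
      unfolding win_prob_given_survival_eq[OF q] using q greedy_breaker[OF q that] by (simp add: field_simps)
    show "win_prob_given_survival xi \<sigma> greedy \<le> breaker_value xi" if "\<sigma> \<in> strategies" for \<sigma>
      unfolding win_prob_given_survival_eq[OF q] using q greedy_maker[OF q that] by (simp add: field_simps)
  qed
  show "game_value (win_prob xi) (extinction_prob xi + (1 - extinction_prob xi) * breaker_value xi)"
  proof (rule game_valueI[OF _ greedy_strategies _ greedy_strategies])
    show "0 \<le> win_prob xi \<sigma> \<tau> \<and> win_prob xi \<sigma> \<tau> \<le> 1" for \<sigma> \<tau>
      by (simp add: win_prob_def)
    show "extinction_prob xi + (1 - extinction_prob xi) * breaker_value xi \<le> win_prob xi greedy \<tau>"
      if "\<tau> \<in> strategies" for \<tau>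
      using greedy_breaker[OF q that] win_prob_eq[OF greedy_strategies that] by simp
    show "win_prob xi \<sigma> greedy \<le> extinction_prob xi + (1 - extinction_prob xi) * breaker_value xi"
      if "\<sigma> \<in> strategies" for \<sigma>
      using greedy_maker[OF q that] win_prob_eq[OF that greedy_strategies] by simp
  qed
qed

lemma game_value_extinct:
  assumes "extinction_prob xi = 1"
  shows "game_value (win_prob xi) 1"
proof (rule game_valueI[OF _ greedy_strategies _ greedy_strategies])
  interpret prob_space "GW xi" by (rule prob_space_GW)
  show "0 \<le> win_prob xi \<sigma> \<tau> \<and> win_prob xi \<sigma> \<tau> \<le> 1" for \<sigma> \<tau>
    by (simp add: win_prob_def)
  show "win_prob xi \<sigma> greedy \<le> 1" for \<sigma>
    by (simp add: win_prob_def)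
  show "1 \<le> win_prob xi greedy \<tau>" if "\<tau> \<in> strategies" for \<tau>
    using win_prob_eq[OF greedy_strategies that, of xi] assms by simp
qed

theorem theorem6p4:
  fixes xi :: "nat pmf"
  shows "let q = extinction_prob xi; g = offspring_pgf xi; \<mu> = offspring_mean xi;
             solution = (\<lambda>x::real. x\<^sup>2 * (1 - q) = g (x * (1 - q) + q) - q)
         in \<exists>p. game_value (win_prob_given_survival xi) p
              \<and> game_value (win_prob xi) (q + (1 - q) * p)
              \<and> solution p
              \<and> (\<mu> \<le> 2 \<and> pmf xi 2 \<noteq> 1 \<longrightarrow> p = 1)
              \<and> ((AE k in measure_pmf xi. 2 \<le> k) \<longrightarrow> p = 0)
              \<and> (\<mu> > 2 \<and> pmf xi 0 + pmf xi 1 > 0 \<longrightarrow>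
                    0 < p \<and> p < 1 \<and> (\<forall>x. 0 < x \<and> x < 1 \<and> solution x \<longrightarrow> x = p))"
proof (cases "extinction_prob xi < 1")
  case True
  show ?thesis
    unfolding Let_def
  proof (intro exI[of _ "breaker_value xi"] conjI impI allI)
    show "game_value (win_prob_given_survival xi) (breaker_value xi)"
      and "game_value (win_prob xi) (extinction_prob xi + (1 - extinction_prob xi) * breaker_value xi)"
      by (rule game_values[OF True])+
  qed (use breaker_value_solution[OF True] breaker_value_eq_1[OF True] breaker_value_eq_0[of xi]
        breaker_value_supercritical[of xi] in blast)+
next
  case False
  \<comment> \<open>Under almost sure extinction p = 1 and the equation reads 0 = 0; the hypotheses
    of the other two cases would each imply q < 1.\<close>
  then have q: "extinction_prob xi = 1" using extinction_prob_bounds[of xi] by simp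
  then have "win_prob_given_survival xi = win_prob xi"
    by (simp add: win_prob_given_survival_def fun_eq_iff)
  moreover have "\<not> (AE k in measure_pmf xi. 2 \<le> k)"
    using breaker_value_eq_0(1)[of xi] q by auto
  moreover have "\<not> offspring_mean xi > 2"
    using extinction_prob_less_one[of xi] q less_trans[of 1 "2 :: ennreal" "offspring_mean xi"] by auto
  ultimately show ?thesis
    unfolding Let_def q using game_value_extinct[OF q] by (intro exI[of _ 1]) simp
qed

end
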